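(* Let $U:\mathbb{R}^n\to\mathbb{R}$ be of class $C^2$, let $\Omega\subset\mathbb{R}^n$ be a connected component of $\{x\in\mathbb{R}^n:U(x)>0\}$, and assume that $\partial\Omega$ is compact and is the union of $N$ distinct nonempty connected components $\Gamma_1,\ldots,\Gamma_N$, all of positive diameter. Assume: (a) $N\geq 2$ and, if $\Omega$ is unbounded, there are $r_0>0$ and a non-negative function $\sigma:[r_0,+\infty)\to\mathbb{R}$ such that $\int_{r_0}^{+\infty}\sigma(r)\,dr=+\infty$ and $\sqrt{U(x)}\geq\sigma(|x|)$ for all $x\in\Omega$ with $|x|\geq r_0$; (b) the set $P$ of critical points of $U$ contained in $\partial\Omega$ is finite (possibly empty) and every $p\in P$ is a hyperbolic critical point of $U$. Then for each $\Gamma_-\in\{\Gamma_1,\ldots,\Gamma_N\}$ there exist $\Gamma_+\in\{\Gamma_1,\ldots,\Gamma_N\}\setminus\{\Gamma_-\}$, real numbers $T_-<T_+$, and a map $v^*:\mathbb{R}\to\overline{\Omega}$, periodic with period $T=2(T_+-T_-)$, such that $$\ddot v^*=\nabla U(v^* ),\qquad \tfrac12|\dot v^*|^2-U(v^* )=0\quad\text{on }\mathbb{R},$$ and $v^*$ oscillates between $\Gamma_-$ and $\Gamma_+$ in the sense that $v^*(T_-+kT)\in\Gamma_-$ and $v^*(T_++kT)\in\Gamma_+$ for every $k\in\mathbb{Z}$, while $v^*(t)\in\Omega$ for all other $t\in\mathbb{R}$.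
   Context: A critical point $p$ of $U$ is hyperbolic if the Hessian of $U$ at $p$ is nonsingular. *)

theory Defs
  imports "HOL-Analysis.Analysis"
begin

text \<open>The values of the next two definitions are meaningful only at points of
  differentiability of \<open>f\<close> and of its gradient respectively; \<open>C2_function\<close> below
  guarantees this everywhere.\<close>

definition gradient :: "(real^'n \<Rightarrow> real) \<Rightarrow> real^'n \<Rightarrow> real^'n" where
  "gradient f x = (THE D. GDERIV f x :> D)"

definition hessian :: "(real^'n \<Rightarrow> real) \<Rightarrow> real^'n \<Rightarrow> real^'n^'n" where
  "hessian f x = jacobian (gradient f) (at x)"

definition C2_function :: "(real^'n \<Rightarrow> real) \<Rightarrow> bool" where
  "C2_function f \<longleftrightarrow>
     f differentiable_on UNIV \<and> gradient f differentiable_on UNIV \<and>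
     continuous_on UNIV (hessian f)"

definition critical_point :: "(real^'n \<Rightarrow> real) \<Rightarrow> real^'n \<Rightarrow> bool" where
  "critical_point f p \<longleftrightarrow> gradient f p = 0"

definition hyperbolic_critical_point :: "(real^'n \<Rightarrow> real) \<Rightarrow> real^'n \<Rightarrow> bool" where
  "hyperbolic_critical_point f p \<longleftrightarrow> critical_point f p \<and> invertible (hessian f p)"

text \<open>\<open>\<sigma>\<close> is integrable on each \<open>[r\<^sub>0, R]\<close> and its improper integral over
  \<open>[r\<^sub>0, +\<infinity>)\<close> is \<open>+\<infinity>\<close>. Without local integrability, an infinite integral
  could be caused by a singularity at a finite radius.\<close>

definition improper_integral_diverges :: "(real \<Rightarrow> real) \<Rightarrow> real \<Rightarrow> bool" where
  "improper_integral_diverges \<sigma> r0 \<longleftrightarrow>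
     (\<forall>R\<ge>r0. \<sigma> integrable_on {r0..R}) \<and>
     filterlim (\<lambda>R. integral {r0..R} \<sigma>) at_top at_top"

end

theory Submission
  imports Defs "HOL-Complex_Analysis.Great_Picard"
begin

text \<open>Minimise the action \<open>\<integral> |v'|\<^sup>2/2 + U(v)\<close> over curves in \<open>\<Omega>\<close>, of arbitrary duration, from
  \<open>A = \<Gamma>\<^sub>m\<close> to the rest \<open>B\<close> of the boundary. Every competitor crosses a compact subset of \<open>\<Omega>\<close> that
  separates \<open>A\<close> from \<open>B\<close>; starting the clock there, a minimising sequence, bounded by the growth
  hypothesis and equi-Hoelder by its action bound, converges locally uniformly to a curve \<open>v\<close> with
  \<open>v 0 \<in> \<Omega>\<close>. While \<open>v\<close> is in \<open>\<Omega>\<close>, replacing pieces of the approximating curves shows that \<open>v\<close> solves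
  \<open>v'' = \<nabla>U(v)\<close>, has nonnegative second variation and has energy at most zero; the energy is zero
  because \<open>U(v)\<close> tends to \<open>0\<close> along \<open>v\<close>.

  If \<open>v\<close> stayed in \<open>\<Omega>\<close> forever, it would spend arbitrarily long time intervals near a critical point
  \<open>q \<in> \<partial>\<Omega>\<close>. As \<open>q\<close> is nondegenerate and not isolated in the zero set of \<open>U\<close>, the Hessian at \<open>q\<close> has a
  negative direction, and perturbing \<open>v\<close> in that direction makes the second variation negative. So \<open>v\<close>
  reaches the boundary in finite time in both directions; it arrives in \<open>B\<close> (in \<open>A\<close> backwards), since
  otherwise a shortcut to the boundary would lower the action below its infimum. There it arrives with
  zero velocity, so that reflection at the end points gives the periodic orbit.\<close>

section \<open>Curves of finite energy\<close>

text \<open>Competitors are continuous curves, differentiable off a finite set, whose speed has an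
  integrable square; the velocity \<open>w\<close> is carried along as data. Instead a smooth
  perturbation is added to the approximating curves, and integration by parts moves the derivative
  onto the perturbation: the change of action then depends on the curves alone, which converge
  uniformly, and not on their velocities, which need not converge. The duration is free because
  varying it controls the energy, and because a short segment can then be traversed at a cost
  proportional to its length, which makes surgery near the boundary cheap. The real obstacle is a
  limit that only approaches a rest point asymptotically; the first-order conditions do not exclude
  this, hence the second variation. A critical boundary point is not an isolated zero of
  \<open>U\<close> because its boundary component is a connected set of positive diameter. The
  backward half of the orbit is the forward half for the reversed sequence with \<open>A\<close> and
  \<open>B\<close> exchanged.\<close>

definition curve :: "real \<Rightarrow> real \<Rightarrow> (real \<Rightarrow> 'a::euclidean_space) \<Rightarrow> (real \<Rightarrow> 'a) \<Rightarrow> bool" where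
  "curve a b v w \<longleftrightarrow> a \<le> b \<and> continuous_on {a..b} v \<and>
     (\<exists>S. finite S \<and> (\<forall>t\<in>{a<..<b} - S. (v has_vector_derivative w t) (at t))) \<and>
     (\<lambda>t. (norm (w t))\<^sup>2) integrable_on {a..b}"

definition kin :: "real \<Rightarrow> real \<Rightarrow> (real \<Rightarrow> 'a::euclidean_space) \<Rightarrow> real" where
  "kin a b w = integral {a..b} (\<lambda>t. (norm (w t))\<^sup>2 / 2)"

definition pot :: "('a::euclidean_space \<Rightarrow> real) \<Rightarrow> real \<Rightarrow> real \<Rightarrow> (real \<Rightarrow> 'a) \<Rightarrow> real" where
  "pot U a b v = integral {a..b} (\<lambda>t. U (v t))"

lemma has_vector_derivative_on_continuous:
  "(\<And>t. t \<in> S \<Longrightarrow> (p has_vector_derivative p' t) (at t within S)) \<Longrightarrow> continuous_on S p"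
  using has_vector_derivative_continuous continuous_on_eq_continuous_within by blast

lemma curve_le: "curve a b v w \<Longrightarrow> a \<le> b"
  by (simp add: curve_def)

lemma curve_continuous: "curve a b v w \<Longrightarrow> continuous_on {a..b} v"
  by (simp add: curve_def)

lemma curve_kin_integrable: "curve a b v w \<Longrightarrow> (\<lambda>t. (norm (w t))\<^sup>2 / 2) integrable_on {a..b}"
  unfolding curve_def divide_inverse by (intro integrable_on_mult_left) auto

lemma kin_nonneg: "0 \<le> kin a b w"
  unfolding kin_def by (cases "(\<lambda>t. (norm (w t))\<^sup>2 / 2) integrable_on {a..b}")
    (auto intro: integral_nonneg simp: not_integrable_integral simp del: integral_divide_zero)

lemma kin_real: "kin a b w = integral {a..b} (\<lambda>t. (norm (w t))\<^sup>2) / 2"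
  unfolding kin_def by simp

lemma curve_C1:
  assumes "a \<le> b" "\<And>t. t \<in> {a..b} \<Longrightarrow> (v has_vector_derivative w t) (at t within {a..b})"
    "continuous_on {a..b} w"
  shows "curve a b v w"
  unfolding curve_def
proof (intro conjI exI[of _ "{}"] ballI)
  show "continuous_on {a..b} v"
    using assms(2) by (rule has_vector_derivative_on_continuous)
  show "(v has_vector_derivative w t) (at t)" if "t \<in> {a<..<b} - {}" for t
    using that assms(2)[of t] by (simp add: at_within_Icc_at)
  show "(\<lambda>t. (norm (w t))\<^sup>2) integrable_on {a..b}"
    by (intro integrable_continuous_real continuous_intros assms)
qed (use assms in auto)

lemma curve_subset:
  assumes "curve a b v w" "a \<le> c" "c \<le> d" "d \<le> b"
  shows "curve c d v w"
proof -
  obtain S where S: "finite S" "\<forall>t\<in>{a<..<b} - S. (v has_vector_derivative w t) (at t)"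
    using assms(1) unfolding curve_def by blast
  have "continuous_on {c..d} v"
    using assms by (auto simp: curve_def intro: continuous_on_subset)
  moreover have "(\<lambda>t. (norm (w t))\<^sup>2) integrable_on {c..d}"
    using assms by (auto simp: curve_def intro: integrable_subinterval_real)
  moreover have "\<forall>t\<in>{c<..<d} - S. (v has_vector_derivative w t) (at t)"
    using S assms by auto
  ultimately show ?thesis
    using S(1) assms unfolding curve_def by blast
qed

lemma curve_derivative_has_integral:
  assumes "curve a b v w"
  shows "(w has_integral (v b - v a)) {a..b}"
proof -
  obtain S where S: "finite S" "\<forall>t\<in>{a<..<b} - S. (v has_vector_derivative w t) (at t)"
    using assms unfolding curve_def by blast
  show ?thesis
    by (rule fundamental_theorem_of_calculus_interior_strong[OF S(1)])
       (use assms S in \<open>auto simp: curve_def\<close>)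
qed

text \<open>The value of the integral involves \<open>v\<close> but not \<open>w\<close>, so it
  passes to uniform limits of curves. This is why test functions are taken twice differentiable,
  with \<open>p\<close> as the derivative of the perturbation.\<close>

lemma curve_by_parts:
  assumes c: "curve a b v w"
    and p: "\<And>t. t \<in> {a..b} \<Longrightarrow> (p has_vector_derivative p' t) (at t within {a..b})"
    and p': "continuous_on {a..b} p'"
  shows "((\<lambda>t. w t \<bullet> p t) has_integral (v b \<bullet> p b - v a \<bullet> p a - integral {a..b} (\<lambda>t. v t \<bullet> p' t))) {a..b}"
proof -
  obtain S where S: "finite S" "\<forall>t\<in>{a<..<b} - S. (v has_vector_derivative w t) (at t)"
    using c unfolding curve_def by blast
  have pc: "continuous_on {a..b} p"
    using p by (rule has_vector_derivative_on_continuous)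
  note vc = curve_continuous[OF c]
  have "((\<lambda>t. v t \<bullet> p' t + w t \<bullet> p t) has_integral (v b \<bullet> p b - v a \<bullet> p a)) {a..b}"
  proof (rule fundamental_theorem_of_calculus_interior_strong[OF S(1) curve_le[OF c]])
    fix t assume t: "t \<in> {a<..<b} - S"
    then have "(p has_vector_derivative p' t) (at t)"
      using p[of t] by (simp add: at_within_Icc_at)
    with t S show "((\<lambda>t. v t \<bullet> p t) has_vector_derivative v t \<bullet> p' t + w t \<bullet> p t) (at t)"
      by (intro bounded_bilinear.has_vector_derivative[OF bounded_bilinear_inner]) auto
  next
    show "continuous_on {a..b} (\<lambda>t. v t \<bullet> p t)"
      by (intro continuous_intros vc pc)
  qed
  moreover have "((\<lambda>t. v t \<bullet> p' t) has_integral integral {a..b} (\<lambda>t. v t \<bullet> p' t)) {a..b}"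
    by (intro integrable_integral integrable_continuous_real continuous_intros vc p')
  ultimately have "((\<lambda>t. (v t \<bullet> p' t + w t \<bullet> p t) - v t \<bullet> p' t) has_integral
      (v b \<bullet> p b - v a \<bullet> p a - integral {a..b} (\<lambda>t. v t \<bullet> p' t))) {a..b}"
    by (rule has_integral_diff)
  then show ?thesis by simp
qed

text \<open>The integral of \<open>(norm (w t - e))\<^sup>2\<close> is nonnegative for the mean
  velocity \<open>e\<close>; expanding the square gives the bound. It makes curves of bounded action
  equi-Hoelder with exponent 1/2.\<close>

lemma curve_Holder:
  assumes c: "curve a b v w"
  shows "(norm (v b - v a))\<^sup>2 \<le> 2 * (b - a) * kin a b w"
proof (cases "a = b")
  case False
  then have ab: "a < b" using curve_le[OF c] by simp
  define d where "d = v b - v a"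
  define e where "e = d /\<^sub>R (b - a)"
  have 1: "((\<lambda>t. w t \<bullet> e) has_integral d \<bullet> e) {a..b}"
    using has_integral_linear[OF curve_derivative_has_integral[OF c] bounded_linear_inner_left[of e]]
    by (simp add: o_def d_def)
  have 2: "((\<lambda>t. (norm (w t))\<^sup>2 / 2) has_integral kin a b w) {a..b}"
    unfolding kin_def by (intro integrable_integral curve_kin_integrable[OF c])
  have 3: "((\<lambda>t. e \<bullet> e / 2) has_integral (b - a) * (e \<bullet> e / 2)) {a..b}"
    using has_integral_const_real[of "e \<bullet> e / 2" a b] ab by simp
  have "0 \<le> kin a b w - d \<bullet> e + (b - a) * (e \<bullet> e / 2)"
  proof (rule has_integral_nonneg)
    show "((\<lambda>t. (norm (w t))\<^sup>2 / 2 - w t \<bullet> e + e \<bullet> e / 2) has_integral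
        kin a b w - d \<bullet> e + (b - a) * (e \<bullet> e / 2)) {a..b}"
      by (intro has_integral_add has_integral_diff 1 2 3)
    show "0 \<le> (norm (w t))\<^sup>2 / 2 - w t \<bullet> e + e \<bullet> e / 2" for t
    proof -
      have "0 \<le> (w t - e) \<bullet> (w t - e)" by simp
      then show ?thesis
        by (simp add: power2_norm_eq_inner inner_diff_left inner_diff_right inner_commute)
    qed
  qed
  moreover define X where "X = (norm d)\<^sup>2 / (b - a)"
  moreover have "d \<bullet> e = X" "(b - a) * (e \<bullet> e / 2) = X / 2"
    using ab by (simp_all add: X_def e_def power2_norm_eq_inner divide_simps)
  ultimately have "X \<le> 2 * kin a b w" by linarith
  then show ?thesis using ab by (simp add: X_def divide_simps d_def algebra_simps)
qed simp

text \<open>Convexity of the square, \<open>w \<bullet> p - |p|^2/2 \<le> |w|^2/2\<close>,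
  integrated with the product moved onto \<open>p'\<close>. As the lower bound depends on
  \<open>v\<close> alone, it serves as a substitute for weak lower semicontinuity of the kinetic
  energy.\<close>

lemma curve_kin_lower:
  assumes c: "curve a b v w"
    and p: "\<And>t. t \<in> {a..b} \<Longrightarrow> (p has_vector_derivative p' t) (at t within {a..b})"
    and p': "continuous_on {a..b} p'"
  shows "v b \<bullet> p b - v a \<bullet> p a - integral {a..b} (\<lambda>t. v t \<bullet> p' t) - kin a b p \<le> kin a b w"
proof -
  have pc: "continuous_on {a..b} p"
    using p by (rule has_vector_derivative_on_continuous)
  have 2: "((\<lambda>t. (norm (w t))\<^sup>2 / 2) has_integral kin a b w) {a..b}"
    unfolding kin_def by (intro integrable_integral curve_kin_integrable[OF c])
  have 3: "((\<lambda>t. (norm (p t))\<^sup>2 / 2) has_integral kin a b p) {a..b}"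
    unfolding kin_def by (intro integrable_integral integrable_continuous_real continuous_intros pc) auto
  show ?thesis
  proof (rule has_integral_le[OF has_integral_diff[OF curve_by_parts[OF c p p'] 3] 2])
    fix t
    have "0 \<le> (w t - p t) \<bullet> (w t - p t)" by simp
    then show "w t \<bullet> p t - (norm (p t))\<^sup>2 / 2 \<le> (norm (w t))\<^sup>2 / 2"
      by (simp add: power2_norm_eq_inner inner_diff_left inner_diff_right inner_commute)
  qed
qed

text \<open>The cross term is rewritten by \<open>curve_by_parts\<close>, so the increment of the
  kinetic energy contains no \<open>w\<close>.\<close>

lemma curve_add:
  assumes c: "curve a b v w"
    and f: "\<And>t. t \<in> {a..b} \<Longrightarrow> (f has_vector_derivative p t) (at t within {a..b})"
    and p: "\<And>t. t \<in> {a..b} \<Longrightarrow> (p has_vector_derivative p' t) (at t within {a..b})"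
    and p': "continuous_on {a..b} p'"
  shows "curve a b (\<lambda>t. v t + f t) (\<lambda>t. w t + p t)"
    and "kin a b (\<lambda>t. w t + p t) = kin a b w +
      (v b \<bullet> p b - v a \<bullet> p a - integral {a..b} (\<lambda>t. v t \<bullet> p' t)) + kin a b p"
proof -
  have pc: "continuous_on {a..b} p" and fc: "continuous_on {a..b} f"
    by (rule has_vector_derivative_on_continuous; fact p f)+
  have 2: "((\<lambda>t. (norm (w t))\<^sup>2 / 2) has_integral kin a b w) {a..b}"
    unfolding kin_def by (intro integrable_integral curve_kin_integrable[OF c])
  have 3: "((\<lambda>t. (norm (p t))\<^sup>2 / 2) has_integral kin a b p) {a..b}"
    unfolding kin_def by (intro integrable_integral integrable_continuous_real continuous_intros pc) auto
  have eq: "(norm (w t + p t))\<^sup>2 / 2 = (norm (w t))\<^sup>2 / 2 + w t \<bullet> p t + (norm (p t))\<^sup>2 / 2" for t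
    by (simp add: power2_norm_eq_inner inner_add_left inner_add_right inner_commute)
  have 4: "((\<lambda>t. (norm (w t + p t))\<^sup>2 / 2) has_integral kin a b w +
      (v b \<bullet> p b - v a \<bullet> p a - integral {a..b} (\<lambda>t. v t \<bullet> p' t)) + kin a b p) {a..b}"
    unfolding eq by (intro has_integral_add 2 3 curve_by_parts[OF c p p'])
  then show "kin a b (\<lambda>t. w t + p t) = kin a b w +
      (v b \<bullet> p b - v a \<bullet> p a - integral {a..b} (\<lambda>t. v t \<bullet> p' t)) + kin a b p"
    unfolding kin_def by (rule integral_unique)
  obtain S where S: "finite S" "\<forall>t\<in>{a<..<b} - S. (v has_vector_derivative w t) (at t)"
    using c unfolding curve_def by blast
  show "curve a b (\<lambda>t. v t + f t) (\<lambda>t. w t + p t)"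
    unfolding curve_def
  proof (intro conjI exI[of _ S] ballI)
    show "continuous_on {a..b} (\<lambda>t. v t + f t)"
      by (intro continuous_intros fc curve_continuous[OF c])
    show "((\<lambda>t. v t + f t) has_vector_derivative w t + p t) (at t)" if t: "t \<in> {a<..<b} - S" for t
    proof -
      have "(f has_vector_derivative p t) (at t)"
        using t f[of t] by (simp add: at_within_Icc_at)
      with t S show ?thesis by (intro has_vector_derivative_add) auto
    qed
    have "(\<lambda>t. (norm (w t + p t))\<^sup>2 / 2) integrable_on {a..b}"
      using 4 by blast
    from integrable_on_cmult_left[OF this, of 2] 
    show "(\<lambda>t. (norm (w t + p t))\<^sup>2) integrable_on {a..b}" by simp
  qed (use curve_le[OF c] S in auto)
qed

section \<open>Concatenation, time change and reversal of curves\<close>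

lemma has_integral_join:
  fixes f g :: "real \<Rightarrow> real"
  assumes "a \<le> c" "c \<le> b" "(f has_integral i) {a..c}" "(g has_integral j) {c..b}"
    and "\<And>t. t \<le> c \<Longrightarrow> h t = f t" "\<And>t. t > c \<Longrightarrow> h t = g t"
  shows "(h has_integral (i + j)) {a..b}"
proof (rule has_integral_combine[OF assms(1,2)])
  show "(h has_integral i) {a..c}"
    by (rule has_integral_eq[OF _ assms(3)]) (use assms(5) in auto)
  show "(h has_integral j) {c..b}"
    by (rule has_integral_spike_finite[OF _ _ assms(4), of "{c}"]) (use assms(6) in auto)
qed

lemma curve_join:
  assumes c: "curve a c v w" "curve c b v' w'" and eq: "v c = v' c"
    and U: "continuous_on UNIV U"
  defines "V \<equiv> (\<lambda>t. if t \<le> c then v t else v' t)" and "W \<equiv> (\<lambda>t. if t \<le> c then w t else w' t)"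
  shows "curve a b V W"
    and "kin a b W = kin a c w + kin c b w'" and "pot U a b V = pot U a c v + pot U c b v'"
proof -
  have ac: "a \<le> c" and cb: "c \<le> b" using c by (auto simp: curve_le)
  have 2: "((\<lambda>t. (norm (w t))\<^sup>2 / 2) has_integral kin a c w) {a..c}"
    "((\<lambda>t. (norm (w' t))\<^sup>2 / 2) has_integral kin c b w') {c..b}"
    unfolding kin_def by (intro integrable_integral curve_kin_integrable[OF c(1)]
      curve_kin_integrable[OF c(2)])+
  have 3: "((\<lambda>t. U (v t)) has_integral pot U a c v) {a..c}"
    "((\<lambda>t. U (v' t)) has_integral pot U c b v') {c..b}"
    unfolding pot_def
    by (intro integrable_integral integrable_continuous_real
        continuous_on_compose2[OF U] curve_continuous[OF c(1)] curve_continuous[OF c(2)] subset_UNIV)+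
  have 4: "((\<lambda>t. (norm (W t))\<^sup>2 / 2) has_integral (kin a c w + kin c b w')) {a..b}"
    by (rule has_integral_join[OF ac cb 2]) (auto simp: W_def)
  then show "kin a b W = kin a c w + kin c b w'"
    unfolding kin_def by (rule integral_unique)
  have "((\<lambda>t. U (V t)) has_integral (pot U a c v + pot U c b v')) {a..b}"
    by (rule has_integral_join[OF ac cb 3]) (auto simp: V_def)
  then show "pot U a b V = pot U a c v + pot U c b v'"
    unfolding pot_def by (rule integral_unique)
  obtain S where S: "finite S" "\<forall>t\<in>{a<..<c} - S. (v has_vector_derivative w t) (at t)"
    using c unfolding curve_def by blast
  obtain S' where S': "finite S'" "\<forall>t\<in>{c<..<b} - S'. (v' has_vector_derivative w' t) (at t)"
    using c unfolding curve_def by blast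
  show "curve a b V W"
    unfolding curve_def
  proof (intro conjI exI[of _ "insert c (S \<union> S')"] ballI)
    have "continuous_on ({a..c} \<union> {c..b}) V"
      unfolding V_def
      by (rule continuous_on_If) (use curve_continuous[OF c(1)] curve_continuous[OF c(2)] eq in auto)
    moreover have "{a..c} \<union> {c..b} = {a..b}" using ac cb by auto
    ultimately show "continuous_on {a..b} V" by simp
    show "(V has_vector_derivative W t) (at t)" if t: "t \<in> {a<..<b} - insert c (S \<union> S')" for t
    proof (cases "t < c")
      case True
      then have "(v has_vector_derivative W t) (at t)" using S t by (auto simp: W_def)
      then show ?thesis
        by (rule has_vector_derivative_transform_within_open[of _ _ _ "{..<c}"])
           (use True in \<open>auto simp: V_def\<close>)
    next
      case False
      then have "(v' has_vector_derivative W t) (at t)" using S' t by (auto simp: W_def)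
      then show ?thesis
        by (rule has_vector_derivative_transform_within_open[of _ _ _ "{c<..}"])
           (use t False in \<open>auto simp: V_def\<close>)
    qed
    have "(\<lambda>t. (norm (W t))\<^sup>2 / 2) integrable_on {a..b}" using 4 by blast
    from integrable_on_cmult_left[OF this, of 2] 
    show "(\<lambda>t. (norm (W t))\<^sup>2) integrable_on {a..b}" by simp
  qed (use ac cb S S' in auto)
qed

text \<open>Used with \<open>m = 1\<close> as a shift of the clock, and with \<open>m < 1\<close> to
  compare a curve with a slower version of itself, where the opposite scaling of the two parts of
  the action matters.\<close>

lemma curve_reparam:
  fixes d :: real
  assumes c: "curve a b v w" and m: "m > 0" and U: "continuous_on UNIV U"
  defines "a' \<equiv> (a - d) / m" and "b' \<equiv> (b - d) / m"
  shows "curve a' b' (\<lambda>t. v (m * t + d)) (\<lambda>t. m *\<^sub>R w (m * t + d))"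
    and "kin a' b' (\<lambda>t. m *\<^sub>R w (m * t + d)) = m * kin a b w"
    and "pot U a' b' (\<lambda>t. v (m * t + d)) = pot U a b v / m"
proof -
  have ab: "a \<le> b" using c by (auto simp: curve_le)
  have sc: "i /\<^sub>R m ^ DIM(real) = i / m" for i :: real
    using m by (simp add: field_simps)
  have box: "cbox ((a - d) /\<^sub>R m) ((b - d) /\<^sub>R m) = {a'..b'}"
    unfolding cbox_interval a'_def b'_def divide_inverse real_scaleR_def
    by (simp only: mult.commute)
  have "((\<lambda>t. (norm (w t))\<^sup>2 / 2) has_integral kin a b w) {a..b}"
    unfolding kin_def by (intro integrable_integral curve_kin_integrable[OF c])
  then have "((\<lambda>t. (norm (w t))\<^sup>2 / 2) has_integral kin a b w) (cbox a b)"
    by simp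
  from has_integral_affinity'[OF this m, of d]
  have "((\<lambda>t. (norm (w (m * t + d)))\<^sup>2 / 2) has_integral kin a b w / m) {a'..b'}"
    unfolding box sc by (simp only: real_scaleR_def)
  from has_integral_mult_right[OF this, of "m^2"]
  have 4: "((\<lambda>t. (norm (m *\<^sub>R w (m * t + d)))\<^sup>2 / 2) has_integral m * kin a b w) {a'..b'}"
    using m by (simp add: power2_eq_square mult_ac)
  then show "kin a' b' (\<lambda>t. m *\<^sub>R w (m * t + d)) = m * kin a b w"
    unfolding kin_def by (rule integral_unique)
  have "((\<lambda>t. U (v t)) has_integral pot U a b v) {a..b}"
    unfolding pot_def
    by (intro integrable_integral integrable_continuous_real
        continuous_on_compose2[OF U] curve_continuous[OF c] subset_UNIV)
  then have "((\<lambda>t. U (v t)) has_integral pot U a b v) (cbox a b)"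
    by simp
  from has_integral_affinity'[OF this m, of d]
  have "((\<lambda>t. U (v (m * t + d))) has_integral pot U a b v / m) {a'..b'}"
    unfolding box sc by (simp only: real_scaleR_def)
  then show "pot U a' b' (\<lambda>t. v (m * t + d)) = pot U a b v / m"
    unfolding pot_def by (rule integral_unique)
  obtain S where S: "finite S" "\<forall>t\<in>{a<..<b} - S. (v has_vector_derivative w t) (at t)"
    using c unfolding curve_def by blast
  have map: "m * t + d \<in> {a..b} \<longleftrightarrow> t \<in> {a'..b'}" "m * t + d \<in> {a<..<b} \<longleftrightarrow> t \<in> {a'<..<b'}" for t
    using m by (auto simp: a'_def b'_def field_simps)
  show "curve a' b' (\<lambda>t. v (m * t + d)) (\<lambda>t. m *\<^sub>R w (m * t + d))"
    unfolding curve_def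
  proof (intro conjI exI[of _ "(\<lambda>x. (x - d) / m) ` S"] ballI)
    show "a' \<le> b'" using ab m by (simp add: a'_def b'_def divide_right_mono)
    show "continuous_on {a'..b'} (\<lambda>t. v (m * t + d))"
      by (intro continuous_on_compose2[OF curve_continuous[OF c]] continuous_intros) (use map in auto)
    show "((\<lambda>t. v (m * t + d)) has_vector_derivative m *\<^sub>R w (m * t + d)) (at t)"
      if t: "t \<in> {a'<..<b'} - (\<lambda>x. (x - d) / m) ` S" for t
    proof -
      have "m * t + d \<notin> S"
      proof
        assume "m * t + d \<in> S"
        moreover have "t = (m * t + d - d) / m" using m by simp
        ultimately show False using t by (metis DiffD2 imageI)
      qed
      then have 1: "(v has_vector_derivative w (m * t + d)) (at (m * t + d))"
        using S map t by auto
      have 2: "((\<lambda>t. m * t + d) has_vector_derivative m) (at t)"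
        by (auto intro!: derivative_eq_intros simp: has_vector_derivative_def)
      show ?thesis using vector_diff_chain_at[OF 2 1] by (simp add: o_def)
    qed
    have "(\<lambda>t. (norm (m *\<^sub>R w (m * t + d)))\<^sup>2 / 2) integrable_on {a'..b'}" using 4 by blast
    from integrable_on_cmult_left[OF this, of 2] 
    show "(\<lambda>t. (norm (m *\<^sub>R w (m * t + d)))\<^sup>2) integrable_on {a'..b'}" by simp
  qed (use S in auto)
qed

lemma curve_reverse:
  assumes c: "curve a b v w"
  shows "curve (-b) (-a) (\<lambda>t. v (- t)) (\<lambda>t. - w (- t))"
    and "kin (-b) (-a) (\<lambda>t. - w (- t)) = kin a b w"
    and "pot U (-b) (-a) (\<lambda>t. v (- t)) = pot U a b v"
proof -
  show "kin (-b) (-a) (\<lambda>t. - w (- t)) = kin a b w"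
    unfolding kin_def using Henstock_Kurzweil_Integration.integral_reflect_real[of b a "\<lambda>t. (norm (w t))\<^sup>2 / 2"]
    by (simp del: integral_divide_zero)
  show "pot U (-b) (-a) (\<lambda>t. v (- t)) = pot U a b v"
    unfolding pot_def using Henstock_Kurzweil_Integration.integral_reflect_real[of b a "\<lambda>t. U (v t)"] by simp
  obtain S where S: "finite S" "\<forall>t\<in>{a<..<b} - S. (v has_vector_derivative w t) (at t)"
    using c unfolding curve_def by blast
  show "curve (-b) (-a) (\<lambda>t. v (- t)) (\<lambda>t. - w (- t))"
    unfolding curve_def
  proof (intro conjI exI[of _ "uminus ` S"] ballI)
    show "continuous_on {-b..-a} (\<lambda>t. v (- t))"
      by (intro continuous_on_compose2[OF curve_continuous[OF c]] continuous_intros) auto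
    show "((\<lambda>t. v (- t)) has_vector_derivative - w (- t)) (at t)"
      if t: "t \<in> {-b<..<-a} - uminus ` S" for t
    proof -
      have "- t \<notin> S" using t by force
      then have 1: "(v has_vector_derivative w (- t)) (at (- t))"
        using S t by auto
      have 2: "(uminus has_vector_derivative (-1::real)) (at t)"
        by (auto intro!: derivative_eq_intros simp: has_vector_derivative_def)
      show ?thesis using vector_diff_chain_at[OF 2 1] by (simp add: o_def)
    qed
    have "(\<lambda>t. (norm (w t))\<^sup>2) integrable_on {a..b}" using c by (simp add: curve_def)
    then show "(\<lambda>t. (norm (- w (- t)))\<^sup>2) integrable_on {-b..-a}"
      using Henstock_Kurzweil_Integration.integrable_reflect_real[where f = "\<lambda>t. (norm (w t))\<^sup>2" and a = a and b = b]
      by simp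
  qed (use S curve_le[OF c] in auto)
qed

lemma curve_split:
  assumes c: "curve a b v w" and "a \<le> s" "s \<le> b"
  shows "kin a b w = kin a s w + kin s b w"
  unfolding kin_def using assms
  by (intro Henstock_Kurzweil_Integration.integral_combine[symmetric] curve_kin_integrable[OF c]) auto

lemma pot_split:
  assumes "continuous_on {a..b} v" "continuous_on UNIV U" "a \<le> s" "s \<le> b"
  shows "pot U a b v = pot U a s v + pot U s b v"
  unfolding pot_def using assms
  by (intro Henstock_Kurzweil_Integration.integral_combine[symmetric] integrable_continuous_real continuous_on_compose2[OF assms(2)]) auto

lemma curve_cong:
  assumes "curve a b v w" "\<And>t. t \<in> {a..b} \<Longrightarrow> v' t = v t"
  shows "curve a b v' w"
proof -
  obtain S where S: "finite S" "\<forall>t\<in>{a<..<b} - S. (v has_vector_derivative w t) (at t)"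
    using assms unfolding curve_def by blast
  have "(v' has_vector_derivative w t) (at t)" if "t \<in> {a<..<b} - S" for t
    by (rule has_vector_derivative_transform_within_open[of v _ _ "{a<..<b}"])
       (use that S assms(2) in auto)
  moreover have "continuous_on {a..b} v'"
    by (rule continuous_on_eq[OF curve_continuous[OF assms(1)]]) (simp add: assms(2))
  ultimately show ?thesis using assms(1) S(1) unfolding curve_def by blast
qed

lemma kin_mono:
  assumes "curve a b v w" "a \<le> s" "s \<le> t" "t \<le> b"
  shows "kin s t w \<le> kin a b w"
proof -
  have "kin a b w = kin a s w + kin s b w" by (rule curve_split[OF assms(1)]) (use assms in auto)
  moreover have "kin s b w = kin s t w + kin t b w"
    by (rule curve_split[OF curve_subset[OF assms(1)]]) (use assms in auto)
  ultimately show ?thesis using kin_nonneg[of a s w] kin_nonneg[of t b w] by linarith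
qed

section \<open>Links inside the domain\<close>

text \<open>Only first derivatives of \<open>U\<close> appear here; second-order information enters
  later solely through \<open>concave_direction_at\<close>.\<close>

locale potential =
  fixes U :: "'a::euclidean_space \<Rightarrow> real" and g :: "'a \<Rightarrow> 'a" and \<Omega> :: "'a set"
  assumes U_deriv: "\<And>x. (U has_derivative (\<lambda>h. g x \<bullet> h)) (at x)"
    and g_cont: "continuous_on UNIV g"
    and open_Omega: "open \<Omega>"
    and connected_Omega: "connected \<Omega>"
    and U_pos: "\<And>x. x \<in> \<Omega> \<Longrightarrow> U x > 0"
    and U_frontier: "\<And>x. x \<in> frontier \<Omega> \<Longrightarrow> U x = 0"
begin

lemma U_cont: "continuous_on S U"
  by (intro continuous_at_imp_continuous_on ballI has_derivative_continuous[OF U_deriv])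

lemma g_cont': "continuous_on S g"
  using g_cont continuous_on_subset by blast

lemma closure_cases: "x \<in> closure \<Omega> \<Longrightarrow> x \<in> \<Omega> \<or> x \<in> frontier \<Omega>"
  using open_Omega by (auto simp: frontier_def interior_open)

lemma frontier_disjoint: "x \<in> frontier \<Omega> \<Longrightarrow> x \<notin> \<Omega>"
  using open_Omega by (auto simp: frontier_def interior_open)

lemma U_nonneg: "x \<in> closure \<Omega> \<Longrightarrow> 0 \<le> U x"
  using closure_cases U_pos U_frontier by fastforce

text \<open>Only interior times must be spent in \<open>\<Omega>\<close>, so that the end points may
  lie on the boundary; the duration is quantified away because the minimisation leaves it
  free.\<close>

definition link :: "'a \<Rightarrow> 'a \<Rightarrow> real \<Rightarrow> bool" where
  "link x y c \<longleftrightarrow> (\<exists>T v w. curve 0 T v w \<and> v 0 = x \<and> v T = y \<and>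
     (\<forall>t\<in>{0<..<T}. v t \<in> \<Omega>) \<and> c = kin 0 T w + pot U 0 T v)"

lemma linkI:
  assumes c: "curve a b v w" and "\<And>t. t \<in> {a<..<b} \<Longrightarrow> v t \<in> \<Omega>"
  shows "link (v a) (v b) (kin a b w + pot U a b v)"
proof -
  note r = curve_reparam[OF c _ U_cont, of 1 a, simplified]
  show ?thesis
    unfolding link_def
    by (rule exI[of _ "b - a"], rule exI[of _ "\<lambda>t. v (t + a)"], rule exI[of _ "\<lambda>t. w (t + a)"])
       (use r assms(2) in auto)
qed

text \<open>The junction \<open>y\<close> has to be in \<open>\<Omega>\<close> because it becomes an
  interior point of the joined curve.\<close>

lemma link_join:
  assumes "link x y c" "link y z d" "y \<in> \<Omega>"
  shows "link x z (c + d)"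
proof -
  obtain T v w where 1: "curve 0 T v w" "v 0 = x" "v T = y"
     "\<forall>t\<in>{0<..<T}. v t \<in> \<Omega>" "c = kin 0 T w + pot U 0 T v"
    using assms(1) unfolding link_def by blast
  obtain T' v' w' where 2: "curve 0 T' v' w'" "v' 0 = y" "v' T' = z"
     "\<forall>t\<in>{0<..<T'}. v' t \<in> \<Omega>" "d = kin 0 T' w' + pot U 0 T' v'"
    using assms(2) unfolding link_def by blast
  note r = curve_reparam[OF 2(1) _ U_cont, of 1 "-T", simplified]
  have eq: "v T = v' (T - T)" using 1 2 by simp
  have T: "0 \<le> T" "0 \<le> T'" using curve_le[OF 1(1)] curve_le[OF 2(1)] by auto
  note j = curve_join[OF 1(1) r(1) eq U_cont]
  let ?V = "\<lambda>t. if t \<le> T then v t else v' (t - T)"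
  let ?W = "\<lambda>t. if t \<le> T then w t else w' (t - T)"
  have in_Omega: "?V t \<in> \<Omega>" if "t \<in> {0<..<T' + T}" for t
    using that 1(3,4) 2(4) assms(3) by (cases t T rule: linorder_cases) auto
  have "link (?V 0) (?V (T' + T)) (kin 0 (T' + T) ?W + pot U 0 (T' + T) ?V)"
    by (rule linkI[OF j(1) in_Omega]) auto
  moreover have "?V 0 = x" using T 1 by simp
  moreover have "?V (T' + T) = z" using T 1 2 by auto
  ultimately show ?thesis
    using j(2,3) r(2,3) 1(5) 2(5) by (simp add: algebra_simps)
qed

lemma link_sym:
  assumes "link x y c"
  shows "link y x c"
proof -
  obtain T v w where 1: "curve 0 T v w" "v 0 = x" "v T = y"
     "\<forall>t\<in>{0<..<T}. v t \<in> \<Omega>" "c = kin 0 T w + pot U 0 T v"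
    using assms(1) unfolding link_def by blast
  note r = curve_reverse[OF 1(1)]
  have "link (v (- (- T))) (v (- (- 0))) (kin (-T) (-0) (\<lambda>t. - w (-t)) + pot U (-T) (-0) (\<lambda>t. v (-t)))"
    by (rule linkI[OF r(1)]) (use 1(4) in auto)
  then show ?thesis using 1 r(2,3) by simp
qed

lemma link_nonneg:
  assumes "link x y c"
  shows "0 \<le> c"
proof -
  obtain T v w where 1: "curve 0 T v w" "v 0 = x" "v T = y"
     "\<forall>t\<in>{0<..<T}. v t \<in> \<Omega>" "c = kin 0 T w + pot U 0 T v"
    using assms(1) unfolding link_def by blast
  have "pot U 0 T v = integral {0<..<T} (\<lambda>t. U (v t))"
    unfolding pot_def by (rule integral_open_interval_real)
  also have "\<dots> \<ge> 0"
    by (rule integral_nonneg)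
       (use 1(4) U_pos in \<open>auto simp: less_imp_le intro!: integrable_continuous_real
           continuous_on_compose2[OF U_cont] curve_continuous[OF 1(1)]
           simp: integrable_on_open_interval_real\<close>)
  finally show ?thesis using kin_nonneg[of 0 T w] 1(5) by simp
qed

text \<open>Traversal at unit speed costs half the length in kinetic energy and at most
  \<open>C\<close> times the length in potential energy. The point is that the cost is linear in the
  distance.\<close>

lemma link_segment:
  assumes "open_segment x y \<subseteq> \<Omega>" "\<And>z. z \<in> closed_segment x y \<Longrightarrow> U z \<le> C"
  shows "\<exists>c \<le> (1/2 + C) * norm (y - x). link x y c"
proof -
  define n where "n = norm (y - x)"
  \<comment> \<open>For \<open>x = y\<close> this is the zero vector, which is why only
    \<open>norm u \<le> 1\<close> is claimed below.\<close>
  define u where "u = (y - x) /\<^sub>R n"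
  let ?v = "\<lambda>t. x + t *\<^sub>R u" and ?w = "\<lambda>t::real. u"
  have n0: "0 \<le> n" by (simp add: n_def)
  have c: "curve 0 n ?v ?w"
    by (rule curve_C1) (auto simp: n0 intro!: derivative_eq_intros)
  have fin: "?v n = y" by (cases "x = y") (auto simp: n_def u_def)
  have seg: "?v t \<in> closed_segment x y" if "t \<in> {0..n}" for t
  proof -
    have "?v t = (1 - t/n) *\<^sub>R x + (t/n) *\<^sub>R y"
      by (simp add: u_def divide_inverse algebra_simps)
    then show ?thesis
      using that unfolding in_segment by (intro exI[of _ "t/n"]) (auto simp: divide_le_eq_1)
  qed
  have "?v t \<in> \<Omega>" if t: "t \<in> {0<..<n}" for t
  proof -
    have "u \<noteq> 0" using t by (auto simp: u_def n_def)
    moreover have "?v t = ?v n \<longleftrightarrow> t = n" using \<open>u \<noteq> 0\<close> by auto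
    ultimately have "?v t \<in> open_segment x y"
      using seg[of t] t fin unfolding open_segment_def by auto
    then show ?thesis using assms by auto
  qed
  from linkI[OF c this] fin have l: "link x y (kin 0 n ?w + pot U 0 n ?v)" by simp
  have "norm u \<le> 1" by (cases "x = y") (auto simp: u_def n_def)
  then have u1: "(norm u)\<^sup>2 \<le> 1" by (simp add: power_le_one)
  have "kin 0 n ?w \<le> n / 2"
    unfolding kin_def using mult_left_mono[OF u1 n0] n0 by simp
  moreover have "pot U 0 n ?v \<le> integral {0..n} (\<lambda>t. C)"
    unfolding pot_def
    by (intro integral_le integrable_continuous_real continuous_on_compose2[OF U_cont]
        curve_continuous[OF c] continuous_intros) (use seg assms in auto)
  ultimately have "kin 0 n ?w + pot U 0 n ?v \<le> (1/2 + C) * n"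
    using n0 by (simp add: algebra_simps)
  then show ?thesis using l n_def by blast
qed

lemma link_exists:
  assumes "x \<in> \<Omega>" "y \<in> \<Omega>"
  shows "\<exists>c. link x y c"
proof -
  \<comment> \<open>A merely continuous path need not have finite energy; a polynomial one is
    continuously differentiable.\<close>
  obtain p where p: "polynomial_function p" "path_image p \<subseteq> \<Omega>" "pathstart p = x" "pathfinish p = y"
    using connected_open_polynomial_connected[OF open_Omega connected_Omega assms] by blast
  obtain p' where p': "polynomial_function p'" "\<And>t. (p has_vector_derivative p' t) (at t)"
    using has_vector_derivative_polynomial_function[OF p(1)] by blast
  have "curve 0 1 p p'"
    by (rule curve_C1) (auto intro: has_vector_derivative_at_within p'
        continuous_on_polymonial_function)
  from linkI[OF this] p show ?thesis
    by (force simp: path_image_def pathstart_def pathfinish_def)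
qed

end

text \<open>The open ball about \<open>x\<close> of radius \<open>dist x q\<close> contains no
  frontier point, so, being connected, it stays in \<open>S\<close>; the open segment lies in that
  ball.\<close>

lemma open_segment_closest_frontier:
  fixes x :: "'a::euclidean_space"
  assumes "x \<in> S" "q \<in> frontier S" "\<And>z. z \<in> frontier S \<Longrightarrow> dist x q \<le> dist x z"
  shows "open_segment q x \<subseteq> S"
proof -
  have "ball x (dist x q) \<subseteq> S"
  proof (rule ccontr)
    assume n: "\<not> ?thesis"
    then have "ball x (dist x q) \<inter> S \<noteq> {}" using assms(1) by (metis IntI centre_in_ball
      empty_iff dist_self ball_eq_empty empty_subsetI not_less zero_less_dist_iff order_refl)
    from connected_Int_frontier[OF connected_ball this] n obtain z where
      "z \<in> ball x (dist x q)" "z \<in> frontier S" by blast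
    with assms(3)[of z] show False by auto
  qed
  moreover have "open_segment q x \<subseteq> ball x (dist x q)"
    using dist_in_open_segment[of _ q x] by (force simp: dist_commute dist_norm)
  ultimately show ?thesis by blast
qed

locale connection = potential +
  fixes A B :: "'a set"
  assumes compact_A: "compact A" and compact_B: "compact B"
    and AB: "A \<union> B = frontier \<Omega>" and AB_disjoint: "A \<inter> B = {}"
    and A_ne: "A \<noteq> {}" and B_ne: "B \<noteq> {}"
begin

definition level :: real where
  "level = Inf {c. \<exists>x\<in>A. \<exists>y\<in>B. link x y c}"

lemma level_le: "x \<in> A \<Longrightarrow> y \<in> B \<Longrightarrow> link x y c \<Longrightarrow> level \<le> c"
  unfolding level_def by (rule cInf_lower) (auto intro!: bdd_belowI[of _ 0] dest: link_nonneg)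

lemma swap: "connection U g \<Omega> B A"
  by unfold_locales (use compact_A compact_B AB AB_disjoint A_ne B_ne in auto)

lemma level_swap: "connection.level U \<Omega> B A = level"
  unfolding connection.level_def[OF swap] level_def using link_sym by (metis)

lemma gap: obtains \<delta> where "\<delta> > 0" "\<And>a b. a \<in> A \<Longrightarrow> b \<in> B \<Longrightarrow> 2 * \<delta> \<le> dist a b"
proof -
  obtain d where "d > 0" "\<And>a b. a \<in> A \<Longrightarrow> b \<in> B \<Longrightarrow> d \<le> dist a b"
    using separate_compact_closed[OF compact_A compact_imp_closed[OF compact_B] AB_disjoint] by blast
  then show ?thesis using that[of "d/2"] by simp
qed

text \<open>The boundary point nearest to \<open>x\<close> is within \<open>\<delta>\<close> of
  \<open>x\<close>, hence at distance less than \<open>2 * \<delta>\<close> from \<open>a\<close>,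
  which the gap forbids for points of \<open>B\<close>.\<close>

lemma near_A:
  assumes \<delta>: "\<And>a b. a \<in> A \<Longrightarrow> b \<in> B \<Longrightarrow> 2 * \<delta> \<le> dist a b"
    and x: "x \<in> \<Omega>" and a: "a \<in> A" "dist x a < \<delta>"
  obtains q where "q \<in> A" "dist x q \<le> dist x a" "open_segment q x \<subseteq> \<Omega>"
proof -
  have cl: "closed (frontier \<Omega>)" "frontier \<Omega> \<noteq> {}" using A_ne AB by auto
  define q where "q = closest_point (frontier \<Omega>) x"
  have q: "q \<in> frontier \<Omega>" "\<And>z. z \<in> frontier \<Omega> \<Longrightarrow> dist x q \<le> dist x z"
    unfolding q_def using closest_point_in_set[OF cl] closest_point_le[OF cl(1)] by auto
  have "dist x q \<le> dist x a" using q(2)[of a] a AB by auto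
  moreover have "q \<notin> B"
  proof
    assume "q \<in> B"
    with \<delta>[of a q] a calculation show False
      using dist_triangle[of a q x] by (simp add: dist_commute)
  qed
  ultimately show ?thesis
    using that[of q] q AB open_segment_closest_frontier[OF x q] by auto
qed

text \<open>A prescribed point of \<open>A\<close> need not be accessible from inside, so the end
  point is chosen: the boundary point nearest to an interior point close to \<open>A\<close> is
  reached along a segment, and interior points are linked with each other.\<close>

lemma link_A:
  assumes "x \<in> \<Omega>"
  shows "\<exists>a\<in>A. \<exists>c. link a x c"
proof -
  obtain \<delta> where \<delta>: "\<delta> > 0" "\<And>a b. a \<in> A \<Longrightarrow> b \<in> B \<Longrightarrow> 2 * \<delta> \<le> dist a b" using gap by blast
  obtain a where a: "a \<in> A" using A_ne by blast
  then have "a \<in> closure \<Omega>" using AB by (auto simp: frontier_def)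
  then obtain y where y: "y \<in> \<Omega>" "dist y a < \<delta>" using \<delta>(1) closure_approachable by metis
  obtain q where q: "q \<in> A" "open_segment q y \<subseteq> \<Omega>" using near_A[OF \<delta>(2) y(1) a y(2)] by blast
  have "bdd_above (U ` closed_segment q y)"
    by (intro compact_imp_bounded[THEN bounded_imp_bdd_above] compact_continuous_image U_cont compact_segment)
  then obtain C where "\<And>z. z \<in> closed_segment q y \<Longrightarrow> U z \<le> C" by (auto simp: bdd_above_def)
  from link_segment[OF q(2) this] obtain c where "link q y c" by blast
  moreover obtain d where "link y x d" using link_exists y assms by blast
  ultimately show ?thesis using link_join y q by blast
qed

lemma links_nonempty: "\<exists>x\<in>A. \<exists>y\<in>B. \<exists>c. link x y c"
proof -
  obtain b where "b \<in> B" using B_ne by blast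
  then have "b \<in> closure \<Omega>" using AB by (auto simp: frontier_def)
  then obtain x where x: "x \<in> \<Omega>" by force
  obtain a c where "a \<in> A" "link a x c" using link_A[OF x] by blast
  moreover obtain b d where "b \<in> B" "link b x d" using connection.link_A[OF swap x] by blast
  ultimately show ?thesis using link_join[OF _ link_sym x] by blast
qed

text \<open>Each \<open>V n\<close> is defined for all times, staying in \<open>A\<close> before
  \<open>\<alpha> n\<close> and in \<open>B\<close> after \<open>\<beta> n\<close>, so that a
  locally uniform limit on the whole line makes sense although nothing controls the
  durations.\<close>

definition minimising :: "(nat \<Rightarrow> real \<Rightarrow> 'a) \<Rightarrow> (nat \<Rightarrow> real \<Rightarrow> 'a) \<Rightarrow> (nat \<Rightarrow> real) \<Rightarrow> (nat \<Rightarrow> real) \<Rightarrow> bool" where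
  "minimising V W \<alpha> \<beta> \<longleftrightarrow>
     (\<forall>n. curve (\<alpha> n) (\<beta> n) (V n) (W n) \<and> \<alpha> n < 0 \<and> 0 < \<beta> n \<and>
        (\<forall>t\<le>\<alpha> n. V n t \<in> A) \<and> (\<forall>t\<ge>\<beta> n. V n t \<in> B) \<and> (\<forall>t\<in>{\<alpha> n<..<\<beta> n}. V n t \<in> \<Omega>) \<and>
        continuous_on UNIV (V n)) \<and>
     (\<forall>n s t. s \<le> t \<longrightarrow> (norm (V n t - V n s))\<^sup>2 \<le> 2 * (t - s) * kin (\<alpha> n) (\<beta> n) (W n)) \<and>
     (\<lambda>n. kin (\<alpha> n) (\<beta> n) (W n) + pot U (\<alpha> n) (\<beta> n) (V n)) \<longlonglongrightarrow> level"

lemma minimising_reverse: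
  assumes "minimising V W \<alpha> \<beta>"
  shows "connection.minimising U \<Omega> B A (\<lambda>n t. V n (- t)) (\<lambda>n t. - W n (- t)) (\<lambda>n. - \<beta> n) (\<lambda>n. - \<alpha> n)"
proof -
  have c: "curve (\<alpha> n) (\<beta> n) (V n) (W n)" for n using assms by (simp add: minimising_def)
  note r = curve_reverse[OF c]
  have co: "continuous_on UNIV (V n)" for n using assms by (simp add: minimising_def)
  have "continuous_on UNIV (\<lambda>t. V n (- t))" for n
    by (intro continuous_on_compose2[OF co] continuous_intros) auto
  moreover have "(norm (V n (- t) - V n (- s)))\<^sup>2 \<le> 2 * (t - s) * kin (\<alpha> n) (\<beta> n) (W n)" if "s \<le> t" for n s t
    using assms that unfolding minimising_def
    by (metis (no_types, opaque_lifting) add.commute diff_minus_eq_add neg_le_iff_le norm_minus_commute uminus_add_conv_diff)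
  ultimately show ?thesis
    using assms unfolding connection.minimising_def[OF swap] minimising_def level_swap
    by (auto simp: r)
qed

text \<open>The distance to \<open>A\<close> is \<open>0\<close> at the start and at least
  \<open>2 * \<delta>\<close> at the end, so it equals \<open>\<delta>\<close> at some intermediate
  time, which becomes time \<open>0\<close>. Outside its interval the curve is continued by
  constants.\<close>

lemma link_clamped:
  assumes "link x y c" "x \<in> A" "y \<in> B"
    and \<delta>: "0 < \<delta>" "\<And>a b. a \<in> A \<Longrightarrow> b \<in> B \<Longrightarrow> 2 * \<delta> \<le> dist a b"
  shows "\<exists>v w a b. curve a b v w \<and> a < 0 \<and> 0 < b \<and> (\<forall>t\<le>a. v t \<in> A) \<and> (\<forall>t\<ge>b. v t \<in> B) \<and>
     (\<forall>t\<in>{a<..<b}. v t \<in> \<Omega>) \<and> continuous_on UNIV v \<and>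
     (\<forall>s t. s \<le> t \<longrightarrow> (norm (v t - v s))\<^sup>2 \<le> 2 * (t - s) * kin a b w) \<and>
     kin a b w + pot U a b v = c \<and> infdist (v 0) A = \<delta>"
proof -
  obtain T v w where 1: "curve 0 T v w" "v 0 = x" "v T = y"
     "\<forall>t\<in>{0<..<T}. v t \<in> \<Omega>" "c = kin 0 T w + pot U 0 T v"
    using assms(1) unfolding link_def by blast
  have T: "0 \<le> T" using curve_le[OF 1(1)] .
  have yA: "2 * \<delta> \<le> infdist y A"
    unfolding infdist_def using A_ne \<delta>(2) assms(3) by (auto simp: dist_commute intro!: cINF_greatest)
  have "\<exists>s\<ge>0. s \<le> T \<and> infdist (v s) A = \<delta>"
    by (rule IVT') (use 1 T yA assms(2) \<delta>(1) curve_continuous[OF 1(1)] in \<open>auto intro!: continuous_intros\<close>)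
  then obtain s where s: "0 \<le> s" "s \<le> T" "infdist (v s) A = \<delta>" by blast
  have s': "0 < s" "s < T"
    using s 1(2,3) yA assms(2) \<delta>(1) by (auto simp: less_le)
  note r = curve_reparam[OF 1(1) _ U_cont, of 1 s, simplified]
  define a where "a = - s"
  define b where "b = T - s"
  \<comment> \<open>Clamping of time to \<open>{a..b}\<close>: monotone and nonexpansive, so the
    Hoelder estimate survives the extension.\<close>
  define cl where "cl t = max a (min b t)" for t
  define V where "V t = v (cl t + s)" for t
  have ab: "a < 0" "0 < b" using s' by (auto simp: a_def b_def)
  have cl: "cl t \<in> {a..b}" for t using ab by (auto simp: cl_def)
  have cl_id: "cl t = t" if "t \<in> {a..b}" for t using that by (auto simp: cl_def)
  have c: "curve a b V (\<lambda>t. w (t + s))"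
    by (rule curve_cong[where v = "\<lambda>t. v (t + s)"]) (use r in \<open>auto simp: a_def[symmetric] b_def[symmetric] V_def cl_id\<close>)
  have pot: "pot U a b V = pot U a b (\<lambda>t. v (t + s))"
    unfolding pot_def by (rule integral_cong) (simp add: V_def cl_id)
  have "V t \<in> A" if "t \<le> a" for t
    using that ab 1 assms by (simp add: V_def cl_def min_def) (simp add: a_def)
  moreover have "V t \<in> B" if "b \<le> t" for t
    using that ab 1 assms by (simp add: V_def cl_def min_def max_def) (simp add: b_def)
  moreover have "V t \<in> \<Omega>" if "t \<in> {a<..<b}" for t
    using that 1(4) by (simp add: V_def cl_id) (simp add: a_def b_def)
  moreover have "continuous_on UNIV V"
    unfolding V_def using cl
    by (intro continuous_on_compose2[OF curve_continuous[OF 1(1)]])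
       (auto simp: a_def b_def cl_def intro!: continuous_intros)
  moreover have "(norm (V t' - V t))\<^sup>2 \<le> 2 * (t' - t) * kin a b (\<lambda>t. w (t + s))" if "t \<le> t'" for t t'
  proof -
    have le: "cl t \<le> cl t'" "cl t' - cl t \<le> t' - t" using that ab by (auto simp: cl_def max_def min_def)
    have VV: "V t = V (cl t)" for t using cl[of t] by (simp add: V_def cl_id)
    have "(norm (V (cl t') - V (cl t)))\<^sup>2 \<le> 2 * (cl t' - cl t) * kin (cl t) (cl t') (\<lambda>t. w (t + s))"
      by (rule curve_Holder[OF curve_subset[OF c]]) (use cl[of t] cl[of t'] le in auto)
    also have "\<dots> \<le> 2 * (t' - t) * kin a b (\<lambda>t. w (t + s))"
      by (intro mult_mono kin_mono[OF c] kin_nonneg) (use le that cl[of t] cl[of t'] in auto)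
    finally show ?thesis using VV by simp
  qed
  moreover have "kin a b (\<lambda>t. w (t + s)) + pot U a b V = c"
    using r 1(5) pot by (simp add: a_def b_def)
  moreover have "infdist (V 0) A = \<delta>" using s(3) ab by (simp add: V_def cl_id)
  ultimately show ?thesis using c ab
    by (intro exI[of _ V] exI[of _ "\<lambda>t. w (t + s)"] exI[of _ a] exI[of _ b] conjI allI impI ballI)
qed

lemma minimising_exists:
  obtains V W \<alpha> \<beta> Z where "minimising V W \<alpha> \<beta>" "compact Z" "Z \<subseteq> \<Omega>" "\<And>n. V n 0 \<in> Z"
proof -
  obtain \<delta> where \<delta>: "\<delta> > 0" "\<And>a b. a \<in> A \<Longrightarrow> b \<in> B \<Longrightarrow> 2 * \<delta> \<le> dist a b" using gap by blast
  let ?L = "{c. \<exists>x\<in>A. \<exists>y\<in>B. link x y c}"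
  have "\<exists>c\<in>?L. c < level + inverse (Suc n)" for n
  proof (rule ccontr)
    assume "\<not> ?thesis"
    then have "level + inverse (Suc n) \<le> Inf ?L"
      using links_nonempty by (intro cInf_greatest) (auto simp: not_less)
    then show False using level_def by simp
  qed
  then have "\<forall>n. \<exists>c. c \<in> ?L \<and> c < level + inverse (Suc n)" by (simp add: Bex_def)
  from choice[OF this] obtain c where c: "\<And>n. c n \<in> ?L" "\<And>n. c n < level + inverse (Suc n)"
    by blast
  have "\<exists>v w a b. curve a b v w \<and> a < 0 \<and> 0 < b \<and> (\<forall>t\<le>a. v t \<in> A) \<and> (\<forall>t\<ge>b. v t \<in> B) \<and>
     (\<forall>t\<in>{a<..<b}. v t \<in> \<Omega>) \<and> continuous_on UNIV v \<and>
     (\<forall>s t. s \<le> t \<longrightarrow> (norm (v t - v s))\<^sup>2 \<le> 2 * (t - s) * kin a b w) \<and>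
     kin a b w + pot U a b v = c n \<and> infdist (v 0) A = \<delta>" for n
    using c(1)[of n] link_clamped[OF _ _ _ \<delta>] by blast
  then obtain V W \<alpha> \<beta> where V: "\<And>n. curve (\<alpha> n) (\<beta> n) (V n) (W n) \<and> \<alpha> n < 0 \<and> 0 < \<beta> n \<and>
     (\<forall>t\<le>\<alpha> n. V n t \<in> A) \<and> (\<forall>t\<ge>\<beta> n. V n t \<in> B) \<and>
     (\<forall>t\<in>{\<alpha> n<..<\<beta> n}. V n t \<in> \<Omega>) \<and> continuous_on UNIV (V n) \<and>
     (\<forall>s t. s \<le> t \<longrightarrow> (norm (V n t - V n s))\<^sup>2 \<le> 2 * (t - s) * kin (\<alpha> n) (\<beta> n) (W n)) \<and>
     kin (\<alpha> n) (\<beta> n) (W n) + pot U (\<alpha> n) (\<beta> n) (V n) = c n \<and> infdist (V n 0) A = \<delta>"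
    by metis
  have "c \<longlonglongrightarrow> level"
  proof (rule tendsto_sandwich[OF always_eventually always_eventually])
    show "\<forall>n. level \<le> c n" using c(1) level_le by blast
    show "\<forall>n. c n \<le> level + inverse (Suc n)" using c(2) by (auto simp: less_imp_le)
    show "(\<lambda>n. level + inverse (real (Suc n))) \<longlonglongrightarrow> level"
      using tendsto_add[OF tendsto_const LIMSEQ_inverse_real_of_nat, of level] by simp
  qed simp
  then have m: "minimising V W \<alpha> \<beta>"
    unfolding minimising_def using V by simp
  \<comment> \<open>Distance \<open>\<delta>\<close> from \<open>A\<close> excludes
    \<open>A\<close>, and \<open>B\<close> is at least \<open>2 * \<delta>\<close> away from
    \<open>A\<close>, so this compact set lies inside \<open>\<Omega>\<close>. Pinning
    \<open>V n 0\<close> here keeps the limit at time \<open>0\<close> off the boundary, which the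
    time-invariant action alone would not do.\<close>
  define Z where "Z = {z \<in> closure \<Omega>. infdist z A = \<delta>}"
  have "closed Z"
  proof -
    have "Z = closure \<Omega> \<inter> (\<lambda>z. infdist z A) -` {\<delta>}" by (auto simp: Z_def)
    then show ?thesis
      by (auto intro!: continuous_closed_preimage continuous_intros)
  qed
  moreover have "bounded Z"
  proof -
    obtain R where R: "\<And>a. a \<in> A \<Longrightarrow> norm a \<le> R"
      using compact_imp_bounded[OF compact_A] by (auto simp: bounded_iff)
    have "norm z \<le> R + \<delta>" if z: "z \<in> Z" for z
    proof -
      obtain a where "a \<in> A" "infdist z A = dist z a"
        using infdist_attains_inf[OF compact_imp_closed[OF compact_A] A_ne, of z] by blast
      then show ?thesis using z R[of a] norm_triangle_sub[of z a] by (auto simp: Z_def dist_norm)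
    qed
    then show ?thesis by (auto simp: bounded_iff)
  qed
  ultimately have "compact Z" by (simp add: compact_eq_bounded_closed)
  moreover have "Z \<subseteq> \<Omega>"
  proof
    fix z assume z: "z \<in> Z"
    have "z \<notin> A" using z \<delta>(1) by (auto simp: Z_def)
    moreover have "z \<notin> B"
    proof
      assume "z \<in> B"
      obtain a where "a \<in> A" "infdist z A = dist z a"
        using infdist_attains_inf[OF compact_imp_closed[OF compact_A] A_ne, of z] by blast
      with \<delta> \<open>z \<in> B\<close> z show False by (fastforce simp: Z_def dist_commute)
    qed
    ultimately show "z \<in> \<Omega>" using z closure_cases AB by (auto simp: Z_def)
  qed
  moreover have "V n 0 \<in> Z" for n
  proof -
    have "V n 0 \<in> \<Omega>" using V[of n] by simp
    then have "V n 0 \<in> closure \<Omega>" by (rule subsetD[OF closure_subset])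
    then show ?thesis using V[of n] by (simp add: Z_def)
  qed
  ultimately show ?thesis using that m by blast
qed

end

section \<open>The limit of a minimising sequence\<close>

lemma inner_by_parts:
  fixes p q :: "real \<Rightarrow> 'a::euclidean_space"
  assumes "a \<le> b"
    and q: "\<And>t. t \<in> {a..b} \<Longrightarrow> (q has_vector_derivative q' t) (at t within {a..b})"
    and p: "\<And>t. t \<in> {a..b} \<Longrightarrow> (p has_vector_derivative p' t) (at t within {a..b})"
    and q': "continuous_on {a..b} q'" and p': "continuous_on {a..b} p'"
  shows "integral {a..b} (\<lambda>t. q' t \<bullet> p t) = q b \<bullet> p b - q a \<bullet> p a - integral {a..b} (\<lambda>t. q t \<bullet> p' t)"
  by (intro integral_unique curve_by_parts[OF curve_C1] assms)

text \<open>Testing with the \<open>\<phi>\<close> for which \<open>\<phi>'' = z\<close>, where \<open>z\<close> is the difference between \<open>v\<close> and the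
  solution of the linear problem with the same boundary values, gives \<open>\<integral>|z|\<^sup>2 = 0\<close>.\<close>

lemma du_Bois_Reymond:
  fixes v f :: "real \<Rightarrow> 'a::euclidean_space"
  assumes st: "s < t" and v: "continuous_on {s..t} v" and f: "continuous_on {s..t} f"
    and weak: "\<And>\<phi> p p'. \<phi> s = 0 \<Longrightarrow> \<phi> t = 0 \<Longrightarrow>
        (\<And>x. x \<in> {s..t} \<Longrightarrow> (\<phi> has_vector_derivative p x) (at x within {s..t})) \<Longrightarrow>
        (\<And>x. x \<in> {s..t} \<Longrightarrow> (p has_vector_derivative p' x) (at x within {s..t})) \<Longrightarrow>
        continuous_on {s..t} p' \<Longrightarrow>
        v t \<bullet> p t - v s \<bullet> p s - integral {s..t} (\<lambda>x. v x \<bullet> p' x) + integral {s..t} (\<lambda>x. f x \<bullet> \<phi> x) = 0"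
  obtains v' where "\<And>x. x \<in> {s..t} \<Longrightarrow> (v has_vector_derivative v' x) (at x within {s..t})"
    "\<And>x. x \<in> {s..t} \<Longrightarrow> (v' has_vector_derivative f x) (at x within {s..t})"
proof -
  define G where "G x = integral {s..x} f" for x
  have G: "(G has_vector_derivative f x) (at x within {s..t})" if "x \<in> {s..t}" for x
    unfolding G_def by (rule integral_has_vector_derivative[OF f that])
  have Gc: "continuous_on {s..t} G" by (rule has_vector_derivative_on_continuous[OF G])
  define F where "F x = integral {s..x} G" for x
  have F: "(F has_vector_derivative G x) (at x within {s..t})" if "x \<in> {s..t}" for x
    unfolding F_def by (rule integral_has_vector_derivative[OF Gc that])
  have Fc: "continuous_on {s..t} F" by (rule has_vector_derivative_on_continuous[OF F])
  define k where "k = ((v t - F t) - (v s - F s)) /\<^sub>R (t - s)"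
  define L where "L x = (v s - F s) + (x - s) *\<^sub>R k" for x
  have L: "(L has_vector_derivative k) (at x within {s..t})" for x
    unfolding L_def by (auto intro!: derivative_eq_intros)
  have Lc: "continuous_on {s..t} L" unfolding L_def by (intro continuous_intros)
  define z where "z x = v x - F x - L x" for x
  have zc: "continuous_on {s..t} z" unfolding z_def by (intro continuous_intros v Fc Lc)
  have z_ends: "z s = 0" "z t = 0" using st by (simp_all add: z_def L_def k_def)
  define Q where "Q x = integral {s..x} z" for x
  have Q: "(Q has_vector_derivative z x) (at x within {s..t})" if "x \<in> {s..t}" for x
    unfolding Q_def by (rule integral_has_vector_derivative[OF zc that])
  have Qc: "continuous_on {s..t} Q" by (rule has_vector_derivative_on_continuous[OF Q])
  define R where "R x = integral {s..x} Q" for x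
  have R: "(R has_vector_derivative Q x) (at x within {s..t})" if "x \<in> {s..t}" for x
    unfolding R_def by (rule integral_has_vector_derivative[OF Qc that])
  \<comment> \<open>The linear correction makes \<open>\<phi>\<close> vanish at \<open>t\<close>
    without changing its second derivative \<open>z\<close>.\<close>
  define r where "r = R t /\<^sub>R (t - s)"
  define \<phi> where "\<phi> x = R x - (x - s) *\<^sub>R r" for x
  define p where "p x = Q x - r" for x
  have \<phi>: "(\<phi> has_vector_derivative p x) (at x within {s..t})" if "x \<in> {s..t}" for x
    unfolding \<phi>_def p_def by (auto intro!: derivative_eq_intros R[OF that])
  have p: "(p has_vector_derivative z x) (at x within {s..t})" if "x \<in> {s..t}" for x
    unfolding p_def by (auto intro!: derivative_eq_intros Q[OF that])
  have \<phi>c: "continuous_on {s..t} \<phi>" by (rule has_vector_derivative_on_continuous[OF \<phi>])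
  have pc: "continuous_on {s..t} p" by (rule has_vector_derivative_on_continuous[OF p])
  have \<phi>_ends: "\<phi> s = 0" "\<phi> t = 0" using st by (simp_all add: \<phi>_def r_def R_def)
  have w: "v t \<bullet> p t - v s \<bullet> p s - integral {s..t} (\<lambda>x. v x \<bullet> z x) + integral {s..t} (\<lambda>x. f x \<bullet> \<phi> x) = 0"
    by (rule weak[OF \<phi>_ends \<phi> p zc])
  \<comment> \<open>The four integrations by parts turn the weak equation into orthogonality of
    \<open>v - F - L\<close> and \<open>z\<close>; these are the same function.\<close>
  have i1: "integral {s..t} (\<lambda>x. f x \<bullet> \<phi> x) = - integral {s..t} (\<lambda>x. G x \<bullet> p x)"
    using inner_by_parts[OF less_imp_le[OF st] G \<phi> f pc] \<phi>_ends by simp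
  have i2: "integral {s..t} (\<lambda>x. G x \<bullet> p x) = F t \<bullet> p t - F s \<bullet> p s - integral {s..t} (\<lambda>x. F x \<bullet> z x)"
    by (rule inner_by_parts[OF less_imp_le[OF st] F p Gc zc])
  have i3: "integral {s..t} (\<lambda>x. k \<bullet> p x) = L t \<bullet> p t - L s \<bullet> p s - integral {s..t} (\<lambda>x. L x \<bullet> z x)"
    by (rule inner_by_parts[OF less_imp_le[OF st] L p _ zc]) auto
  have i4: "integral {s..t} (\<lambda>x. 0 \<bullet> \<phi> x) = k \<bullet> \<phi> t - k \<bullet> \<phi> s - integral {s..t} (\<lambda>x. k \<bullet> p x)"
    by (rule inner_by_parts[OF less_imp_le[OF st] _ \<phi> _ pc]) auto
  have "integral {s..t} (\<lambda>x. z x \<bullet> z x) =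
      integral {s..t} (\<lambda>x. v x \<bullet> z x) - integral {s..t} (\<lambda>x. F x \<bullet> z x) - integral {s..t} (\<lambda>x. L x \<bullet> z x)"
    unfolding z_def[of "x" for x] inner_diff_left
    by (subst Henstock_Kurzweil_Integration.integral_diff
       | intro integrable_continuous_real continuous_intros v Fc Lc refl)+
  moreover have "z t \<bullet> p t = 0" "z s \<bullet> p s = 0" using z_ends by auto
  ultimately have "integral {s..t} (\<lambda>x. z x \<bullet> z x) = 0"
    using w i1 i2 i3 i4 \<phi>_ends by (simp add: z_def[of t] z_def[of s] inner_diff_left)
  moreover have "continuous_on {s..t} (\<lambda>x. z x \<bullet> z x)" by (intro continuous_intros zc)
  ultimately have "\<forall>x\<in>{s..t}. z x \<bullet> z x = 0"
    using integral_eq_0_iff[of s t "\<lambda>x. z x \<bullet> z x"] st inner_ge_zero by blast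
  then have vz: "v x = F x + L x" if "x \<in> {s..t}" for x 
  proof -
    have "z x = 0" using \<open>\<forall>x\<in>{s..t}. z x \<bullet> z x = 0\<close> that by (metis inner_eq_zero_iff)
    then show ?thesis by (simp add: z_def algebra_simps)
  qed
  show ?thesis
  proof (rule that[of "\<lambda>x. G x + k"])
    fix x assume x: "x \<in> {s..t}"
    have d: "((\<lambda>x. F x + L x) has_vector_derivative G x + k) (at x within {s..t})"
      by (intro has_vector_derivative_add F[OF x] L)
    show "(v has_vector_derivative G x + k) (at x within {s..t})"
      by (rule has_vector_derivative_transform[OF x _ d]) (simp add: vz)
    show "((\<lambda>x. G x + k) has_vector_derivative f x) (at x within {s..t})"
      using has_vector_derivative_add[OF G[OF x] has_vector_derivative_const[of k]] by simp
  qed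
qed

text \<open>Nothing is assumed about derivatives of \<open>v\<close>; its regularity is recovered
  from the near-minimality of the curves \<open>V n\<close>.\<close>

locale limit_curve = connection +
  fixes V W :: "nat \<Rightarrow> real \<Rightarrow> 'a" and \<alpha> \<beta> :: "nat \<Rightarrow> real" and v :: "real \<Rightarrow> 'a"
  assumes minimising: "minimising V W \<alpha> \<beta>"
    and V_lim: "\<And>s t. uniform_limit {s..t} V v sequentially"
    and v_bounded: "bounded (range v)"
    and v0: "v 0 \<in> \<Omega>"
begin

definition act :: "nat \<Rightarrow> real" where
  "act n = kin (\<alpha> n) (\<beta> n) (W n) + pot U (\<alpha> n) (\<beta> n) (V n)"

lemma act_lim: "act \<longlonglongrightarrow> level"
  using minimising unfolding minimising_def act_def by blast

lemma V_curve: "curve (\<alpha> n) (\<beta> n) (V n) (W n)"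
  and V_Omega: "\<alpha> n < t \<Longrightarrow> t < \<beta> n \<Longrightarrow> V n t \<in> \<Omega>"
  and V_A: "t \<le> \<alpha> n \<Longrightarrow> V n t \<in> A" and V_B: "\<beta> n \<le> t \<Longrightarrow> V n t \<in> B"
  and \<alpha>\<beta>: "\<alpha> n < 0" "0 < \<beta> n"
  and V_cont: "continuous_on S (V n)"
  using minimising continuous_on_subset[of UNIV "V n" S] unfolding minimising_def by auto

lemma V_in: "V n t \<in> \<Omega> \<Longrightarrow> \<alpha> n < t \<and> t < \<beta> n"
  using V_A[of t n] V_B[of n t] frontier_disjoint AB by (metis UnI1 UnI2 not_le)

lemma V_closure: "V n t \<in> closure \<Omega>"
  using V_A[of t n] V_B[of n t] V_Omega[of n t] AB closure_subset
  by (metis (no_types, lifting) DiffE UnI1 UnI2 frontier_def not_le subsetD)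

lemma V_close: "e > 0 \<Longrightarrow> \<forall>\<^sub>F n in sequentially. \<forall>u\<in>{s..t}. dist (V n u) (v u) < e"
  by (rule uniform_limitD[OF V_lim])

lemma V_pointwise: "(\<lambda>n. V n t) \<longlonglongrightarrow> v t"
  using tendsto_uniform_limitI[OF V_lim[of t t]] by simp

lemma v_closure: "v t \<in> closure \<Omega>"
  by (rule closed_sequentially[OF closed_closure _ V_pointwise]) (use V_closure in auto)

lemma v_cont: "continuous_on S v"
proof -
  have "continuous_on {s..t} v" for s t
    by (rule uniform_limit_theorem[OF always_eventually V_lim]) (auto intro: V_cont)
  then have "isCont v x" for x
    using continuous_on_interior[of "{x-1..x+1}" v x] by simp
  then show ?thesis by (simp add: continuous_at_imp_continuous_on)
qed

text \<open>The perturbed limit has compact image, hence keeps a positive distance from the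
  complement of \<open>\<Omega>\<close>, and the convergence is uniform.\<close>

lemma eventually_in_Omega:
  assumes \<phi>: "continuous_on {s..t} \<phi>" and "\<And>u. u \<in> {s..t} \<Longrightarrow> v u + \<phi> u \<in> \<Omega>"
  shows "\<forall>\<^sub>F n in sequentially. \<forall>u\<in>{s..t}. V n u + \<phi> u \<in> \<Omega>"
proof -
  have "compact ((\<lambda>u. v u + \<phi> u) ` {s..t})"
    by (intro compact_continuous_image continuous_intros v_cont \<phi>) auto
  then obtain eps where eps: "eps > 0" "(\<Union>x\<in>(\<lambda>u. v u + \<phi> u) ` {s..t}. ball x eps) \<subseteq> \<Omega>"
    using compact_subset_open_imp_ball_epsilon_subset[OF _ open_Omega] assms(2) by blast
  from V_close[OF eps(1), of s t] show ?thesis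
  proof eventually_elim
    case (elim n)
    show ?case
    proof
      fix u assume u: "u \<in> {s..t}"
      then have "V n u + \<phi> u \<in> ball (v u + \<phi> u) eps" using elim by (auto simp: dist_commute)
      then show "V n u + \<phi> u \<in> \<Omega>" using eps(2) u by blast
    qed
  qed
qed

lemma eventually_window:
  assumes "\<And>u. u \<in> {s..t} \<Longrightarrow> v u \<in> \<Omega>"
  shows "\<forall>\<^sub>F n in sequentially. \<forall>u\<in>{s..t}. V n u \<in> \<Omega>"
  using eventually_in_Omega[of s t "\<lambda>_. 0"] assms by simp

lemma V_unif_bounded:
  obtains R where "\<forall>\<^sub>F n in sequentially. \<forall>u\<in>{s..t}. norm (V n u) \<le> R" "\<And>u. norm (v u) \<le> R"
proof -
  obtain R where R: "\<And>u. norm (v u) \<le> R" using v_bounded by (auto simp: bounded_iff)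
  have "\<forall>\<^sub>F n in sequentially. \<forall>u\<in>{s..t}. norm (V n u) \<le> R + 1"
    using V_close[OF zero_less_one, of s t]
  proof eventually_elim
    case (elim n)
    show ?case
    proof
      fix u assume "u \<in> {s..t}"
      then have "dist (V n u) (v u) < 1" using elim by blast
      then show "norm (V n u) \<le> R + 1"
        using R[of u] norm_triangle_sub[of "V n u" "v u"] by (simp add: dist_norm)
    qed
  qed
  then show ?thesis using that[of "R + 1"] R by (meson add_increasing2 zero_le_one)
qed

lemma pot_lim:
  assumes \<phi>: "continuous_on {s..t} \<phi>"
  shows "(\<lambda>n. pot U s t (\<lambda>u. V n u + \<phi> u)) \<longlonglongrightarrow> pot U s t (\<lambda>u. v u + \<phi> u)"
proof -
  \<comment> \<open>\<open>U\<close> is uniformly continuous only on bounded sets, so the curves are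
    first confined to a ball.\<close>
  obtain R where R: "\<forall>\<^sub>F n in sequentially. \<forall>u\<in>{s..t}. norm (V n u) \<le> R" "\<And>u. norm (v u) \<le> R"
    using V_unif_bounded by blast
  have "bounded (\<phi> ` {s..t})"
    by (intro compact_imp_bounded compact_continuous_image \<phi>) auto
  then obtain R' where R': "\<And>u. u \<in> {s..t} \<Longrightarrow> norm (\<phi> u) \<le> R'" unfolding bounded_iff by blast
  have u: "uniform_limit {s..t} (\<lambda>n u. V n u + \<phi> u) (\<lambda>u. v u + \<phi> u) sequentially"
    by (intro uniform_limit_add V_lim uniform_limit_const)
  have "uniform_limit {s..t} (\<lambda>n u. U (V n u + \<phi> u)) (U \<circ> (\<lambda>u. v u + \<phi> u)) sequentially"
  proof (rule uniform_limit_compose[OF u, of "cball 0 (R + R')"])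
    show "uniformly_continuous_on (cball 0 (R + R')) U"
      by (intro compact_uniformly_continuous U_cont compact_cball)
    show "\<forall>\<^sub>F n in sequentially. (\<lambda>u. V n u + \<phi> u) ` {s..t} \<subseteq> cball 0 (R + R')"
      using R(1) by eventually_elim (auto intro!: norm_triangle_mono R')
    show "(\<lambda>u. v u + \<phi> u) ` {s..t} \<subseteq> cball 0 (R + R')"
      by (auto intro!: norm_triangle_mono R' R)
  qed
  then obtain I J where IJ: "\<And>n. ((\<lambda>u. U (V n u + \<phi> u)) has_integral I n) {s..t}"
    "(U \<circ> (\<lambda>u. v u + \<phi> u) has_integral J) {s..t}" "(I \<longlongrightarrow> J) sequentially"
    by (rule uniform_limit_integral)
       (auto intro!: continuous_on_compose2[OF U_cont] continuous_intros V_cont \<phi>)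
  have "I = (\<lambda>n. pot U s t (\<lambda>u. V n u + \<phi> u))" "J = pot U s t (\<lambda>u. v u + \<phi> u)"
    using integral_unique[OF IJ(1)] integral_unique[OF IJ(2)] by (auto simp: pot_def o_def)
  then show ?thesis using IJ(3) by simp
qed

lemma pot_lim0: "(\<lambda>n. pot U s t (V n)) \<longlonglongrightarrow> pot U s t v"
  using pot_lim[of s t "\<lambda>_. 0"] by simp

lemma inner_integral_lim:
  assumes q: "continuous_on {s..t} q"
  shows "(\<lambda>n. integral {s..t} (\<lambda>u. V n u \<bullet> q u)) \<longlonglongrightarrow> integral {s..t} (\<lambda>u. v u \<bullet> q u)"
proof -
  have "bounded (q ` {s..t})" "bounded (v ` {s..t})"
    by (intro compact_imp_bounded compact_continuous_image q v_cont; auto)+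
  then have u: "uniform_limit {s..t} (\<lambda>n u. V n u \<bullet> q u) (\<lambda>u. v u \<bullet> q u) sequentially"
    by (intro bounded_bilinear.bounded_uniform_limit[OF bounded_bilinear_inner]
          V_lim uniform_limit_const)
  then obtain I J where IJ: "\<And>n. ((\<lambda>u. V n u \<bullet> q u) has_integral I n) {s..t}"
    "((\<lambda>u. v u \<bullet> q u) has_integral J) {s..t}" "(I \<longlongrightarrow> J) sequentially"
    by (rule uniform_limit_integral)
       (auto intro!: continuous_intros V_cont q)
  have "I = (\<lambda>n. integral {s..t} (\<lambda>u. V n u \<bullet> q u))" "J = integral {s..t} (\<lambda>u. v u \<bullet> q u)"
    using integral_unique[OF IJ(1)] integral_unique[OF IJ(2)] by auto
  then show ?thesis using IJ(3) by simp
qed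

lemma V_split:
  assumes "\<alpha> n \<le> s" "s \<le> t" "t \<le> \<beta> n"
  shows "act n = (kin (\<alpha> n) s (W n) + pot U (\<alpha> n) s (V n)) + (kin s t (W n) + pot U s t (V n))
    + (kin t (\<beta> n) (W n) + pot U t (\<beta> n) (V n))"
proof -
  have "kin (\<alpha> n) (\<beta> n) (W n) = kin (\<alpha> n) s (W n) + kin s (\<beta> n) (W n)"
    by (rule curve_split[OF V_curve]) (use assms in auto)
  moreover have "kin s (\<beta> n) (W n) = kin s t (W n) + kin t (\<beta> n) (W n)"
    by (rule curve_split[OF curve_subset[OF V_curve]]) (use assms in auto)
  moreover have "pot U (\<alpha> n) (\<beta> n) (V n) = pot U (\<alpha> n) s (V n) + pot U s (\<beta> n) (V n)"
    by (rule pot_split[OF V_cont U_cont]) (use assms in auto)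
  moreover have "pot U s (\<beta> n) (V n) = pot U s t (V n) + pot U t (\<beta> n) (V n)"
    by (rule pot_split[OF V_cont U_cont]) (use assms in auto)
  ultimately show ?thesis by (simp add: act_def)
qed

lemma V_link:
  assumes "\<alpha> n \<le> s" "s \<le> t" "t \<le> \<beta> n"
  shows "link (V n s) (V n t) (kin s t (W n) + pot U s t (V n))"
  by (rule linkI[OF curve_subset[OF V_curve]]) (use assms in \<open>auto intro: V_Omega\<close>)

text \<open>Exchanging a piece of \<open>V n\<close> for another link with the same end points gives
  again a competitor, which costs at least \<open>level\<close>. So every piece is minimal up to the
  error \<open>act n - level\<close>, which tends to \<open>0\<close>.\<close>

lemma replace:
  assumes "V n s \<in> \<Omega>" "V n t \<in> \<Omega>" "s \<le> t" "link (V n s) (V n t) c"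
  shows "kin s t (W n) + pot U s t (V n) \<le> c + (act n - level)"
proof -
  have st: "\<alpha> n < s" "s < \<beta> n" "\<alpha> n < t" "t < \<beta> n" using V_in assms by auto
  have "link (V n (\<alpha> n)) (V n t) (kin (\<alpha> n) s (W n) + pot U (\<alpha> n) s (V n) + c)"
    by (rule link_join[OF V_link assms(4,1)]) (use st in auto)
  from link_join[OF this V_link assms(2)] st
  have "link (V n (\<alpha> n)) (V n (\<beta> n)) (kin (\<alpha> n) s (W n) + pot U (\<alpha> n) s (V n) + c +
    (kin t (\<beta> n) (W n) + pot U t (\<beta> n) (V n)))" by auto
  from level_le[OF V_A V_B this] V_split[of n s t] st assms(3) show ?thesis by auto
qed

text \<open>\<open>replace\<close> compares \<open>V n\<close> with \<open>V n + \<phi>\<close>; by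
  \<open>curve_add\<close> the kinetic energy of \<open>W n\<close> cancels, and the remaining terms
  converge. The perturbation is finite, not infinitesimal, so both the first and the second
  variation can be extracted.\<close>

lemma variation:
  assumes st: "s \<le> t" and v: "\<And>u. u \<in> {s..t} \<Longrightarrow> v u \<in> \<Omega>"
    and \<phi>: "\<And>u. u \<in> {s..t} \<Longrightarrow> (\<phi> has_vector_derivative p u) (at u within {s..t})"
    and p: "\<And>u. u \<in> {s..t} \<Longrightarrow> (p has_vector_derivative p' u) (at u within {s..t})"
    and p': "continuous_on {s..t} p'"
    and ends: "\<phi> s = 0" "\<phi> t = 0"
    and v\<phi>: "\<And>u. u \<in> {s..t} \<Longrightarrow> v u + \<phi> u \<in> \<Omega>"
  shows "0 \<le> (v t \<bullet> p t - v s \<bullet> p s - integral {s..t} (\<lambda>u. v u \<bullet> p' u)) + kin s t p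
    + (pot U s t (\<lambda>u. v u + \<phi> u) - pot U s t v)"
proof -
  have \<phi>c: "continuous_on {s..t} \<phi>" by (rule has_vector_derivative_on_continuous[OF \<phi>])
  define X where "X n = (V n t \<bullet> p t - V n s \<bullet> p s - integral {s..t} (\<lambda>u. V n u \<bullet> p' u)) + kin s t p
    + (pot U s t (\<lambda>u. V n u + \<phi> u) - pot U s t (V n))" for n
  have "X \<longlonglongrightarrow> (v t \<bullet> p t - v s \<bullet> p s - integral {s..t} (\<lambda>u. v u \<bullet> p' u)) + kin s t p
    + (pot U s t (\<lambda>u. v u + \<phi> u) - pot U s t v)"
    unfolding X_def
    by (intro tendsto_intros V_pointwise inner_integral_lim p' pot_lim \<phi>c pot_lim0)
  moreover have lim2: "(\<lambda>n. level - act n) \<longlonglongrightarrow> level - level"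
    by (intro tendsto_intros act_lim)
  have ev: "\<forall>\<^sub>F n in sequentially. \<forall>u\<in>{s..t}. V n u \<in> \<Omega>"
    by (rule eventually_window) (fact v)
  have "\<forall>\<^sub>F n in sequentially. \<forall>u\<in>{s..t}. V n u + \<phi> u \<in> \<Omega>"
    by (rule eventually_in_Omega[OF \<phi>c]) (fact v\<phi>)
  with ev have fin: "\<forall>\<^sub>F n in sequentially. level - act n \<le> X n"
  proof eventually_elim
    case (elim n)
    have on: "\<alpha> n < s" "t < \<beta> n" using V_in elim(1) st by auto
    have c: "curve s t (V n) (W n)" by (rule curve_subset[OF V_curve]) (use on st in auto)
    note a = curve_add[OF c \<phi> p p']
    have "link (V n s + \<phi> s) (V n t + \<phi> t) (kin s t (\<lambda>u. W n u + p u) + pot U s t (\<lambda>u. V n u + \<phi> u))"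
      by (rule linkI[OF a(1)]) (use elim in auto)
    then have "kin s t (W n) + pot U s t (V n) \<le>
        kin s t (\<lambda>u. W n u + p u) + pot U s t (\<lambda>u. V n u + \<phi> u) + (act n - level)"
      using elim st ends by (intro replace) auto
    then show ?case using a(2) by (simp add: X_def)
  qed
  moreover note fin lim2
  ultimately show ?thesis using tendsto_le[of sequentially X _ "\<lambda>n. level - act n"] by simp
qed

section \<open>The Euler-Lagrange equation for the limit curve\<close>

lemma pot_derivative:
  assumes \<phi>: "continuous_on {s..t} \<phi>"
  shows "((\<lambda>eps. pot U s t (\<lambda>u. v u + eps *\<^sub>R \<phi> u)) has_field_derivative
     integral {s..t} (\<lambda>u. g (v u) \<bullet> \<phi> u)) (at 0)"
proof -
  have "((\<lambda>eps. integral (cbox s t) (\<lambda>u. U (v u + eps *\<^sub>R \<phi> u))) has_field_derivative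
     integral (cbox s t) (\<lambda>u. g (v u + 0 *\<^sub>R \<phi> u) \<bullet> \<phi> u)) (at 0 within UNIV)"
  proof (rule leibniz_rule_field_derivative[where fx = "\<lambda>eps u. g (v u + eps *\<^sub>R \<phi> u) \<bullet> \<phi> u"])
    fix eps u :: real
    have "((\<lambda>eps. v u + eps *\<^sub>R \<phi> u) has_derivative (\<lambda>h. h *\<^sub>R \<phi> u)) (at eps)"
      by (auto intro!: derivative_eq_intros)
    from diff_chain_at[OF this U_deriv]
    show "((\<lambda>eps. U (v u + eps *\<^sub>R \<phi> u)) has_field_derivative g (v u + eps *\<^sub>R \<phi> u) \<bullet> \<phi> u) (at eps)"
      by (simp add: has_field_derivative_def o_def mult_commute_abs)
  next
    fix eps :: real
    show "(\<lambda>u. U (v u + eps *\<^sub>R \<phi> u)) integrable_on cbox s t"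
      using \<phi> by (intro integrable_continuous continuous_on_compose2[OF U_cont] continuous_intros v_cont) auto
  next
    have 1: "continuous_on (UNIV \<times> cbox s t) (\<lambda>x. v (snd x))"
      by (intro continuous_on_compose2[OF v_cont] continuous_intros) auto
    have 2: "continuous_on (UNIV \<times> cbox s t) (\<lambda>x. \<phi> (snd x))"
      by (intro continuous_on_compose2[OF \<phi>] continuous_intros) auto
    have "continuous_on (UNIV \<times> cbox s t) (\<lambda>x. g (v (snd x) + fst x *\<^sub>R \<phi> (snd x)) \<bullet> \<phi> (snd x))"
      by (intro continuous_intros continuous_on_compose2[OF g_cont'] 1 2) auto
    then show "continuous_on (UNIV \<times> cbox s t) (\<lambda>(eps, u). g (v u + eps *\<^sub>R \<phi> u) \<bullet> \<phi> u)"
      by (simp add: case_prod_beta)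
  qed auto
  then show ?thesis by (simp add: pot_def)
qed

lemma kin_scale: "kin s t (\<lambda>u. eps *\<^sub>R p u) = eps\<^sup>2 * kin s t p"
  unfolding kin_def by (simp add: power_mult_distrib)

lemma small_multiples:
  assumes \<phi>: "continuous_on {s..t} \<phi>" and v: "\<And>u. u \<in> {s..t} \<Longrightarrow> v u \<in> \<Omega>"
  obtains e where "e > 0" "\<And>eps u. \<bar>eps\<bar> < e \<Longrightarrow> u \<in> {s..t} \<Longrightarrow> v u + eps *\<^sub>R \<phi> u \<in> \<Omega>"
proof -
  have "compact (v ` {s..t})" by (intro compact_continuous_image v_cont) auto
  then obtain r where r: "r > 0" "(\<Union>x\<in>v ` {s..t}. ball x r) \<subseteq> \<Omega>"
    using compact_subset_open_imp_ball_epsilon_subset[OF _ open_Omega] v by blast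
  have "bounded (\<phi> ` {s..t})"
    by (intro compact_imp_bounded compact_continuous_image \<phi>) auto
  then obtain R where R: "R > 0" "\<And>u. u \<in> {s..t} \<Longrightarrow> norm (\<phi> u) \<le> R"
    unfolding bounded_pos by auto
  show ?thesis
  proof (rule that[of "r / R"])
    fix eps u assume *: "\<bar>eps\<bar> < r / R" "u \<in> {s..t}"
    have "\<bar>eps\<bar> * norm (\<phi> u) \<le> \<bar>eps\<bar> * R" using R(2)[OF *(2)] by (intro mult_left_mono) auto
    also have "\<dots> < r" using *(1) R(1) by (simp add: pos_less_divide_eq)
    finally have "v u + eps *\<^sub>R \<phi> u \<in> ball (v u) r" by (simp add: dist_norm)
    then show "v u + eps *\<^sub>R \<phi> u \<in> \<Omega>" using r(2) *(2) by blast
  qed (use r R in auto)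
qed

lemma weak_Euler_Lagrange:
  assumes st: "s \<le> t" and v: "\<And>u. u \<in> {s..t} \<Longrightarrow> v u \<in> \<Omega>"
    and \<phi>: "\<And>u. u \<in> {s..t} \<Longrightarrow> (\<phi> has_vector_derivative p u) (at u within {s..t})"
    and p: "\<And>u. u \<in> {s..t} \<Longrightarrow> (p has_vector_derivative p' u) (at u within {s..t})"
    and p': "continuous_on {s..t} p'"
    and ends: "\<phi> s = 0" "\<phi> t = 0"
  shows "v t \<bullet> p t - v s \<bullet> p s - integral {s..t} (\<lambda>u. v u \<bullet> p' u) + integral {s..t} (\<lambda>u. g (v u) \<bullet> \<phi> u) = 0"
proof -
  have \<phi>c: "continuous_on {s..t} \<phi>" by (rule has_vector_derivative_on_continuous[OF \<phi>])
  define a where "a = v t \<bullet> p t - v s \<bullet> p s - integral {s..t} (\<lambda>u. v u \<bullet> p' u)"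
  \<comment> \<open>The right-hand side of \<open>variation\<close> for the perturbation
    \<open>eps *\<^sub>R \<phi>\<close>: it vanishes at \<open>0\<close> and is nonnegative nearby,
    so its derivative there is zero.\<close>
  define h where "h eps = eps * a + eps\<^sup>2 * kin s t p + (pot U s t (\<lambda>u. v u + eps *\<^sub>R \<phi> u) - pot U s t v)" for eps
  obtain e where e: "e > 0" "\<And>eps u. \<bar>eps\<bar> < e \<Longrightarrow> u \<in> {s..t} \<Longrightarrow> v u + eps *\<^sub>R \<phi> u \<in> \<Omega>"
    using small_multiples[OF \<phi>c v] by blast
  have h: "0 \<le> h eps" if "\<bar>eps\<bar> < e" for eps
  proof -
    have "0 \<le> (v t \<bullet> (eps *\<^sub>R p t) - v s \<bullet> (eps *\<^sub>R p s) - integral {s..t} (\<lambda>u. v u \<bullet> (eps *\<^sub>R p' u)))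
      + kin s t (\<lambda>u. eps *\<^sub>R p u) + (pot U s t (\<lambda>u. v u + eps *\<^sub>R \<phi> u) - pot U s t v)"
      by (rule variation[OF st v]) (use e(2)[OF that] ends in
         \<open>auto intro!: continuous_intros p'
            bounded_linear.has_vector_derivative[OF bounded_linear_scaleR_right] \<phi> p\<close>)
    then show ?thesis unfolding h_def a_def kin_scale by (simp add: algebra_simps)
  qed
  have "(h has_field_derivative (a + integral {s..t} (\<lambda>u. g (v u) \<bullet> \<phi> u))) (at 0)"
    unfolding h_def by (auto intro!: derivative_eq_intros pot_derivative[OF \<phi>c])
  from DERIV_local_min[OF this e(1)] h have "a + integral {s..t} (\<lambda>u. g (v u) \<bullet> \<phi> u) = 0"
    by (simp add: h_def)
  then show ?thesis by (simp add: a_def)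
qed

lemma Newton:
  assumes "s < t" "\<And>u. u \<in> {s..t} \<Longrightarrow> v u \<in> \<Omega>"
  obtains v' where "\<And>x. x \<in> {s..t} \<Longrightarrow> (v has_vector_derivative v' x) (at x within {s..t})"
    "\<And>x. x \<in> {s..t} \<Longrightarrow> (v' has_vector_derivative g (v x)) (at x within {s..t})"
  by (rule du_Bois_Reymond[OF assms(1) v_cont, of "\<lambda>x. g (v x)"])
     (use weak_Euler_Lagrange[OF less_imp_le[OF assms(1)] assms(2)]
      in \<open>auto intro!: continuous_on_compose2[OF g_cont'] v_cont\<close>)

end

section \<open>The limit curve reaches the boundary in finite time\<close>

text \<open>Strict concavity of \<open>U\<close> along lines in direction \<open>e\<close>, uniform
  near \<open>q\<close> and phrased with the gradient only. It is applied with \<open>x\<close> on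
  the limit curve and \<open>c\<close> the size of the perturbation, and then bounds the integrand
  of the second variation.\<close>

definition concave_direction_at :: "('a::euclidean_space \<Rightarrow> real) \<Rightarrow> ('a \<Rightarrow> 'a) \<Rightarrow> 'a \<Rightarrow> bool" where
  "concave_direction_at U g q \<longleftrightarrow> (\<exists>e \<kappa> r. \<kappa> > 0 \<and> r > 0 \<and>
     (\<forall>x c. x \<in> ball q r \<longrightarrow> x + c *\<^sub>R e \<in> ball q r \<longrightarrow>
       U (x + c *\<^sub>R e) \<le> U x + c * (g x \<bullet> e) - \<kappa> * c\<^sup>2))"

context limit_curve
begin

text \<open>A total function whose value is meaningful only at times when \<open>v\<close> is in
  \<open>\<Omega>\<close>.\<close>

definition vd :: "real \<Rightarrow> 'a" where
  "vd u = vector_derivative v (at u)"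

text \<open>\<open>Newton\<close> yields a velocity depending on the chosen interval; uniqueness of
  derivatives identifies it with \<open>vd\<close>, so the local solutions fit together.\<close>

lemma v_deriv_aux:
  assumes "v u \<in> \<Omega>"
  shows "(v has_vector_derivative vd u) (at u) \<and> (vd has_vector_derivative g (v u)) (at u)"
proof -
  have "open (v -` \<Omega>)" by (rule open_vimage[OF open_Omega v_cont])
  then obtain h where h: "h > 0" "cball u h \<subseteq> v -` \<Omega>"
    using assms open_contains_cball by (metis vimageI)
  then have in\<Omega>: "v x \<in> \<Omega>" if "x \<in> {u - h..u + h}" for x
    using that by (auto simp: cball_def dist_real_def subset_iff abs_le_iff)
  have lt: "u - h < u + h" using h by simp
  obtain v' where v': "\<And>x. x \<in> {u - h..u + h} \<Longrightarrow> (v has_vector_derivative v' x) (at x within {u - h..u + h})"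
    "\<And>x. x \<in> {u - h..u + h} \<Longrightarrow> (v' has_vector_derivative g (v x)) (at x within {u - h..u + h})"
    using Newton[OF lt in\<Omega>] by blast
  have d: "(v has_vector_derivative v' x) (at x)" "(v' has_vector_derivative g (v x)) (at x)"
    if "x \<in> {u - h<..<u + h}" for x
  proof -
    have x: "x \<in> {u - h..u + h}" and at: "at x within {u - h..u + h} = at x"
      using that by (auto intro: at_within_Icc_at)
    show "(v has_vector_derivative v' x) (at x)" "(v' has_vector_derivative g (v x)) (at x)"
      using v'[OF x] unfolding at by auto
  qed
  have eq: "v' x = vd x" if "x \<in> {u - h<..<u + h}" for x
    using vector_derivative_at[OF d(1)[OF that]] by (simp add: vd_def)
  have u: "u \<in> {u - h<..<u + h}" using h by simp
  show ?thesis
    using d(1)[OF u] has_vector_derivative_transform_within_open[OF d(2)[OF u] open_greaterThanLessThan u eq]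
      eq[OF u] by simp
qed

lemma v_deriv: "v u \<in> \<Omega> \<Longrightarrow> (v has_vector_derivative vd u) (at u within S)"
  and vd_deriv: "v u \<in> \<Omega> \<Longrightarrow> (vd has_vector_derivative g (v u)) (at u within S)"
  using v_deriv_aux has_vector_derivative_at_within by blast+

lemma vd_cont: "(\<And>u. u \<in> S \<Longrightarrow> v u \<in> \<Omega>) \<Longrightarrow> continuous_on S vd"
  by (rule has_vector_derivative_on_continuous[OF vd_deriv])

lemma gv_cont: "continuous_on S (\<lambda>u. g (v u))"
  by (rule continuous_on_compose2[OF g_cont v_cont]) auto

lemma Uv_cont: "continuous_on S (\<lambda>u. U (v u))"
  by (rule continuous_on_compose2[OF U_cont[of UNIV] v_cont]) auto

lemma v_curve: "s \<le> t \<Longrightarrow> (\<And>u. u \<in> {s..t} \<Longrightarrow> v u \<in> \<Omega>) \<Longrightarrow> curve s t v vd"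
  by (rule curve_C1) (auto intro: v_deriv vd_cont)

lemma pot_nonneg: "0 \<le> pot U s t v"
  unfolding pot_def by (rule integral_nonneg)
    (auto intro!: integrable_continuous_real Uv_cont U_nonneg v_closure)

lemma pot_pos:
  assumes "s < t" "\<And>u. u \<in> {s..t} \<Longrightarrow> v u \<in> \<Omega>"
  shows "0 < pot U s t v"
proof -
  have "pot U s t v \<noteq> 0"
    unfolding pot_def
    using integral_eq_0_iff[OF Uv_cont assms(1)] U_nonneg[OF v_closure] U_pos[OF assms(2)[of s]] assms(1)
    by auto
  then show ?thesis using pot_nonneg[of s t] by simp
qed

text \<open>\<open>variation\<close> minus \<open>weak_Euler_Lagrange\<close>: the terms linear in
  \<open>\<phi>\<close> cancel, leaving the kinetic energy of \<open>\<phi>\<close> and the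
  remainder of \<open>U\<close> after its linear part.\<close>

lemma second_variation:
  assumes st: "s \<le> t" and v: "\<And>u. u \<in> {s..t} \<Longrightarrow> v u \<in> \<Omega>"
    and \<phi>: "\<And>u. u \<in> {s..t} \<Longrightarrow> (\<phi> has_vector_derivative p u) (at u within {s..t})"
    and p: "\<And>u. u \<in> {s..t} \<Longrightarrow> (p has_vector_derivative p' u) (at u within {s..t})"
    and p': "continuous_on {s..t} p'"
    and ends: "\<phi> s = 0" "\<phi> t = 0"
    and v\<phi>: "\<And>u. u \<in> {s..t} \<Longrightarrow> v u + \<phi> u \<in> \<Omega>"
  shows "0 \<le> kin s t p + integral {s..t} (\<lambda>u. U (v u + \<phi> u) - U (v u) - g (v u) \<bullet> \<phi> u)"
proof -
  have \<phi>c: "continuous_on {s..t} \<phi>" by (rule has_vector_derivative_on_continuous[OF \<phi>])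
  have "integral {s..t} (\<lambda>u. U (v u + \<phi> u) - U (v u) - g (v u) \<bullet> \<phi> u) =
     pot U s t (\<lambda>u. v u + \<phi> u) - pot U s t v - integral {s..t} (\<lambda>u. g (v u) \<bullet> \<phi> u)"
    unfolding pot_def
    by (subst Henstock_Kurzweil_Integration.integral_diff
       | intro integrable_continuous_real continuous_intros Uv_cont gv_cont \<phi>c
          continuous_on_compose2[OF U_cont[of UNIV]] v_cont subset_UNIV refl)+
  then show ?thesis
    using variation[OF st v \<phi> p p' ends v\<phi>] weak_Euler_Lagrange[OF st v \<phi> p p' ends] by linarith
qed

text \<open>The test function is \<open>eps (u - s) (t - u) e\<close>.\<close>

lemma concave_direction_window:
  assumes st: "s < t" and v: "\<And>u. u \<in> {s..t} \<Longrightarrow> v u \<in> \<Omega>" and q: "\<And>u. u \<in> {s..t} \<Longrightarrow> v u \<in> ball q r"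
    and conc: "\<And>x c. x \<in> ball q r \<Longrightarrow> x + c *\<^sub>R e \<in> ball q r \<Longrightarrow> U (x + c *\<^sub>R e) \<le> U x + c * (g x \<bullet> e) - \<kappa> * c\<^sup>2"
  shows "\<kappa> * (t - s)\<^sup>2 \<le> 5 * (norm e)\<^sup>2"
proof -
  define \<psi> where "\<psi> u = (u - s) * (t - u)" for u
  have \<psi>c: "continuous_on {s..t} \<psi>" unfolding \<psi>_def by (intro continuous_intros)
  have \<psi>e: "continuous_on {s..t} (\<lambda>u. \<psi> u *\<^sub>R e)" by (intro continuous_intros \<psi>c)
  obtain e1 where e1: "e1 > 0" "\<And>eps u. \<bar>eps\<bar> < e1 \<Longrightarrow> u \<in> {s..t} \<Longrightarrow> v u + eps *\<^sub>R \<psi> u *\<^sub>R e \<in> \<Omega>"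
    using small_multiples[OF \<psi>e v] by blast
  have "compact (v ` {s..t})" by (intro compact_continuous_image v_cont) auto
  then obtain d where d: "d > 0" "(\<Union>x\<in>v ` {s..t}. ball x d) \<subseteq> ball q r"
    using compact_subset_open_imp_ball_epsilon_subset[OF _ open_ball] q by blast
  define K where "K = (t - s)\<^sup>2 * norm e + 1"
  have \<psi>K: "norm (\<psi> u *\<^sub>R e) < K" if "u \<in> {s..t}" for u
  proof -
    have "\<psi> u \<le> (t - s) * (t - s)" "0 \<le> \<psi> u"
      unfolding \<psi>_def using that by (auto intro!: mult_mono)
    then have "\<bar>\<psi> u\<bar> * norm e \<le> (t - s)\<^sup>2 * norm e"
      by (intro mult_right_mono) (auto simp: power2_eq_square)
    then show ?thesis by (simp add: K_def)
  qed
  have K: "K > 0" by (auto simp: K_def intro: add_nonneg_pos)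
  \<comment> \<open>Small enough for the perturbed curve to stay both in \<open>\<Omega>\<close> and
    in the ball about \<open>q\<close>. Its value drops out at the end, because both terms compared
    are quadratic in it.\<close>
  define eps where "eps = min (e1 / 2) (d / K)"
  have eps: "eps > 0" "\<bar>eps\<bar> < e1" "eps * K \<le> d"
    using e1 d K by (auto simp: eps_def min_def field_simps)
  have in_ball: "v u + (eps * \<psi> u) *\<^sub>R e \<in> ball q r" if "u \<in> {s..t}" for u
  proof -
    have "eps * norm (\<psi> u *\<^sub>R e) < eps * K" using \<psi>K[OF that] eps(1) by (intro mult_strict_left_mono)
    moreover have "norm ((eps * \<psi> u) *\<^sub>R e) = eps * norm (\<psi> u *\<^sub>R e)"
      using eps(1) by (simp add: abs_mult mult.assoc)
    ultimately have "norm ((eps * \<psi> u) *\<^sub>R e) < d" using eps(3) by linarith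
    then have "v u + (eps * \<psi> u) *\<^sub>R e \<in> ball (v u) d" by (simp add: dist_norm)
    then show ?thesis using d(2) that by blast
  qed
  have "0 \<le> kin s t (\<lambda>u. (eps * (s + t - 2 * u)) *\<^sub>R e) +
     integral {s..t} (\<lambda>u. U (v u + (eps * \<psi> u) *\<^sub>R e) - U (v u) - g (v u) \<bullet> ((eps * \<psi> u) *\<^sub>R e))"
  proof (rule second_variation[where p' = "\<lambda>u. (eps * (- 2)) *\<^sub>R e"])
    show "((\<lambda>u. (eps * \<psi> u) *\<^sub>R e) has_vector_derivative (eps * (s + t - 2 * u)) *\<^sub>R e) (at u within {s..t})" for u
      unfolding \<psi>_def by (auto intro!: derivative_eq_intros simp: algebra_simps)
    show "((\<lambda>u. (eps * (s + t - 2 * u)) *\<^sub>R e) has_vector_derivative (eps * (- 2)) *\<^sub>R e) (at u within {s..t})" for u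
      by (auto intro!: derivative_eq_intros)
  qed (use st v e1(2)[OF eps(2)] in \<open>auto simp: \<psi>_def mult.assoc\<close>)
  moreover have "integral {s..t} (\<lambda>u. U (v u + (eps * \<psi> u) *\<^sub>R e) - U (v u) - g (v u) \<bullet> ((eps * \<psi> u) *\<^sub>R e))
     \<le> integral {s..t} (\<lambda>u. - \<kappa> * (eps * \<psi> u)\<^sup>2)"
  proof (rule integral_le)
    show "(\<lambda>u. U (v u + (eps * \<psi> u) *\<^sub>R e) - U (v u) - g (v u) \<bullet> ((eps * \<psi> u) *\<^sub>R e)) integrable_on {s..t}"
      by (intro integrable_continuous_real continuous_intros Uv_cont gv_cont \<psi>c
          continuous_on_compose2[OF U_cont[of UNIV]] v_cont subset_UNIV)
    show "(\<lambda>u. - \<kappa> * (eps * \<psi> u)\<^sup>2) integrable_on {s..t}"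
      by (intro integrable_continuous_real continuous_intros \<psi>c)
    show "U (v u + (eps * \<psi> u) *\<^sub>R e) - U (v u) - g (v u) \<bullet> ((eps * \<psi> u) *\<^sub>R e) \<le> - \<kappa> * (eps * \<psi> u)\<^sup>2"
      if "u \<in> {s..t}" for u
      using conc[OF q[OF that] in_ball[OF that]] by simp
  qed
  moreover have "((\<lambda>u. (norm ((eps * (s + t - 2 * u)) *\<^sub>R e))\<^sup>2 / 2) has_integral eps\<^sup>2 * (norm e)\<^sup>2 * ((t - s)^3 / 6)) {s..t}"
  proof -
    have "((\<lambda>u. eps\<^sup>2 * (norm e)\<^sup>2 * ((s + t - 2 * u)\<^sup>2 / 2)) has_integral
       eps\<^sup>2 * (norm e)\<^sup>2 * (- ((s + t - 2 * t)^3) / 12) - eps\<^sup>2 * (norm e)\<^sup>2 * (- ((s + t - 2 * s)^3) / 12)) {s..t}"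
      by (rule fundamental_theorem_of_calculus[OF less_imp_le[OF st]])
         (auto intro!: derivative_eq_intros simp: has_real_derivative_iff_has_vector_derivative[symmetric] power2_eq_square)
    moreover have "eps\<^sup>2 * (norm e)\<^sup>2 * (- ((s + t - 2 * t)^3) / 12) - eps\<^sup>2 * (norm e)\<^sup>2 * (- ((s + t - 2 * s)^3) / 12)
       = eps\<^sup>2 * (norm e)\<^sup>2 * ((t - s)^3 / 6)"
      by (simp add: power3_eq_cube field_simps)
    moreover have "(norm ((eps * (s + t - 2 * u)) *\<^sub>R e))\<^sup>2 / 2 = eps\<^sup>2 * (norm e)\<^sup>2 * ((s + t - 2 * u)\<^sup>2 / 2)" for u
      by (simp add: power_mult_distrib mult_ac)
    ultimately show ?thesis by (simp only:)
  qed
  then have "kin s t (\<lambda>u. (eps * (s + t - 2 * u)) *\<^sub>R e) = eps\<^sup>2 * (norm e)\<^sup>2 * ((t - s)^3 / 6)"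
    unfolding kin_def by (rule integral_unique)
  moreover have "((\<lambda>u. - \<kappa> * (eps * \<psi> u)\<^sup>2) has_integral - \<kappa> * eps\<^sup>2 * ((t - s)^5 / 30)) {s..t}"
  proof -
    \<comment> \<open>Antiderivative of the square of \<open>\<psi>\<close>, expanded in powers of
      \<open>u - s\<close> through \<open>t - u = (t - s) - (u - s)\<close>.\<close>
    define P where "P u = - \<kappa> * eps\<^sup>2 * ((t - s)\<^sup>2 * (u - s)^3 / 3 - (t - s) * (u - s)^4 / 2 + (u - s)^5 / 5)" for u
    have "((\<lambda>u. - \<kappa> * (eps * \<psi> u)\<^sup>2) has_integral P t - P s) {s..t}"
    proof (rule fundamental_theorem_of_calculus[OF less_imp_le[OF st]])
      fix u
      have "(P has_real_derivative - \<kappa> * eps\<^sup>2 * ((t - s)\<^sup>2 * (u - s)^2 - (t - s) * (2 * (u - s)^3) + (u - s)^4)) (at u within {s..t})"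
        unfolding P_def by (rule derivative_eq_intros refl | simp)+
      moreover have "(t - s)\<^sup>2 * (u - s)^2 - (t - s) * (2 * (u - s)^3) + (u - s)^4 = (\<psi> u)\<^sup>2"
        unfolding \<psi>_def by algebra
      ultimately show "(P has_vector_derivative - \<kappa> * (eps * \<psi> u)\<^sup>2) (at u within {s..t})"
        by (simp add: has_real_derivative_iff_has_vector_derivative[symmetric] power_mult_distrib mult.assoc)
    qed
    moreover have "P t - P s = - \<kappa> * eps\<^sup>2 * ((t - s)^5 / 30)"
    proof -
      have "(t - s)\<^sup>2 * (t - s)^3 = (t - s)^5" "(t - s) * (t - s)^4 = (t - s)^5" by algebra+
      then show ?thesis unfolding P_def by simp
    qed
    ultimately show ?thesis by simp
  qed
  then have "integral {s..t} (\<lambda>u. - \<kappa> * (eps * \<psi> u)\<^sup>2) = - \<kappa> * eps\<^sup>2 * ((t - s)^5 / 30)"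
    by (rule integral_unique)
  \<comment> \<open>The kinetic term carries \<open>(t - s)^3 / 6\<close> and the concave term
    \<open>(t - s)^5 / 30\<close>; the quotient \<open>30 / 6\<close> is the constant
    \<open>5\<close> of the claim.\<close>
  ultimately have "0 \<le> eps\<^sup>2 * (norm e)\<^sup>2 * ((t - s)^3 / 6) - \<kappa> * eps\<^sup>2 * ((t - s)^5 / 30)" by linarith
  moreover have "(t - s)^5 = (t - s)^3 * (t - s)\<^sup>2" by algebra
  moreover have "E * N * (c / 6) - \<kappa> * E * (c * d / 30) = (E * c / 30) * (5 * N - \<kappa> * d)" for E N c d :: real
    by (simp add: algebra_simps)
  ultimately have "0 \<le> (eps\<^sup>2 * (t - s)^3 / 30) * (5 * (norm e)\<^sup>2 - \<kappa> * (t - s)\<^sup>2)"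
    by (simp only:)
  moreover have "0 < eps\<^sup>2 * (t - s)^3 / 30" using eps(1) st by simp
  ultimately show ?thesis by (simp add: zero_le_mult_iff)
qed

section \<open>Energy of the limit curve\<close>

definition energy :: "real \<Rightarrow> real" where
  "energy u = (norm (vd u))\<^sup>2 / 2 - U (v u)"

lemma energy_const:
  assumes "s \<le> t" "\<And>u. u \<in> {s..t} \<Longrightarrow> v u \<in> \<Omega>"
  shows "energy t = energy s"
proof -
  have d: "(energy has_field_derivative 0) (at u within {s..t})" if "u \<in> {s..t}" for u
  proof -
    note va = assms(2)[OF that]
    have 1: "((\<lambda>u. 1/2 * (vd u \<bullet> vd u) - U (v u)) has_derivative
        (\<lambda>h. 1/2 * (vd u \<bullet> (h *\<^sub>R g (v u)) + (h *\<^sub>R g (v u)) \<bullet> vd u) - g (v u) \<bullet> (h *\<^sub>R vd u))) (at u within {s..t})"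
      using v_deriv[OF va] vd_deriv[OF va] unfolding has_vector_derivative_def
      by (intro has_derivative_diff bounded_linear.has_derivative[OF bounded_linear_mult_right] has_derivative_inner
         has_derivative_compose[OF _ U_deriv]) auto
    have "(\<lambda>h. 1/2 * (vd u \<bullet> (h *\<^sub>R g (v u)) + (h *\<^sub>R g (v u)) \<bullet> vd u) - g (v u) \<bullet> (h *\<^sub>R vd u)) = (*) 0"
      by (auto simp: inner_commute)
    with 1 have "((\<lambda>u. 1/2 * (vd u \<bullet> vd u) - U (v u)) has_derivative (*) 0) (at u within {s..t})"
      by (simp only:)
    then show ?thesis
      unfolding has_field_derivative_def energy_def power2_norm_eq_inner by simp
  qed
  have "\<exists>c. \<forall>u\<in>{s..t}. energy u = c"
    by (rule has_field_derivative_zero_constant[OF convex_real_interval(5) d]) auto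
  then show ?thesis using assms(1) by auto
qed

text \<open>\<open>curve_kin_lower\<close> with \<open>p = vd\<close>, whose derivative is
  \<open>g (v u)\<close> by Newton's equation. The minorants converge to twice the kinetic energy of
  the limit minus the kinetic energy itself.\<close>

lemma kin_vd_limit:
  assumes st: "s \<le> t" and v: "\<And>u. u \<in> {s..t} \<Longrightarrow> v u \<in> \<Omega>"
  obtains L where "\<forall>\<^sub>F n in sequentially. L n \<le> kin s t (W n)" "L \<longlonglongrightarrow> kin s t vd"
proof (rule that)
  define L where "L n = V n t \<bullet> vd t - V n s \<bullet> vd s - integral {s..t} (\<lambda>u. V n u \<bullet> g (v u)) - kin s t vd" for n
  have "\<forall>\<^sub>F n in sequentially. \<forall>u\<in>{s..t}. V n u \<in> \<Omega>" by (rule eventually_window) (fact v)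
  then show "\<forall>\<^sub>F n in sequentially. L n \<le> kin s t (W n)"
  proof eventually_elim
    case (elim n)
    have "\<alpha> n < s" "t < \<beta> n" using V_in elim st by auto
    then have c: "curve s t (V n) (W n)" by (intro curve_subset[OF V_curve]) (use st in auto)
    show ?case unfolding L_def
      by (rule curve_kin_lower[OF c vd_deriv gv_cont]) (use v in auto)
  qed
  have "L \<longlonglongrightarrow> v t \<bullet> vd t - v s \<bullet> vd s - integral {s..t} (\<lambda>u. v u \<bullet> g (v u)) - kin s t vd"
    unfolding L_def by (intro tendsto_intros V_pointwise inner_integral_lim gv_cont)
  moreover have "((\<lambda>u. vd u \<bullet> vd u) has_integral (v t \<bullet> vd t - v s \<bullet> vd s - integral {s..t} (\<lambda>u. v u \<bullet> g (v u)))) {s..t}"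
    by (rule curve_by_parts[OF v_curve[OF st v] vd_deriv gv_cont]) (use v in auto)
  then have "v t \<bullet> vd t - v s \<bullet> vd s - integral {s..t} (\<lambda>u. v u \<bullet> g (v u)) = 2 * kin s t vd"
    unfolding kin_real power2_norm_eq_inner by (simp add: integral_unique)
  ultimately show "L \<longlonglongrightarrow> kin s t vd" by simp
qed

text \<open>Slowing the approximating curves down by a factor \<open>\<sigma> < 1\<close> bounds their kinetic energy by
  their potential energy; the limit of the kinetic energies is only known to be an upper bound for
  the kinetic energy of the limit.\<close>

lemma energy_nonpos:
  assumes st: "s < t" and v: "\<And>u. u \<in> {s..t} \<Longrightarrow> v u \<in> \<Omega>"
  shows "energy s \<le> 0"
proof -
  obtain L where L: "\<forall>\<^sub>F n in sequentially. L n \<le> kin s t (W n)" "L \<longlonglongrightarrow> kin s t vd"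
    using kin_vd_limit[OF less_imp_le[OF st] v] by blast
  have ev: "\<forall>\<^sub>F n in sequentially. \<forall>u\<in>{s..t}. V n u \<in> \<Omega>" by (rule eventually_window) (fact v)
  \<comment> \<open>The competitor is the same piece of \<open>V n\<close> traversed at
    \<open>\<sigma>\<close> times the speed, which multiplies its kinetic part by
    \<open>\<sigma>\<close> and its potential part by \<open>1 / \<sigma>\<close>.\<close>
  have scaled: "(1 - \<sigma>) * kin s t vd \<le> (1 / \<sigma> - 1) * pot U s t v" if \<sigma>: "0 < \<sigma>" "\<sigma> < 1" for \<sigma>
  proof -
    have "\<forall>\<^sub>F n in sequentially. (1 - \<sigma>) * L n \<le> (1 / \<sigma> - 1) * pot U s t (V n) + (act n - level)"
      using L(1) ev
    proof eventually_elim
      case (elim n)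
      have "\<alpha> n < s" "t < \<beta> n" using V_in elim st by auto
      then have c: "curve s t (V n) (W n)" by (intro curve_subset[OF V_curve]) (use st in auto)
      note r = curve_reparam[OF c \<sigma>(1) U_cont, of 0]
      have "link (V n (\<sigma> * ((s - 0) / \<sigma>) + 0)) (V n (\<sigma> * ((t - 0) / \<sigma>) + 0))
         (\<sigma> * kin s t (W n) + pot U s t (V n) / \<sigma>)"
        unfolding r(2,3)[symmetric]
        by (rule linkI[OF r(1)]) (use elim(2) \<sigma> in \<open>auto simp: field_simps\<close>)
      then have "kin s t (W n) + pot U s t (V n) \<le> \<sigma> * kin s t (W n) + pot U s t (V n) / \<sigma> + (act n - level)"
        using elim(2) st \<sigma> by (intro replace) auto
      moreover have "(1 - \<sigma>) * L n \<le> (1 - \<sigma>) * kin s t (W n)"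
        using elim(1) \<sigma> by (intro mult_left_mono) auto
      ultimately show ?case by (simp add: algebra_simps)
    qed
    moreover have "(\<lambda>n. (1 - \<sigma>) * L n) \<longlonglongrightarrow> (1 - \<sigma>) * kin s t vd" by (intro tendsto_intros L)
    moreover have "(\<lambda>n. (1 / \<sigma> - 1) * pot U s t (V n) + (act n - level)) \<longlonglongrightarrow> (1 / \<sigma> - 1) * pot U s t v + (level - level)"
      by (intro tendsto_intros pot_lim0 act_lim)
    ultimately show ?thesis using tendsto_le[OF sequentially_bot] by fastforce
  qed
  \<comment> \<open>After division by \<open>1 - \<sigma>\<close> the inequality is still
    informative as \<open>\<sigma>\<close> approaches \<open>1\<close>.\<close>
  have "\<sigma> * kin s t vd \<le> pot U s t v" if "0 < \<sigma>" "\<sigma> < 1" for \<sigma>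
  proof -
    have "(1 / \<sigma> - 1) = (1 - \<sigma>) / \<sigma>" using that by (simp add: field_simps)
    then have "(1 - \<sigma>) * kin s t vd \<le> (1 - \<sigma>) * (pot U s t v / \<sigma>)"
      using scaled[OF that] by simp
    moreover have "0 < 1 - \<sigma>" using that by simp
    ultimately have "kin s t vd \<le> pot U s t v / \<sigma>" by (rule mult_left_le_imp_le)
    then show ?thesis using that by (simp add: pos_le_divide_eq mult.commute)
  qed
  then have kp: "kin s t vd \<le> pot U s t v"
    by (rule field_le_mult_one_interval)
  have vdc: "continuous_on {s..t} vd" by (rule vd_cont) (fact v)
  have "kin s t vd - pot U s t v = integral {s..t} energy"
    unfolding kin_def pot_def energy_def
    by (intro Henstock_Kurzweil_Integration.integral_diff[symmetric] integrable_continuous_real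
        continuous_intros Uv_cont vdc) auto
  also have "\<dots> = integral {s..t} (\<lambda>_. energy s)"
    by (rule Henstock_Kurzweil_Integration.integral_cong) (use energy_const v in auto)
  also have "\<dots> = (t - s) * energy s" using st by simp
  finally have "(t - s) * energy s \<le> 0" using kp by simp
  then show ?thesis using st by (simp add: mult_le_0_iff)
qed

text \<open>The bound does not depend on \<open>s\<close> and \<open>t\<close>, so \<open>U\<close>
  has finite integral along any half-line of times spent in \<open>\<Omega>\<close>.\<close>

lemma pot_le_level:
  assumes st: "s \<le> t" and v: "\<And>u. u \<in> {s..t} \<Longrightarrow> v u \<in> \<Omega>"
  shows "pot U s t v \<le> level"
proof -
  have "\<forall>\<^sub>F n in sequentially. \<forall>u\<in>{s..t}. V n u \<in> \<Omega>" by (rule eventually_window) (fact v)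
  then have "\<forall>\<^sub>F n in sequentially. pot U s t (V n) \<le> act n"
  proof eventually_elim
    case (elim n)
    then have on: "\<alpha> n \<le> s" "t \<le> \<beta> n" "\<alpha> n \<le> t" "s \<le> \<beta> n" using V_in st less_imp_le by (metis atLeastAtMost_iff order_refl)+
    show ?case
      using V_split[of n s t] link_nonneg[OF V_link[of n "\<alpha> n" s]] link_nonneg[OF V_link[of n t "\<beta> n"]]
        kin_nonneg[of s t "W n"] on st by simp
  qed
  then show ?thesis
    by (rule tendsto_le[OF sequentially_bot act_lim pot_lim0])
qed

lemma vd_le:
  assumes "\<And>u. 0 \<le> u \<Longrightarrow> v u \<in> \<Omega>" "0 \<le> u"
  shows "(norm (vd u))\<^sup>2 / 2 \<le> U (v u)"
  using energy_nonpos[of u "u + 1"] assms by (simp add: energy_def)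

text \<open>The integrals of \<open>U\<close> up to time \<open>k\<close> increase and are bounded
  by \<open>level\<close>, hence converge, so their increments over windows of fixed length
  vanish.\<close>

lemma pot_window_tendsto_0:
  assumes inf: "\<And>u. 0 \<le> u \<Longrightarrow> v u \<in> \<Omega>"
  shows "(\<lambda>k. pot U (real k) (real (k + len)) v) \<longlonglongrightarrow> 0"
proof -
  define P where "P k = pot U 0 (real k) v" for k :: nat
  have split: "P (k + l) = P k + pot U (real k) (real (k + l)) v" for k l
    unfolding P_def by (rule pot_split[OF v_cont U_cont]) auto
  have "incseq P"
    by (rule incseq_SucI) (use split[of _ 1] pot_nonneg in \<open>simp add: add.commute\<close>)
  moreover have "\<forall>k. P k \<le> level" unfolding P_def using pot_le_level inf by simp
  ultimately obtain p where p: "P \<longlonglongrightarrow> p" using incseq_convergent[of P level] by blast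
  have "(\<lambda>k. P (k + len) - P k) \<longlonglongrightarrow> p - p"
    by (intro tendsto_intros p LIMSEQ_ignore_initial_segment)
  then show ?thesis using split[of _ len] by simp
qed

text \<open>If the curve never left the domain, it would rest on long time intervals ever closer to a
  critical boundary point.\<close>

lemma exits:
  assumes concave: "\<And>q. q \<in> frontier \<Omega> \<Longrightarrow> g q = 0 \<Longrightarrow> concave_direction_at U g q"
  shows "\<exists>t\<ge>0. v t \<notin> \<Omega>"
proof (rule ccontr)
  assume "\<not> ?thesis"
  then have inf: "v u \<in> \<Omega>" if "0 \<le> u" for u using that by blast
  have "bounded (range (\<lambda>k::nat. v (real k)))"
    by (rule bounded_subset[OF v_bounded]) auto
  then obtain q \<rho> where \<rho>: "strict_mono \<rho>" "((\<lambda>k. v (real k)) \<circ> \<rho>) \<longlonglongrightarrow> q"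
    using bounded_imp_convergent_subsequence by blast
  \<comment> \<open>On a window of fixed length the kinetic energy is at most the potential part, by
    \<open>vd_le\<close>, and this tends to \<open>0\<close>; by \<open>curve_Holder\<close> the
    curve hardly moves there and the whole window is close to \<open>q\<close>.\<close>
  have win: "\<forall>\<^sub>F i in sequentially. \<forall>u\<in>{real (\<rho> i)..real (\<rho> i + len)}. dist (v u) q < eps" if "eps > 0" for len eps
  proof -
    have "(\<lambda>i. 2 * real len * pot U (real (\<rho> i)) (real (\<rho> i + len)) v) \<longlonglongrightarrow> 2 * real len * 0"
      using LIMSEQ_subseq_LIMSEQ[OF pot_window_tendsto_0[OF inf] \<rho>(1), of len]
      by (intro tendsto_intros) (simp add: o_def)
    then have "\<forall>\<^sub>F i in sequentially. 2 * real len * pot U (real (\<rho> i)) (real (\<rho> i + len)) v < (eps/2)\<^sup>2"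
      using that by (intro order_tendstoD(2)) auto
    moreover have "\<forall>\<^sub>F i in sequentially. dist (v (real (\<rho> i))) q < eps / 2"
      using tendstoD[OF \<rho>(2), of "eps/2"] that by (simp add: o_def)
    ultimately show ?thesis
    proof eventually_elim
      case (elim i)
      let ?k = "real (\<rho> i)"
      show ?case
      proof
        fix u assume u: "u \<in> {?k..real (\<rho> i + len)}"
        then have u': "?k \<le> u" "u \<le> ?k + len" by auto
        have k0: "0 \<le> ?k" by simp
        have vdc: "continuous_on {?k..u} vd" by (rule vd_cont) (use inf k0 in auto)
        have "(norm (v u - v ?k))\<^sup>2 \<le> 2 * (u - ?k) * kin ?k u vd"
          by (rule curve_Holder[OF v_curve]) (use inf u' k0 in auto)
        also have "\<dots> \<le> 2 * (u - ?k) * pot U ?k u v"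
          unfolding kin_def pot_def
          using u' vd_le[OF inf] k0 order_trans[OF k0]
          by (intro mult_left_mono integral_le integrable_continuous_real continuous_intros vdc Uv_cont) auto
        also have "\<dots> \<le> 2 * real len * pot U ?k (real (\<rho> i + len)) v"
        proof (intro mult_mono)
          have "pot U ?k (real (\<rho> i + len)) v = pot U ?k u v + pot U u (real (\<rho> i + len)) v"
            by (rule pot_split[OF v_cont U_cont]) (use u in auto)
          then show "pot U ?k u v \<le> pot U ?k (real (\<rho> i + len)) v" using pot_nonneg[of u] by simp
        qed (use u' pot_nonneg in auto)
        also have "\<dots> < (eps/2)\<^sup>2" by (rule elim)
        finally have "norm (v u - v ?k) < eps/2" by (rule power_less_imp_less_base) (use that in auto)
        then show "dist (v u) q < eps"
          using elim(2) dist_triangle_half_r[of "v ?k" "v u" eps q] by (simp add: dist_norm norm_minus_commute)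
      qed
    qed
  qed
  have q_closure: "q \<in> closure \<Omega>"
    by (rule closed_sequentially[OF closed_closure _ \<rho>(2)]) (use v_closure in auto)
  have near: "\<exists>d>0. \<forall>x. dist x q < d \<longrightarrow> f x > f q / 2" if "f q > 0" "continuous_on UNIV f" for f :: "'a \<Rightarrow> real"
  proof -
    have "isCont f q" using that(2) by (simp add: continuous_on_eq_continuous_at)
    then obtain d where "d > 0" "\<forall>x. dist x q < d \<longrightarrow> dist (f x) (f q) < f q / 2"
      using \<open>f q > 0\<close> unfolding continuous_at_eps_delta by (elim allE[of _ "f q / 2"]) auto
    moreover have "f x > f q / 2" if "dist (f x) (f q) < f q / 2" for x
      using that unfolding dist_real_def by linarith
    ultimately show ?thesis by blast
  qed
  \<comment> \<open>Otherwise the integral of \<open>U\<close> over unit windows near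
    \<open>q\<close> would be bounded below by a positive number.\<close>
  have Uq: "U q = 0"
  proof (rule ccontr)
    assume "U q \<noteq> 0"
    then have U0: "U q > 0" using U_nonneg[OF q_closure] by simp
    from near[OF this U_cont] obtain d where d: "d > 0" "\<And>x. dist x q < d \<Longrightarrow> U x > U q / 2" by blast
    have "(\<lambda>i. pot U (real (\<rho> i)) (real (\<rho> i + 1)) v) \<longlonglongrightarrow> 0"
      using LIMSEQ_subseq_LIMSEQ[OF pot_window_tendsto_0[OF inf] \<rho>(1), of 1] by (simp add: o_def)
    then have "\<forall>\<^sub>F i in sequentially. pot U (real (\<rho> i)) (real (\<rho> i + 1)) v < U q / 2"
      using U0 by (intro order_tendstoD(2)) auto
    with win[OF d(1), of 1] have "\<forall>\<^sub>F i::nat in sequentially. False"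
    proof eventually_elim
      case (elim i)
      have "integral {real (\<rho> i)..real (\<rho> i + 1)} (\<lambda>_. U q / 2) \<le> pot U (real (\<rho> i)) (real (\<rho> i + 1)) v"
        unfolding pot_def
        by (intro integral_le integrable_continuous_real continuous_intros Uv_cont)
           (use d(2) elim(1) in \<open>auto intro: less_imp_le\<close>)
      then show False using elim(2) by simp
    qed
    then show False by simp
  qed
  have q_frontier: "q \<in> frontier \<Omega>"
    using closure_cases[OF q_closure] U_pos Uq by force
  have vd_lim: "(\<lambda>i. vd (real (\<rho> i + j))) \<longlonglongrightarrow> 0" for j
  proof -
    have "(\<lambda>i. v (real (\<rho> i + j))) \<longlonglongrightarrow> q"
    proof (rule tendstoI)
      fix eps :: real assume "eps > 0"
      from win[OF this, of j] show "\<forall>\<^sub>F i in sequentially. dist (v (real (\<rho> i + j))) q < eps"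
        by eventually_elim auto
    qed
    then have "(\<lambda>i. U (v (real (\<rho> i + j)))) \<longlonglongrightarrow> U q"
      by (rule isCont_tendsto_compose[rotated]) (use U_cont[of UNIV] in \<open>simp add: continuous_on_eq_continuous_at\<close>)
    then have "(\<lambda>i. sqrt (2 * U (v (real (\<rho> i + j))))) \<longlonglongrightarrow> sqrt (2 * U q)"
      by (intro tendsto_intros)
    then have lim: "(\<lambda>i. sqrt (2 * U (v (real (\<rho> i + j))))) \<longlonglongrightarrow> 0" using Uq by simp
    show ?thesis
    proof (rule Lim_null_comparison[OF always_eventually lim], rule allI)
      fix i
      have "(norm (vd (real (\<rho> i + j))))\<^sup>2 \<le> 2 * U (v (real (\<rho> i + j)))"
        using vd_le[OF inf, of "real (\<rho> i + j)"] by simp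
      then show "norm (vd (real (\<rho> i + j))) \<le> sqrt (2 * U (v (real (\<rho> i + j))))"
        by (rule real_le_rsqrt)
    qed
  qed
  \<comment> \<open>Otherwise the velocity would change by a definite amount over a unit window,
    although it tends to \<open>0\<close> at both ends of the window.\<close>
  have gq: "g q = 0"
  proof (rule ccontr)
    assume gq: "g q \<noteq> 0"
    then have "g q \<bullet> g q > 0" by simp
    from near[of "\<lambda>x. g x \<bullet> g q", OF this continuous_on_inner[OF g_cont continuous_on_const]] obtain d where
      d: "d > 0" "\<And>x. dist x q < d \<Longrightarrow> g x \<bullet> g q > (g q \<bullet> g q) / 2"
      by blast
    have "(\<lambda>i. (vd (real (\<rho> i + 1)) - vd (real (\<rho> i + 0))) \<bullet> g q) \<longlonglongrightarrow> (0 - 0) \<bullet> g q"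
      by (intro tendsto_intros vd_lim)
    then have "\<forall>\<^sub>F i in sequentially. (vd (real (\<rho> i + 1)) - vd (real (\<rho> i + 0))) \<bullet> g q < (g q \<bullet> g q) / 2"
      using gq by (intro order_tendstoD(2)) auto
    with win[OF d(1), of 1] have "\<forall>\<^sub>F i::nat in sequentially. False"
    proof eventually_elim
      case (elim i)
      let ?a = "real (\<rho> i)" and ?b = "real (\<rho> i + 1)"
      have "((\<lambda>u. g (v u)) has_integral (vd ?b - vd ?a)) {?a..?b}"
        by (rule fundamental_theorem_of_calculus) (use vd_deriv inf in auto)
      from has_integral_linear[OF this bounded_linear_inner_left[of "g q"]]
      have 1: "((\<lambda>u. g (v u) \<bullet> g q) has_integral (vd ?b - vd ?a) \<bullet> g q) {?a..?b}" by (simp add: o_def)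
      have 2: "((\<lambda>u. (g q \<bullet> g q) / 2) has_integral (g q \<bullet> g q) / 2) {?a..?b}"
        using has_integral_const_real[of "(g q \<bullet> g q) / 2" ?a ?b] by simp
      have "(g q \<bullet> g q) / 2 \<le> (vd ?b - vd ?a) \<bullet> g q"
        by (rule has_integral_le[OF 2 1]) (use d(2) elim(1) in \<open>auto intro: less_imp_le\<close>)
      then show False using elim(2) by simp
    qed
    then show False by simp
  qed
  obtain e \<kappa> r where ek: "\<kappa> > 0" "r > 0" "\<And>x c. x \<in> ball q r \<Longrightarrow> x + c *\<^sub>R e \<in> ball q r \<Longrightarrow>
      U (x + c *\<^sub>R e) \<le> U x + c * (g x \<bullet> e) - \<kappa> * c\<^sup>2"
    using concave[OF q_frontier gq] unfolding concave_direction_at_def by blast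
  \<comment> \<open>For \<open>len\<close> above \<open>1\<close> the square of \<open>len\<close>
    is at least \<open>len\<close>, so exceeding \<open>5 * (norm e)\<^sup>2 / \<kappa>\<close>
    linearly is enough to contradict \<open>concave_direction_window\<close>.\<close>
  obtain len :: nat where len: "real len > max 1 (5 * (norm e)\<^sup>2 / \<kappa>)" using reals_Archimedean2 by blast
  have "\<forall>\<^sub>F i in sequentially. False"
    using win[OF ek(2), of len]
  proof eventually_elim
    case (elim i)
    let ?a = "real (\<rho> i)" and ?b = "real (\<rho> i + len)"
    have "\<kappa> * (?b - ?a)\<^sup>2 \<le> 5 * (norm e)\<^sup>2"
      by (rule concave_direction_window[where q = q and r = r])
         (use len inf elim ek(3) in \<open>auto simp: dist_commute\<close>)
    moreover have "real len \<le> (?b - ?a)\<^sup>2" using len by (simp add: power2_eq_square)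
    ultimately have "\<kappa> * real len \<le> 5 * (norm e)\<^sup>2"
      using ek(1) by (meson mult_left_mono less_imp_le order_trans)
    then show False using len ek(1) by (simp add: pos_divide_less_eq mult.commute)
  qed
  then show False by simp
qed

text \<open>If \<open>v T\<close> were in \<open>A\<close>, the part of \<open>V n\<close> before
  \<open>T\<close> could be replaced by a segment from \<open>A\<close> whose cost tends to
  \<open>0\<close>. The discarded part costs at least the potential spent on
  \<open>{0..T / 2}\<close>, which stays positive in the limit, so the new competitors would beat
  \<open>level\<close>.\<close>

lemma limit_not_in_A:
  assumes T: "T > 0" and v\<Omega>: "\<And>u. 0 \<le> u \<Longrightarrow> u < T \<Longrightarrow> v u \<in> \<Omega>"
  shows "v T \<notin> A"
proof
  assume vA: "v T \<in> A"
  obtain \<delta> where \<delta>: "\<delta> > 0" "\<And>a b. a \<in> A \<Longrightarrow> b \<in> B \<Longrightarrow> 2 * \<delta> \<le> dist a b" using gap by blast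
  have "bounded (U ` cball (v T) (2 * \<delta>))"
    by (intro compact_imp_bounded compact_continuous_image U_cont compact_cball)
  then obtain C where C: "C > 0" "\<And>x. x \<in> cball (v T) (2 * \<delta>) \<Longrightarrow> norm (U x) \<le> C"
    unfolding bounded_pos by auto
  \<comment> \<open>Stopping strictly before \<open>T\<close> keeps a closed interval on which the
    limit is in \<open>\<Omega>\<close>, so that the saving there has a positive limit.\<close>
  define \<eta> where "\<eta> = T / 2"
  have \<eta>: "0 < \<eta>" "\<eta> < T" using T by (auto simp: \<eta>_def)
  have in\<Omega>: "v u \<in> \<Omega>" if "u \<in> {0..\<eta>}" for u using v\<Omega> that \<eta> by simp
  have ev: "\<forall>\<^sub>F n in sequentially. \<forall>u\<in>{0..\<eta>}. V n u \<in> \<Omega>" by (rule eventually_window) (fact in\<Omega>)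
  have "\<forall>\<^sub>F n in sequentially. level \<le> (1/2 + C) * dist (V n T) (v T) + act n - pot U 0 \<eta> (V n)"
    using ev V_close[OF \<delta>(1), of T T]
  proof eventually_elim
    case (elim n)
    have dT: "dist (V n T) (v T) < \<delta>" using elim(2) by simp
    have \<eta>\<beta>: "\<eta> < \<beta> n" using V_in elim(1) \<eta> by auto
    \<comment> \<open>The curve \<open>V n\<close> cannot have finished by time \<open>T\<close>: it
      would be in \<open>B\<close>, while \<open>V n T\<close> is close to a point of
      \<open>A\<close>.\<close>
    have T\<beta>: "T < \<beta> n"
    proof (rule ccontr)
      assume "\<not> ?thesis"
      then have "V n T \<in> B" using V_B by simp
      with \<delta>(2)[OF vA this] dT \<delta>(1) show False by (simp add: dist_commute)
    qed
    have VT: "V n T \<in> \<Omega>" using V_Omega \<alpha>\<beta>[of n] T T\<beta> by auto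
    obtain q where q: "q \<in> A" "dist (V n T) q \<le> dist (V n T) (v T)" "open_segment q (V n T) \<subseteq> \<Omega>"
      using near_A[OF \<delta>(2) VT vA dT] by blast
    have "dist q (v T) \<le> dist (V n T) q + dist (V n T) (v T)" by (metis dist_commute dist_triangle)
    then have "q \<in> cball (v T) (2 * \<delta>)" "V n T \<in> cball (v T) (2 * \<delta>)"
      using q(2) dT \<delta>(1) by (auto simp: dist_commute)
    then have "closed_segment q (V n T) \<subseteq> cball (v T) (2 * \<delta>)"
      by (intro closed_segment_subset convex_cball)
    then have "U z \<le> C" if "z \<in> closed_segment q (V n T)" for z using C(2)[of z] that by auto
    from link_segment[OF q(3) this] obtain c where c: "c \<le> (1/2 + C) * dist (V n T) q" "link q (V n T) c"
      by (auto simp: dist_norm)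
    have "link q (V n (\<beta> n)) (c + (kin T (\<beta> n) (W n) + pot U T (\<beta> n) (V n)))"
      by (rule link_join[OF c(2) V_link VT]) (use T T\<beta> \<alpha>\<beta>[of n] in auto)
    then have "level \<le> c + (kin T (\<beta> n) (W n) + pot U T (\<beta> n) (V n))"
      using level_le[OF q(1) V_B] by blast
    moreover have "act n = (kin (\<alpha> n) 0 (W n) + pot U (\<alpha> n) 0 (V n)) + (kin 0 T (W n) + pot U 0 T (V n))
      + (kin T (\<beta> n) (W n) + pot U T (\<beta> n) (V n))"
      by (rule V_split) (use T T\<beta> \<alpha>\<beta>[of n] in auto)
    moreover have "0 \<le> kin (\<alpha> n) 0 (W n) + pot U (\<alpha> n) 0 (V n)"
      by (rule link_nonneg[OF V_link]) (use T T\<beta> \<alpha>\<beta>[of n] in auto)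
    moreover have "kin 0 T (W n) = kin 0 \<eta> (W n) + kin \<eta> T (W n)"
      by (rule curve_split[OF curve_subset[OF V_curve]]) (use T T\<beta> \<alpha>\<beta>[of n] \<eta> in auto)
    moreover have "pot U 0 T (V n) = pot U 0 \<eta> (V n) + pot U \<eta> T (V n)"
      by (rule pot_split[OF V_cont U_cont]) (use \<eta> in auto)
    moreover have "0 \<le> kin \<eta> T (W n) + pot U \<eta> T (V n)"
      by (rule link_nonneg[OF V_link]) (use T T\<beta> \<alpha>\<beta>[of n] \<eta> in auto)
    moreover have "(1/2 + C) * dist (V n T) q \<le> (1/2 + C) * dist (V n T) (v T)"
      using q(2) C(1) by (intro mult_left_mono) auto
    ultimately show ?case using kin_nonneg[of 0 \<eta> "W n"] c(1) by linarith
  qed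
  moreover have "(\<lambda>n. (1/2 + C) * dist (V n T) (v T) + act n - pot U 0 \<eta> (V n)) \<longlonglongrightarrow>
      (1/2 + C) * dist (v T) (v T) + level - pot U 0 \<eta> v"
    by (intro tendsto_intros V_pointwise act_lim pot_lim0)
  ultimately have "level \<le> (1/2 + C) * dist (v T) (v T) + level - pot U 0 \<eta> v"
    by (intro tendsto_lowerbound[OF _ _ sequentially_bot])
  then show False using pot_pos[OF \<eta>(1) in\<Omega>] by simp
qed

lemma forward_exit:
  assumes concave: "\<And>q. q \<in> frontier \<Omega> \<Longrightarrow> g q = 0 \<Longrightarrow> concave_direction_at U g q"
  obtains T where "T > 0" "v T \<in> B" "\<And>u. 0 \<le> u \<Longrightarrow> u < T \<Longrightarrow> v u \<in> \<Omega>"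
    "\<And>u. 0 \<le> u \<Longrightarrow> u < T \<Longrightarrow> (norm (vd u))\<^sup>2 / 2 = U (v u)"
proof -
  define X where "X = {0..} \<inter> v -` (- \<Omega>)"
  have "closed X" unfolding X_def
    by (intro closed_Int closed_vimage) (use open_Omega v_cont in auto)
  moreover have "X \<noteq> {}" using exits[OF concave] by (auto simp: X_def)
  moreover have bdd: "bdd_below X" by (rule bdd_belowI[of _ 0]) (auto simp: X_def)
  ultimately have TX: "Inf X \<in> X" by (intro closed_contains_Inf)
  define T where "T = Inf X"
  have T: "v T \<notin> \<Omega>" "0 \<le> T" using TX by (auto simp: X_def T_def)
  have T0: "T > 0" using T v0 by (cases "T = 0") auto
  have v\<Omega>: "v u \<in> \<Omega>" if "0 \<le> u" "u < T" for u
  proof (rule ccontr)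
    assume "v u \<notin> \<Omega>"
    then have "u \<in> X" using that by (simp add: X_def)
    from cInf_lower[OF this bdd] that(2) show False by (simp add: T_def)
  qed
  have vT: "v T \<in> frontier \<Omega>" using closure_cases[OF v_closure] T(1) by blast
  have vB: "v T \<in> B" using vT AB limit_not_in_A[OF T0 v\<Omega>] by blast
  have E: "energy u = energy 0" if "0 \<le> u" "u < T" for u
    using energy_const[of 0 u] that v\<Omega> by simp
  have "energy 0 \<le> 0" using energy_nonpos[of 0 "T/2"] T0 v\<Omega> by simp
  \<comment> \<open>The kinetic energy is nonnegative, so the constant energy is at least
    \<open>- U (v u)\<close>, and \<open>u\<close> may approach \<open>T\<close>, where
    \<open>U\<close> vanishes.\<close>
  moreover have "- U (v T) \<le> energy 0"
  proof (rule tendsto_upperbound)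
    show "((\<lambda>u. - U (v u)) \<longlongrightarrow> - U (v T)) (at_left T)"
    proof -
      have "isCont (\<lambda>u. U (v u)) T" using Uv_cont[of UNIV] by (simp add: continuous_on_eq_continuous_at)
      then have "((\<lambda>u. U (v u)) \<longlongrightarrow> U (v T)) (at_left T)"
        by (simp add: isCont_def filterlim_at_split)
      then show ?thesis by (rule tendsto_minus)
    qed
    have "\<forall>\<^sub>F u in at_left T. u \<in> {0<..<T}" using eventually_at_left_real[OF T0] .
    then show "\<forall>\<^sub>F u in at_left T. - U (v u) \<le> energy 0"
    proof eventually_elim
      case (elim u)
      then have "energy u = energy 0" by (intro E) auto
      then show ?case unfolding energy_def[of u] by (smt (verit) divide_nonneg_pos zero_le_power2)
    qed
  qed auto
  ultimately have "energy 0 = 0" using U_frontier[OF vT] by simp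
  then have "(norm (vd u))\<^sup>2 / 2 = U (v u)" if "0 \<le> u" "u < T" for u
    using E[OF that] by (simp add: energy_def[of u])
  then show ?thesis using that T0 vB v\<Omega> by blast
qed

end

section \<open>Existence of the limit curve\<close>

text \<open>The growth hypothesis of the theorem verbatim, so that it can be folded in the final
  proof.\<close>

definition radial_growth :: "('a::euclidean_space \<Rightarrow> real) \<Rightarrow> 'a set \<Rightarrow> bool" where
  "radial_growth U \<Omega> \<longleftrightarrow> (\<not> bounded \<Omega> \<longrightarrow> (\<exists>r0>0. \<exists>\<sigma> :: real \<Rightarrow> real. (\<forall>r\<ge>r0. \<sigma> r \<ge> 0) \<and>
             improper_integral_diverges \<sigma> r0 \<and>
             (\<forall>x\<in>\<Omega>. norm x \<ge> r0 \<longrightarrow> sqrt (U x) \<ge> \<sigma> (norm x))))"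

lemma Inf_image_close:
  fixes f h :: "'b \<Rightarrow> real"
  assumes "D \<noteq> {}" "bdd_below (f ` D)" "\<And>e. e \<in> D \<Longrightarrow> f e \<le> h e + eps"
  shows "Inf (f ` D) \<le> Inf (h ` D) + eps"
proof -
  have "Inf (f ` D) - eps \<le> Inf (h ` D)"
  proof (rule cINF_greatest[OF assms(1)])
    fix e assume e: "e \<in> D"
    have "Inf (f ` D) \<le> f e" by (rule cINF_lower[OF assms(2) e])
    then show "Inf (f ` D) - eps \<le> h e" using assms(3)[OF e] by simp
  qed
  then show ?thesis by simp
qed

context connection
begin

text \<open>Outside a large ball the domain is a cone over a set \<open>D\<close> of unit vectors, and the infimum of
  \<open>sqrt U\<close> over \<open>D\<close> at radius \<open>r\<close> is continuous in \<open>r\<close> and at least \<open>\<sigma> r\<close>; the action of a curve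
  bounds the integral of this infimum over the radii that the curve crosses.\<close>

lemma growth_bound:
  assumes growth: "radial_growth U \<Omega>"
    and Z: "bounded Z"
  shows "\<exists>R. \<forall>a b v w. curve a b v w \<longrightarrow> (\<forall>t\<in>{a..b}. v t \<in> \<Omega>) \<longrightarrow> v a \<in> Z \<longrightarrow>
    kin a b w + pot U a b v \<le> M \<longrightarrow> norm (v b) \<le> R"
proof (cases "bounded \<Omega>")
  case True
  then obtain R where "\<And>x. x \<in> \<Omega> \<Longrightarrow> norm x \<le> R" by (auto simp: bounded_iff)
  moreover have "v b \<in> \<Omega>" if "curve a b v w" "\<forall>t\<in>{a..b}. v t \<in> \<Omega>" for a b w and v :: "real \<Rightarrow> 'a"
    using curve_le[OF that(1)] that(2) by simp
  ultimately show ?thesis by blast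
next
  case False
  with growth[unfolded radial_growth_def] obtain r0 and \<sigma> :: "real \<Rightarrow> real" where r0: "r0 > 0" "\<And>r. r \<ge> r0 \<Longrightarrow> \<sigma> r \<ge> 0"
    and int\<sigma>: "\<And>R. R \<ge> r0 \<Longrightarrow> \<sigma> integrable_on {r0..R}"
    and lim\<sigma>: "filterlim (\<lambda>R. integral {r0..R} \<sigma>) at_top at_top"
    and \<sigma>: "\<And>x. x \<in> \<Omega> \<Longrightarrow> norm x \<ge> r0 \<Longrightarrow> sqrt (U x) \<ge> \<sigma> (norm x)"
    unfolding improper_integral_diverges_def by blast
  have "bounded (frontier \<Omega> \<union> Z)"
    using compact_A compact_B AB Z by (metis bounded_Un compact_imp_bounded)
  then obtain b0 where b0: "\<And>x. x \<in> frontier \<Omega> \<union> Z \<Longrightarrow> norm x \<le> b0" unfolding bounded_iff by blast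
  define r1 where "r1 = max r0 (b0 + 1)"
  have r1: "r1 > 0" "r0 \<le> r1" using r0 by (auto simp: r1_def)
  have small: "norm x < r1" if "x \<in> frontier \<Omega> \<union> Z" for x using b0[OF that] by (auto simp: r1_def)
  \<comment> \<open>The part of a ray beyond radius \<open>r1\<close> is connected and avoids the
    frontier, so it lies entirely in \<open>\<Omega>\<close> or entirely outside.\<close>
  have ray: "r *\<^sub>R e \<in> \<Omega>" if "norm e = 1" "\<rho> *\<^sub>R e \<in> \<Omega>" "\<rho> \<ge> r1" "r \<ge> r1" for e :: 'a and r \<rho>
  proof (rule ccontr)
    assume n: "r *\<^sub>R e \<notin> \<Omega>"
    have "connected ((\<lambda>r. r *\<^sub>R e) ` {r1..})"
      by (intro connected_continuous_image continuous_intros connected_Ici)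
    from connected_Int_frontier[OF this, of \<Omega>] that n
    obtain y where "y \<ge> r1" "y *\<^sub>R e \<in> frontier \<Omega>" by auto
    with small[of "y *\<^sub>R e"] that(1) r1 show False by simp
  qed
  define D where "D = {e::'a. norm e = 1 \<and> r1 *\<^sub>R e \<in> \<Omega>}"
  have dir: "x /\<^sub>R norm x \<in> D" if "x \<in> \<Omega>" "norm x \<ge> r1" for x
  proof -
    have x: "x \<noteq> 0" using that r1 by auto
    have "r1 *\<^sub>R (x /\<^sub>R norm x) \<in> \<Omega>"
      by (rule ray[of _ "norm x"]) (use x that in auto)
    then show ?thesis using x by (simp add: D_def)
  qed
  have "\<exists>x\<in>\<Omega>. norm x > r1" using False by (metis boundedI not_le)
  then have D_ne: "D \<noteq> {}" using dir by fastforce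
  \<comment> \<open>The given \<open>\<sigma>\<close> is merely integrable. Its continuous majorant
    \<open>s\<close> has a differentiable antiderivative \<open>G\<close>, to which the chain rule
    along the radius of a curve applies.\<close>
  define s where "s r = Inf ((\<lambda>e. sqrt (U (r *\<^sub>R e))) ` D)" for r
  have D\<Omega>: "r *\<^sub>R e \<in> \<Omega>" "norm e = 1" if "e \<in> D" "r \<ge> r1" for e r
    using that ray[of e r1 r] by (auto simp: D_def)
  have sqrt_nonneg: "0 \<le> sqrt (U (r *\<^sub>R e))" if "e \<in> D" "r \<ge> r1" for e r
    using U_pos[OF D\<Omega>(1)[OF that]] by simp
  have bdd: "bdd_below ((\<lambda>e. sqrt (U (r *\<^sub>R e))) ` D)" if "r \<ge> r1" for r
    by (rule bdd_belowI[of _ 0]) (use sqrt_nonneg that in auto)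
  have s_le: "s (norm x) \<le> sqrt (U x)" if "x \<in> \<Omega>" "norm x \<ge> r1" for x
  proof -
    have "norm x *\<^sub>R (x /\<^sub>R norm x) = x" using that r1 by (cases "x = 0") auto
    then show ?thesis
      using cINF_lower[OF bdd[OF that(2)] dir[OF that]] by (simp add: s_def)
  qed
  have s_nonneg: "0 \<le> s r" if "r \<ge> r1" for r
    unfolding s_def by (rule cINF_greatest[OF D_ne]) (use sqrt_nonneg that in auto)
  have s_ge: "\<sigma> r \<le> s r" if "r \<ge> r1" for r
    unfolding s_def
  proof (rule cINF_greatest[OF D_ne])
    fix e assume "e \<in> D"
    then show "\<sigma> r \<le> sqrt (U (r *\<^sub>R e))"
      using \<sigma>[of "r *\<^sub>R e"] D\<Omega>[of e r] that r1 by simp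
  qed
  have s_cont: "continuous_on {r1..R} s" for R
    unfolding continuous_on_iff
  proof (intro ballI allI impI)
    fix r and eps :: real assume r: "r \<in> {r1..R}" and eps: "eps > 0"
    have "continuous_on ({r1..R} \<times> sphere 0 1) (\<lambda>(r, e::'a). sqrt (U (r *\<^sub>R e)))"
      unfolding case_prod_beta
      by (intro continuous_intros continuous_on_compose2[OF U_cont[of UNIV]]) auto
    then have "uniformly_continuous_on ({r1..R} \<times> sphere 0 1) (\<lambda>(r, e::'a). sqrt (U (r *\<^sub>R e)))"
      by (intro compact_uniformly_continuous compact_Times compact_sphere) auto
    then obtain d where d: "d > 0" "\<And>x x'. x \<in> {r1..R} \<times> sphere 0 1 \<Longrightarrow> x' \<in> {r1..R} \<times> sphere 0 1 \<Longrightarrow>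
       dist x' x < d \<Longrightarrow> dist ((\<lambda>(r, e::'a). sqrt (U (r *\<^sub>R e))) x') ((\<lambda>(r, e). sqrt (U (r *\<^sub>R e))) x) < eps / 2"
      unfolding uniformly_continuous_on_def using half_gt_zero[OF eps] by blast
    have close: "sqrt (U (x *\<^sub>R e)) \<le> sqrt (U (y *\<^sub>R e)) + eps / 2"
      if "x \<in> {r1..R}" "y \<in> {r1..R}" "dist x y < d" "e \<in> D" for x y e
    proof -
      have "dist (sqrt (U (x *\<^sub>R e))) (sqrt (U (y *\<^sub>R e))) < eps / 2"
        using d(2)[of "(y, e)" "(x, e)"] that by (simp add: dist_Pair_Pair D_def)
      then show ?thesis unfolding dist_real_def by linarith
    qed
    show "\<exists>d>0. \<forall>x'\<in>{r1..R}. dist x' r < d \<longrightarrow> dist (s x') (s r) < eps"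
    proof (intro exI[of _ d] conjI ballI impI d(1))
      fix x assume x: "x \<in> {r1..R}" "dist x r < d"
      have "s x \<le> s r + eps / 2"
        unfolding s_def by (rule Inf_image_close[OF D_ne bdd close]) (use x r in auto)
      moreover have "s r \<le> s x + eps / 2"
        unfolding s_def by (rule Inf_image_close[OF D_ne bdd close]) (use x r in \<open>auto simp: dist_commute\<close>)
      ultimately show "dist (s x) (s r) < eps" using eps unfolding dist_real_def by linarith
    qed
  qed
  define G where "G r = integral {r1..r} s" for r
  have G_ge: "integral {r0..R} \<sigma> - integral {r0..r1} \<sigma> \<le> G R" if "R \<ge> r1" for R
  proof -
    have "integral {r0..R} \<sigma> = integral {r0..r1} \<sigma> + integral {r1..R} \<sigma>"
      by (rule Henstock_Kurzweil_Integration.integral_combine[symmetric]) (use r1 that int\<sigma>[of R] in auto)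
    moreover have "integral {r1..R} \<sigma> \<le> G R"
      unfolding G_def
    proof (rule integral_le)
      show "\<sigma> integrable_on {r1..R}"
        by (rule integrable_subinterval_real[OF int\<sigma>[of R]]) (use r1 that in auto)
      show "s integrable_on {r1..R}" by (rule integrable_continuous_real[OF s_cont])
    qed (use s_ge in auto)
    ultimately show ?thesis by simp
  qed
  \<comment> \<open>One more than \<open>r1\<close>, so that all radii considered are interior to
    the interval on which \<open>G\<close> is differentiable.\<close>
  define r2 where "r2 = r1 + 1"
  have "\<forall>\<^sub>F R in at_top. M + G r2 + integral {r0..r1} \<sigma> < integral {r0..R} \<sigma>"
    using lim\<sigma> by (auto simp: filterlim_at_top_dense)
  then obtain R0 where R0: "\<And>R. R \<ge> R0 \<Longrightarrow> M + G r2 + integral {r0..r1} \<sigma> < integral {r0..R} \<sigma>"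
    by (auto simp: eventually_at_top_linorder)
  define R where "R = max R0 r2"
  show ?thesis
  proof (intro exI[of _ R] allI impI)
    fix a b v w
    assume c: "curve a b v w" and v: "\<forall>t\<in>{a..b}. v t \<in> \<Omega>" and va: "v a \<in> Z" and act: "kin a b w + pot U a b v \<le> M"
    have ab: "a \<le> b" by (rule curve_le[OF c])
    show "norm (v b) \<le> R"
    proof (rule ccontr)
      assume "\<not> ?thesis"
      then have nb: "norm (v b) > R" by simp
      have nc: "continuous_on {a..b} (\<lambda>t. norm (v t))" by (intro continuous_intros curve_continuous[OF c])
      \<comment> \<open>The largest element \<open>p\<close> of this set is the last time at which
        the radius is at most \<open>r2\<close>; afterwards the curve stays where \<open>s\<close>
        is a lower bound for \<open>sqrt U\<close>.\<close>
      define X where "X = {a..b} \<inter> (\<lambda>t. norm (v t)) -` {..r2}"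
      have "closed X" unfolding X_def by (rule continuous_closed_preimage[OF nc]) auto
      then have "compact X" by (auto simp: X_def compact_eq_bounded_closed intro: bounded_subset[OF bounded_closed_interval])
      moreover have "a \<in> X" using small[of "v a"] va ab by (auto simp: X_def r2_def)
      ultimately have "\<exists>p\<in>X. \<forall>x\<in>X. x \<le> p" by (intro compact_attains_sup) auto
      then obtain p where p: "p \<in> X" "\<And>x. x \<in> X \<Longrightarrow> x \<le> p" by blast
      have pab: "a \<le> p" "p \<le> b" "norm (v p) \<le> r2" using p(1) by (auto simp: X_def)
      have np: "norm (v p) = r2"
      proof (rule ccontr)
        assume "norm (v p) \<noteq> r2"
        then have "norm (v p) < r2" using pab by simp
        have "\<exists>x\<ge>p. x \<le> b \<and> norm (v x) = r2"
          by (rule IVT') (use pab nb in \<open>auto simp: R_def intro: continuous_on_subset[OF nc]\<close>)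
        then obtain x where x: "p \<le> x" "x \<le> b" "norm (v x) = r2" by blast
        then have "x \<in> X" using pab by (auto simp: X_def)
        then have "x = p" using p(2)[of x] x by simp
        then show False using x \<open>norm (v p) < r2\<close> by simp
      qed
      have above: "norm (v t) \<ge> r2" if "t \<in> {p..b}" for t
      proof (cases "t = p")
        case False
        then have "t \<notin> X" using p(2)[of t] that by force
        then show ?thesis using that pab by (auto simp: X_def)
      qed (use np in simp)
      note c' = curve_subset[OF c pab(1,2) order_refl]
      obtain S where S: "finite S" "\<forall>t\<in>{p<..<b} - S. (v has_vector_derivative w t) (at t)"
        using c' unfolding curve_def by blast
      have nc': "continuous_on {p..b} (\<lambda>t. norm (v t))" by (intro continuous_intros curve_continuous[OF c'])
      have "bounded ((\<lambda>t. norm (v t)) ` {p..b})"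
        by (intro compact_imp_bounded compact_continuous_image nc') auto
      then obtain Q where Q: "\<And>t. t \<in> {p..b} \<Longrightarrow> norm (v t) \<le> Q" unfolding bounded_iff by force
      have GQ: "(G has_vector_derivative s r) (at r within {r1..Q + 1})" if "r \<in> {r1..Q + 1}" for r
        unfolding G_def by (rule integral_has_vector_derivative[OF s_cont that])
      have Gc: "continuous_on {r1..Q + 1} G" by (rule has_vector_derivative_on_continuous[OF GQ])
      have in_r: "norm (v t) \<in> {r1<..<Q + 1}" if "t \<in> {p..b}" for t
        using above[OF that] Q[OF that] by (simp add: r2_def)
      have "((\<lambda>t. (sgn (v t) \<bullet> w t) * s (norm (v t))) has_integral (G (norm (v b)) - G (norm (v p)))) {p..b}"
      proof (rule fundamental_theorem_of_calculus_interior_strong[OF S(1) pab(2)])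
        fix t assume t: "t \<in> {p<..<b} - S"
        then have t': "t \<in> {p..b}" by auto
        have "v t \<noteq> 0" using above[OF t'] r1 by (auto simp: r2_def)
        then have "((\<lambda>t. norm (v t)) has_derivative (\<lambda>h. (h *\<^sub>R w t) \<bullet> sgn (v t))) (at t)"
          using S(2) t unfolding has_vector_derivative_def
          by (intro has_derivative_compose[OF _ has_derivative_norm]) auto
        then have 1: "((\<lambda>t. norm (v t)) has_vector_derivative (sgn (v t) \<bullet> w t)) (at t)"
          by (simp add: has_vector_derivative_def inner_commute)
        have "(G has_vector_derivative s (norm (v t))) (at (norm (v t)))"
          using GQ[of "norm (v t)"] in_r[OF t'] at_within_Icc_at[of r1 "norm (v t)" "Q + 1"] by auto
        from vector_diff_chain_at[OF 1 this]
        show "((\<lambda>t. G (norm (v t))) has_vector_derivative (sgn (v t) \<bullet> w t) * s (norm (v t))) (at t)"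
          by (simp add: o_def)
      next
        show "continuous_on {p..b} (\<lambda>t. G (norm (v t)))"
          by (rule continuous_on_compose2[OF Gc nc']) (use in_r in \<open>auto simp: less_imp_le\<close>)
      qed
      moreover have "((\<lambda>t. (norm (w t))\<^sup>2 / 2 + U (v t)) has_integral (kin p b w + pot U p b v)) {p..b}"
        unfolding kin_def pot_def
        by (intro has_integral_add integrable_integral curve_kin_integrable[OF c'] integrable_continuous_real
            continuous_on_compose2[OF U_cont[of UNIV]] curve_continuous[OF c'] subset_UNIV)
      ultimately have "G (norm (v b)) - G (norm (v p)) \<le> kin p b w + pot U p b v"
      proof (rule has_integral_le)
        fix t assume t: "t \<in> {p..b}"
        have r: "norm (v t) \<ge> r1" and vt: "v t \<in> \<Omega>" using in_r[OF t] v t pab by auto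
        have "sgn (v t) \<bullet> w t \<le> norm (w t)"
          using norm_cauchy_schwarz[of "sgn (v t)" "w t"] by (cases "v t = 0") (auto simp: norm_sgn)
        then have "(sgn (v t) \<bullet> w t) * s (norm (v t)) \<le> norm (w t) * sqrt (U (v t))"
          by (intro mult_mono s_le[OF vt r] s_nonneg[OF r]) auto
        \<comment> \<open>The inequality between geometric and arithmetic mean: the product of speed
          and \<open>sqrt U\<close> is dominated by the integrand of the action.\<close>
        also have "\<dots> \<le> ((norm (w t))\<^sup>2 + (sqrt (U (v t)))\<^sup>2) / 2"
          using sum_squares_bound[of "norm (w t)" "sqrt (U (v t))"] by simp
        also have "\<dots> \<le> (norm (w t))\<^sup>2 / 2 + U (v t)" using U_pos[OF vt] by simp
        finally show "(sgn (v t) \<bullet> w t) * s (norm (v t)) \<le> (norm (w t))\<^sup>2 / 2 + U (v t)" .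
      qed
      moreover have "kin p b w \<le> kin a b w" by (rule kin_mono[OF c]) (use pab in auto)
      moreover have "pot U p b v \<le> pot U a b v"
      proof -
        have "pot U a b v = pot U a p v + pot U p b v"
          by (rule pot_split[OF curve_continuous[OF c] U_cont]) (use pab in auto)
        moreover have "0 \<le> U (v t)" if "t \<in> {a..p}" for t
          using U_pos[of "v t"] v that pab by simp
        then have "0 \<le> pot U a p v" unfolding pot_def
          by (intro integral_nonneg)
             (use pab in \<open>auto intro!: integrable_continuous_real
               continuous_on_compose2[OF U_cont[of UNIV]] curve_continuous[OF curve_subset[OF c]]\<close>)
        ultimately show ?thesis by simp
      qed
      ultimately have "G (norm (v b)) - G r2 \<le> M" using act np by simp
      moreover have "norm (v b) \<ge> r1" "norm (v b) \<ge> R0" using nb by (auto simp: R_def r2_def)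
      ultimately show False using G_ge[of "norm (v b)"] R0[of "norm (v b)"] by simp
    qed
  qed
qed

section \<open>Compactness of minimising sequences\<close>

lemma minimising_subseq:
  assumes "minimising V W \<alpha> \<beta>" "strict_mono (k :: nat \<Rightarrow> nat)"
  shows "minimising (V \<circ> k) (W \<circ> k) (\<alpha> \<circ> k) (\<beta> \<circ> k)"
proof -
  have "(\<lambda>n. kin (\<alpha> n) (\<beta> n) (W n) + pot U (\<alpha> n) (\<beta> n) (V n)) \<longlonglongrightarrow> level"
    using assms(1) by (simp add: minimising_def)
  from LIMSEQ_subseq_LIMSEQ[OF this assms(2)] show ?thesis
    using assms(1) by (simp add: minimising_def o_def)
qed

text \<open>Arzela-Ascoli on each interval \<open>{- real i..real i}\<close>, followed by the
  extraction of a diagonal subsequence.\<close>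

lemma subsequence_locally_uniform_limit:
  fixes V :: "nat \<Rightarrow> real \<Rightarrow> 'a"
  assumes R: "\<And>n t. norm (V n t) \<le> R"
    and Hoelder: "\<And>n s t. s \<le> t \<Longrightarrow> (norm (V n t - V n s))\<^sup>2 \<le> M * (t - s)"
  shows "\<exists>v k. strict_mono (k :: nat \<Rightarrow> nat) \<and> (\<forall>s t. uniform_limit {s..t} (V \<circ> k) v sequentially)"
proof -
  have M: "0 \<le> M" using Hoelder[of 0 1 0] by (simp add: order_trans[OF zero_le_power2])
  have Hoelder': "(norm (V n s - V n t))\<^sup>2 \<le> M * \<bar>s - t\<bar>" for n s t
    using Hoelder[of s t n] Hoelder[of t s n] by (cases "s \<le> t") (auto simp: norm_minus_commute)
  define P where "P i f \<longleftrightarrow> (\<exists>g. uniform_limit {- real i..real i} f g sequentially)" for i and f :: "nat \<Rightarrow> real \<Rightarrow> 'a"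
  have sub: "\<exists>k::nat \<Rightarrow> nat. strict_mono k \<and> P i ((V \<circ> r) \<circ> k)" for i and r :: "nat \<Rightarrow> nat"
  proof -
    obtain g k where k: "strict_mono (k :: nat \<Rightarrow> nat)"
      "\<And>e. 0 < e \<Longrightarrow> \<exists>N. \<forall>n x. n \<ge> N \<and> x \<in> {-real i..real i} \<longrightarrow> norm ((V \<circ> r) (k n) x - g x) < e"
    proof (rule Arzela_Ascoli[of "{-real i..real i}" "V \<circ> r" R])
      fix x e :: real assume "0 < e"
      show "\<exists>d>0. \<forall>n y. y \<in> {- real i..real i} \<and> norm (x - y) < d \<longrightarrow> norm ((V \<circ> r) n x - (V \<circ> r) n y) < e"
      proof (intro exI[of _ "e\<^sup>2 / (M + 1)"] conjI allI impI)
        \<comment> \<open>The summand \<open>1\<close> covers the case \<open>M = 0\<close>.\<close>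
        show "0 < e\<^sup>2 / (M + 1)" using \<open>0 < e\<close> M by simp
        fix n y assume "y \<in> {- real i..real i} \<and> norm (x - y) < e\<^sup>2 / (M + 1)"
        then have "\<bar>x - y\<bar> * (M + 1) < e\<^sup>2" using M by (simp add: pos_less_divide_eq)
        moreover have "M * \<bar>x - y\<bar> \<le> \<bar>x - y\<bar> * (M + 1)" by (simp add: algebra_simps)
        ultimately have "(norm (V (r n) x - V (r n) y))\<^sup>2 < e\<^sup>2"
          using Hoelder'[of "r n" x y] by linarith
        then show "norm ((V \<circ> r) n x - (V \<circ> r) n y) < e"
          using \<open>0 < e\<close> by (auto intro: power_less_imp_less_base)
      qed
    qed (use R in auto)
    have "uniform_limit {- real i..real i} ((V \<circ> r) \<circ> k) g sequentially"
      unfolding uniform_limit_iff eventually_sequentially dist_norm using k(2) by fastforce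
    then show ?thesis using k(1) unfolding P_def by blast
  qed
  obtain k where k: "strict_mono (k :: nat \<Rightarrow> nat)" "\<And>i. P i (V \<circ> k)"
  proof (rule subsequence_diagonalization_lemma[where P = "\<lambda>i r. P i (V \<circ> r)" and r = id])
    show "\<exists>k. strict_mono k \<and> P i (V \<circ> (r \<circ> k))" for i and r :: "nat \<Rightarrow> nat"
      using sub[of i r] by (simp add: o_assoc)
    show "P i (V \<circ> (r \<circ> k2))" if P1: "P i (V \<circ> (r \<circ> k1))" and k12: "\<And>j. N \<le> j \<Longrightarrow> \<exists>j'\<ge>j. k2 j = k1 j'"
      for i N and r k1 k2 :: "nat \<Rightarrow> nat"
    proof -
      obtain g where g: "uniform_limit {- real i..real i} (V \<circ> (r \<circ> k1)) g sequentially"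
        using P1 unfolding P_def by blast
      have "uniform_limit {- real i..real i} (V \<circ> (r \<circ> k2)) g sequentially"
        unfolding uniform_limit_iff eventually_sequentially
      proof (intro allI impI)
        fix e :: real assume "0 < e"
        then obtain N' where N': "\<And>n x. n \<ge> N' \<Longrightarrow> x \<in> {- real i..real i} \<Longrightarrow> dist (V (r (k1 n)) x) (g x) < e"
          using g unfolding uniform_limit_iff eventually_sequentially by fastforce
        show "\<exists>N. \<forall>n\<ge>N. \<forall>x\<in>{- real i..real i}. dist ((V \<circ> (r \<circ> k2)) n x) (g x) < e"
        proof (intro exI[of _ "max N N'"] allI impI ballI)
          fix n x assume "max N N' \<le> n" "x \<in> {- real i..real i}"
          moreover obtain j' where "j' \<ge> n" "k2 n = k1 j'" using k12[of n] \<open>max N N' \<le> n\<close> by auto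
          ultimately show "dist ((V \<circ> (r \<circ> k2)) n x) (g x) < e" using N'[of j' x] by simp
        qed
      qed
      then show ?thesis unfolding P_def by blast
    qed
  qed auto
  \<comment> \<open>Defined pointwise, so that the limits obtained on the different intervals are
    restrictions of one function.\<close>
  define v where "v t = lim (\<lambda>n. V (k n) t)" for t
  have "uniform_limit {- real i..real i} (V \<circ> k) v sequentially" for i
  proof -
    obtain g where g: "uniform_limit {- real i..real i} (V \<circ> k) g sequentially"
      using k(2) unfolding P_def by blast
    have "v t = g t" if "t \<in> {- real i..real i}" for t
      using limI[OF tendsto_uniform_limitI[OF g that]] by (simp add: v_def)
    then show ?thesis using g by (simp add: uniform_limit_iff)
  qed
  note lim = this
  have "uniform_limit {s..t} (V \<circ> k) v sequentially" for s t
  proof -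
    obtain i :: nat where "real i > max \<bar>s\<bar> \<bar>t\<bar>" using reals_Archimedean2 by blast
    then have "{s..t} \<subseteq> {- real i..real i}" by auto
    then show ?thesis using lim uniform_limit_on_subset by blast
  qed
  then show ?thesis using k(1) by blast
qed

lemma limit_curve_exists:
  assumes growth: "radial_growth U \<Omega>"
  obtains V W \<alpha> \<beta> v where "limit_curve U g \<Omega> A B V W \<alpha> \<beta> v"
proof -
  obtain V W \<alpha> \<beta> Z where m: "minimising V W \<alpha> \<beta>" and Z: "compact Z" "Z \<subseteq> \<Omega>" "\<And>n. V n 0 \<in> Z"
    using minimising_exists by blast
  have V: "curve (\<alpha> n) (\<beta> n) (V n) (W n)" "\<alpha> n < 0" "0 < \<beta> n"
    "t \<le> \<alpha> n \<Longrightarrow> V n t \<in> A" "\<beta> n \<le> t \<Longrightarrow> V n t \<in> B" "\<alpha> n < t \<Longrightarrow> t < \<beta> n \<Longrightarrow> V n t \<in> \<Omega>"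
    "s \<le> t \<Longrightarrow> (norm (V n t - V n s))\<^sup>2 \<le> 2 * (t - s) * kin (\<alpha> n) (\<beta> n) (W n)" for n s t
    using m unfolding minimising_def by auto
  have cont: "continuous_on UNIV (V n)" for n using m unfolding minimising_def by auto
  have "Bseq (\<lambda>n. kin (\<alpha> n) (\<beta> n) (W n) + pot U (\<alpha> n) (\<beta> n) (V n))"
    using m unfolding minimising_def by (intro convergent_imp_Bseq convergentI) blast
  then obtain M where M: "\<And>n. norm (kin (\<alpha> n) (\<beta> n) (W n) + pot U (\<alpha> n) (\<beta> n) (V n)) \<le> M"
    unfolding Bseq_def by blast
  have U0: "0 \<le> U (V n t)" for n t
    using V(4)[of t n] V(5)[of n t] V(6)[of n t] AB U_frontier U_pos less_imp_le by (metis UnI1 UnI2 not_le order_refl)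
  have pot0: "0 \<le> pot U s t (V n)" for s t n
    unfolding pot_def by (rule integral_nonneg)
      (auto intro!: integrable_continuous_real continuous_on_compose2[OF U_cont[of UNIV]]
         continuous_on_subset[OF cont] U0)
  have act: "kin s t (W n) + pot U s t (V n) \<le> M" if "\<alpha> n \<le> s" "s \<le> t" "t \<le> \<beta> n" for n s t
  proof -
    have "kin s t (W n) \<le> kin (\<alpha> n) (\<beta> n) (W n)" by (rule kin_mono[OF V(1) that])
    moreover have "pot U (\<alpha> n) (\<beta> n) (V n) = pot U (\<alpha> n) s (V n) + pot U s (\<beta> n) (V n)"
      by (rule pot_split[OF continuous_on_subset[OF cont] U_cont]) (use that in auto)
    moreover have "pot U s (\<beta> n) (V n) = pot U s t (V n) + pot U t (\<beta> n) (V n)"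
      by (rule pot_split[OF continuous_on_subset[OF cont] U_cont]) (use that in auto)
    ultimately show ?thesis using pot0[of "\<alpha> n" s n] pot0[of t "\<beta> n" n] M[of n] by simp
  qed
  obtain R where R: "\<And>a b v w. curve a b v w \<Longrightarrow> (\<forall>t\<in>{a..b}. v t \<in> \<Omega>) \<Longrightarrow> v a \<in> Z \<Longrightarrow>
    kin a b w + pot U a b v \<le> M \<Longrightarrow> norm (v b) \<le> R"
    using growth_bound[OF growth compact_imp_bounded[OF Z(1)], of M] by blast
  have "bounded (A \<union> B)" using compact_A compact_B by (simp add: compact_imp_bounded)
  then obtain R' where R': "\<And>x. x \<in> A \<union> B \<Longrightarrow> norm x \<le> R'" unfolding bounded_iff by blast
  have bound: "norm (V n t) \<le> max R R'" for n t
  proof (cases "\<alpha> n < t \<and> t < \<beta> n")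
    case True
    have "norm (V n t) \<le> R"
    proof (cases "0 \<le> t")
      case True': True
      show ?thesis
        by (rule R[OF curve_subset[OF V(1), of n 0 t]]) (use True True' V(2,3,6)[of n] Z(3) act[of n 0 t] in auto)
    next
      case False
      have c: "curve t 0 (V n) (W n)" by (rule curve_subset[OF V(1)]) (use False True V(2,3)[of n] in auto)
      \<comment> \<open>\<open>growth_bound\<close> controls the final point of a curve starting in
        \<open>Z\<close>, so for negative times the curve is run backwards from time
        \<open>0\<close>.\<close>
      have "norm (V n (- (- t))) \<le> R"
        by (rule R[OF curve_reverse(1)[OF c]])
           (use False True V(2,3,6)[of n] Z(3) act[of n t 0] curve_reverse(2,3)[OF c] in auto)
      then show ?thesis by simp
    qed
    then show ?thesis by simp
  next
    case False
    then have "V n t \<in> A \<union> B" using V(4)[of t n] V(5)[of n t] by auto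
    then show ?thesis using R' by (simp add: le_max_iff_disj)
  qed
  have hoelder: "(norm (V n t - V n s))\<^sup>2 \<le> 2 * M * (t - s)" if "s \<le> t" for n s t
  proof -
    have "kin (\<alpha> n) (\<beta> n) (W n) \<le> M" using M[of n] pot0[of "\<alpha> n" "\<beta> n" n] by simp
    then have "2 * (t - s) * kin (\<alpha> n) (\<beta> n) (W n) \<le> 2 * (t - s) * M"
      using that by (intro mult_left_mono) auto
    then show ?thesis using V(7)[OF that, of n] by (simp add: algebra_simps)
  qed
  obtain v k where k: "strict_mono (k :: nat \<Rightarrow> nat)" "\<And>s t. uniform_limit {s..t} (V \<circ> k) v sequentially"
    using subsequence_locally_uniform_limit[where V = V, OF bound hoelder] by metis
  have pw: "(\<lambda>n. V (k n) t) \<longlonglongrightarrow> v t" for t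
    using tendsto_uniform_limitI[OF k(2)[of t t], of t] by simp
  have "norm (v t) \<le> max R R'" for t
    by (rule tendsto_upperbound[OF tendsto_norm[OF pw]]) (use bound in auto)
  then have "bounded (range v)" unfolding bounded_iff by blast
  moreover have "v 0 \<in> \<Omega>"
    using closed_sequentially[OF compact_imp_closed[OF Z(1)] _ pw] Z(2,3) by blast
  ultimately have "limit_curve U g \<Omega> A B (V \<circ> k) (W \<circ> k) (\<alpha> \<circ> k) (\<beta> \<circ> k) v"
    by (unfold_locales) (use minimising_subseq[OF m k(1)] k(2) in auto)
  then show ?thesis using that by blast
qed

end

section \<open>Functions of class \<open>C\<^sup>2\<close>\<close>

text \<open>The derivative is represented by the vector \<open>adjoint f' 1\<close>, and uniqueness
  of the representing vector makes the definite description in \<open>gradient\<close> denote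
  it.\<close>

lemma C2_has_gradient:
  fixes f :: "real^'n \<Rightarrow> real"
  assumes "C2_function f"
  shows "(f has_derivative (\<lambda>h. gradient f x \<bullet> h)) (at x)"
proof -
  have "f differentiable (at x)" using assms by (auto simp: C2_function_def differentiable_on_def)
  then obtain f' where f': "(f has_derivative f') (at x)" by (auto simp: differentiable_def)
  have lin: "linear f'" using f' by (rule has_derivative_linear)
  have rep: "f' h = h \<bullet> adjoint f' 1" for h
    using adjoint_works[OF lin, of h 1] by simp
  have G: "GDERIV f x :> adjoint f' 1"
    using f' unfolding gderiv_def by (simp add: rep[symmetric])
  have "gradient f x = adjoint f' 1"
    unfolding gradient_def
  proof (rule the_equality[where P = "\<lambda>D. GDERIV f x :> D", OF G])
    fix D assume "GDERIV f x :> D"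
    then have "(\<lambda>h. h \<bullet> D) = f'"
      using has_derivative_unique[OF _ f'] unfolding gderiv_def by blast
    then have "\<forall>h. h \<bullet> D = h \<bullet> adjoint f' 1" using rep by metis
    then show "D = adjoint f' 1" by (simp add: vector_eq_ldot)
  qed
  then show ?thesis using G by (simp add: gderiv_def inner_commute)
qed

lemma C2_has_hessian:
  fixes f :: "real^'n \<Rightarrow> real"
  assumes "C2_function f"
  shows "(gradient f has_derivative (\<lambda>h. hessian f x *v h)) (at x)"
  using assms unfolding C2_function_def hessian_def jacobian_works[symmetric] differentiable_on_def
  by simp

lemma C2_gradient_continuous:
  fixes f :: "real^'n \<Rightarrow> real"
  assumes "C2_function f"
  shows "continuous_on UNIV (gradient f)"
  by (intro continuous_at_imp_continuous_on ballI has_derivative_continuous[OF C2_has_hessian[OF assms]])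

section \<open>Second-order behaviour near a critical point\<close>

lemma line_derivative:
  fixes f :: "'a::euclidean_space \<Rightarrow> real"
  assumes "\<And>x. (f has_derivative (\<lambda>h. g x \<bullet> h)) (at x)"
  shows "((\<lambda>s. f (x + s *\<^sub>R e)) has_real_derivative g (x + s *\<^sub>R e) \<bullet> e) (at s within S)"
proof -
  have "((\<lambda>s. x + s *\<^sub>R e) has_derivative (\<lambda>h. h *\<^sub>R e)) (at s within S)"
    by (auto intro!: derivative_eq_intros)
  from has_derivative_compose[OF this assms]
  show ?thesis by (simp add: has_field_derivative_def mult_commute_abs)
qed

text \<open>The second difference \<open>f(p+sh+sk) - f(p+sh) - f(p+sk) + f(p)\<close> is symmetric in \<open>h, k\<close> and
  equals \<open>s\<^sup>2 k \<bullet> H h + o(s\<^sup>2)\<close>.\<close>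

lemma second_derivative_symmetric:
  fixes f :: "'a::euclidean_space \<Rightarrow> real"
  assumes f: "\<And>x. (f has_derivative (\<lambda>h. g x \<bullet> h)) (at x)" and g: "(g has_derivative H) (at p)"
  shows "k \<bullet> H h = h \<bullet> H k"
proof -
  have lin: "linear H" by (rule has_derivative_linear[OF g])
  define D where "D s h k = f (p + s *\<^sub>R h + s *\<^sub>R k) - f (p + s *\<^sub>R h) - f (p + s *\<^sub>R k) + f p" for s h k
  have D: "\<exists>s0>0. \<forall>s. 0 < s \<longrightarrow> s < s0 \<longrightarrow> \<bar>D s h k - s\<^sup>2 * (k \<bullet> H h)\<bar> \<le> s\<^sup>2 * (eps * (2 * (norm h + norm k) * norm k))"
    if eps: "eps > 0" for eps h k
  proof -
    obtain d where d: "d > 0" "\<And>y. norm (y - p) < d \<Longrightarrow> norm (g y - g p - H (y - p)) \<le> eps * norm (y - p)"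
      using g eps unfolding has_derivative_at_alt by blast
    define K where "K = norm h + norm k"
    show ?thesis
    proof (intro exI[of _ "d / (K + 1)"] conjI allI impI)
      have K: "K \<ge> 0" by (simp add: K_def)
      then show "0 < d / (K + 1)" using d by simp
      fix s assume s: "0 < s" "s < d / (K + 1)"
      have "s * (K + 1) < d" using s(2) K by (simp add: pos_less_divide_eq)
      then have sK: "s * K < d" using s(1) by (simp add: algebra_simps)
      have approx: "norm (g (p + y) - g p - H y) \<le> eps * (s * K)" if "norm y \<le> s * K" for y
      proof -
        have "norm (g (p + y) - g p - H (p + y - p)) \<le> eps * norm (p + y - p)"
          by (rule d(2)) (use that sK in auto)
        also have "\<dots> \<le> eps * (s * K)" using that eps by (intro mult_left_mono) auto
        finally show ?thesis by simp
      qed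
      \<comment> \<open>The second difference is \<open>F 1 - F 0\<close>. The mean value theorem in
        \<open>u\<close> reduces it to a difference of two values of \<open>g\<close>, to which the
        linearisation at \<open>p\<close> applies.\<close>
      define F where "F u = f (p + s *\<^sub>R h + u *\<^sub>R (s *\<^sub>R k)) - f (p + u *\<^sub>R (s *\<^sub>R k))" for u
      have "\<exists>z::real. z > 0 \<and> z < 1 \<and> F 1 - F 0 = (1 - 0) * (g (p + s *\<^sub>R h + z *\<^sub>R (s *\<^sub>R k)) \<bullet> (s *\<^sub>R k) - g (p + z *\<^sub>R (s *\<^sub>R k)) \<bullet> (s *\<^sub>R k))"
        unfolding F_def by (rule MVT2[OF zero_less_one]) (rule DERIV_diff line_derivative[OF f])+
      then obtain z where z: "0 < z" "z < 1"
        "F 1 - F 0 = s * ((g (p + (s *\<^sub>R h + z *\<^sub>R (s *\<^sub>R k))) - g (p + z *\<^sub>R (s *\<^sub>R k))) \<bullet> k)"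
        by (auto simp: inner_diff_left algebra_simps)
      let ?a = "s *\<^sub>R h + z *\<^sub>R (s *\<^sub>R k)" and ?b = "z *\<^sub>R (s *\<^sub>R k)"
      have nb: "norm ?b \<le> s * norm k" using z s by (simp add: mult_left_le_one_le)
      have na: "norm ?a \<le> s * K"
        using norm_triangle_ineq[of "s *\<^sub>R h" ?b] nb s by (simp add: K_def algebra_simps)
      have nb': "norm ?b \<le> s * K"
        by (rule order_trans[OF nb]) (use s in \<open>simp add: K_def\<close>)
      have "H ?a - H ?b = s *\<^sub>R H h" by (simp add: linear_add[OF lin] linear_scale[OF lin])
      then have eq: "g (p + ?a) - g (p + ?b) - s *\<^sub>R H h = (g (p + ?a) - g p - H ?a) - (g (p + ?b) - g p - H ?b)"
        by (simp add: algebra_simps)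
      have n: "norm (g (p + ?a) - g (p + ?b) - s *\<^sub>R H h) \<le> 2 * (eps * (s * K))"
        unfolding eq
        by (rule order_trans[OF norm_triangle_ineq4]) (use approx[OF na] approx[OF nb'] in linarith)
      have "D s h k - s\<^sup>2 * (k \<bullet> H h) = s * ((g (p + ?a) - g (p + ?b) - s *\<^sub>R H h) \<bullet> k)"
      proof -
        have "D s h k = F 1 - F 0" by (simp add: D_def F_def)
        then show ?thesis unfolding z(3)
          by (simp add: inner_diff_left power2_eq_square inner_commute algebra_simps)
      qed
      then have "\<bar>D s h k - s\<^sup>2 * (k \<bullet> H h)\<bar> = s * \<bar>(g (p + ?a) - g (p + ?b) - s *\<^sub>R H h) \<bullet> k\<bar>"
        using s by (simp add: abs_mult)
      also have "\<dots> \<le> s * (2 * (eps * (s * K)) * norm k)"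
        using s n by (intro mult_left_mono order_trans[OF Cauchy_Schwarz_ineq2] mult_right_mono) auto
      also have "\<dots> = s\<^sup>2 * (eps * (2 * K * norm k))" by (simp add: power2_eq_square)
      finally show "\<bar>D s h k - s\<^sup>2 * (k \<bullet> H h)\<bar> \<le> s\<^sup>2 * (eps * (2 * (norm h + norm k) * norm k))"
        by (simp add: K_def)
    qed
  qed
  define C where "C = 2 * (norm h + norm k) * norm k + 2 * (norm k + norm h) * norm h"
  have "\<bar>k \<bullet> H h - h \<bullet> H k\<bar> \<le> eps * C" if eps: "eps > 0" for eps
  proof -
    obtain s1 s2 where s1: "s1 > 0" "\<And>s. 0 < s \<Longrightarrow> s < s1 \<Longrightarrow> \<bar>D s h k - s\<^sup>2 * (k \<bullet> H h)\<bar> \<le> s\<^sup>2 * (eps * (2 * (norm h + norm k) * norm k))"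
      and s2: "s2 > 0" "\<And>s. 0 < s \<Longrightarrow> s < s2 \<Longrightarrow> \<bar>D s k h - s\<^sup>2 * (h \<bullet> H k)\<bar> \<le> s\<^sup>2 * (eps * (2 * (norm k + norm h) * norm h))"
      using D[OF eps, of h k] D[OF eps, of k h] by blast
    define s where "s = min s1 s2 / 2"
    have s: "0 < s" "s < s1" "s < s2" using s1 s2 by (auto simp: s_def)
    have "D s h k = D s k h" by (simp add: D_def algebra_simps)
    then have "\<bar>s\<^sup>2 * (k \<bullet> H h) - s\<^sup>2 * (h \<bullet> H k)\<bar> \<le>
       s\<^sup>2 * (eps * (2 * (norm h + norm k) * norm k)) + s\<^sup>2 * (eps * (2 * (norm k + norm h) * norm h))"
      using s1(2)[OF s(1,2)] s2(2)[OF s(1,3)] by linarith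
    also have "\<dots> = s\<^sup>2 * (eps * C)" unfolding C_def by (simp add: algebra_simps)
    finally have "s\<^sup>2 * \<bar>k \<bullet> H h - h \<bullet> H k\<bar> \<le> s\<^sup>2 * (eps * C)"
      by (simp add: right_diff_distrib[symmetric] abs_mult)
    then show ?thesis using s(1) by simp
  qed
  note bound = this
  have "\<bar>k \<bullet> H h - h \<bullet> H k\<bar> \<le> 0"
  proof (rule field_le_epsilon)
    fix eps :: real assume eps: "eps > 0"
    have C: "C \<ge> 0" by (simp add: C_def)
    have "\<bar>k \<bullet> H h - h \<bullet> H k\<bar> \<le> eps / (C + 1) * C" using bound[of "eps / (C + 1)"] eps C by simp
    also have "\<dots> \<le> eps" using eps C by (simp add: field_simps)
    finally show "\<bar>k \<bullet> H h - h \<bullet> H k\<bar> \<le> 0 + eps" by simp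
  qed
  then show ?thesis by simp
qed

text \<open>If \<open>H e\<close> were nonzero, the quadratic form along
  \<open>e + t *\<^sub>R H e\<close> would have a nonzero linear term and no constant term, hence
  negative values.\<close>

lemma positive_semidefinite_null:
  fixes H :: "'a::euclidean_space \<Rightarrow> 'a"
  assumes lin: "linear H" and sym: "\<And>h k. k \<bullet> H h = h \<bullet> H k" and psd: "\<And>e. 0 \<le> e \<bullet> H e" and "e \<bullet> H e = 0"
  shows "H e = 0"
proof (rule ccontr)
  assume n: "H e \<noteq> 0"
  define k where "k = H e"
  define a where "a = k \<bullet> k"
  define b where "b = k \<bullet> H k"
  have a: "a > 0" using n by (simp add: a_def k_def)
  have b: "b \<ge> 0" using psd by (simp add: b_def)
  \<comment> \<open>The minimiser of the quadratic polynomial would be \<open>- a / b\<close>;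
    adding \<open>1\<close> avoids \<open>b = 0\<close> and still gives a negative value.\<close>
  define t where "t = - a / (b + 1)"
  have "(e + t *\<^sub>R k) \<bullet> H (e + t *\<^sub>R k) = 2 * t * a + t\<^sup>2 * b"
    using assms(4) sym[of e k]
    by (simp add: linear_add[OF lin] linear_scale[OF lin] inner_add_left inner_add_right a_def b_def
        power2_eq_square k_def[symmetric] distrib_left)
  also have "\<dots> = - (a\<^sup>2 * (b + 2) / (b + 1)\<^sup>2)"
    using b by (simp add: t_def power2_eq_square field_simps add_nonneg_eq_0_iff)
  also have "\<dots> < 0" using a b by (simp add: divide_pos_pos)
  finally show False using psd[of "e + t *\<^sub>R k"] by simp
qed

text \<open>By the mean value theorem \<open>f x = g (p + z *\<^sub>R h) \<bullet> h\<close> with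
  \<open>0 < z < 1\<close>. Near \<open>p\<close> the linearisation of \<open>g\<close> errs by at
  most half of the coercivity constant \<open>m\<close>, so the quadratic term wins.\<close>

lemma isolated_zero:
  fixes f :: "'a::euclidean_space \<Rightarrow> real"
  assumes f: "\<And>x. (f has_derivative (\<lambda>h. g x \<bullet> h)) (at x)" and g: "(g has_derivative H) (at p)"
    and "f p = 0" "g p = 0" and pd: "\<And>e. e \<noteq> 0 \<Longrightarrow> 0 < e \<bullet> H e"
  obtains r where "r > 0" "\<And>x. x \<in> ball p r \<Longrightarrow> x \<noteq> p \<Longrightarrow> f x > 0"
proof -
  have lin: "linear H" by (rule has_derivative_linear[OF g])
  obtain m where m: "m > 0" "\<And>e. norm e = 1 \<Longrightarrow> m \<le> e \<bullet> H e"
  proof (cases "sphere (0::'a) 1 = {}")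
    case True
    then show ?thesis using that[of 1] by auto
  next
    case False
    have "continuous_on (sphere 0 1) (\<lambda>e. e \<bullet> H e)"
      by (intro continuous_intros linear_continuous_on linear_conv_bounded_linear[THEN iffD1] lin)
    then obtain e where e: "e \<in> sphere 0 1" "\<And>y. y \<in> sphere 0 1 \<Longrightarrow> e \<bullet> H e \<le> y \<bullet> H y"
      using continuous_attains_inf[OF compact_sphere False] by blast
    moreover from e have "e \<noteq> 0" by auto
    ultimately show ?thesis using pd[of e] by (intro that[of "e \<bullet> H e"]) auto
  qed
  have m': "m * (norm h)\<^sup>2 \<le> h \<bullet> H h" for h
  proof (cases "h = 0")
    case False
    have "m \<le> (h /\<^sub>R norm h) \<bullet> H (h /\<^sub>R norm h)" using False by (intro m) simp
    then have "m \<le> (h \<bullet> H h) / (norm h)\<^sup>2"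
      by (simp add: linear_scale[OF lin] power2_eq_square field_simps)
    then show ?thesis using False by (simp add: pos_le_divide_eq)
  qed (simp add: linear_0[OF lin])
  obtain r where r: "r > 0" "\<And>y. norm (y - p) < r \<Longrightarrow> norm (g y - g p - H (y - p)) \<le> (m / 2) * norm (y - p)"
    using g half_gt_zero[OF m(1)] unfolding has_derivative_at_alt by blast
  show ?thesis
  proof (rule that[OF r(1)])
    fix x assume x: "x \<in> ball p r" "x \<noteq> p"
    define h where "h = x - p"
    have h: "h \<noteq> 0" "norm h < r" using x by (auto simp: h_def dist_norm norm_minus_commute)
    have "\<exists>z::real. z > 0 \<and> z < 1 \<and> f (p + 1 *\<^sub>R h) - f (p + 0 *\<^sub>R h) = (1 - 0) * (g (p + z *\<^sub>R h) \<bullet> h)"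
      by (rule MVT2) (auto intro!: line_derivative[OF f])
    then obtain z where z: "0 < z" "z < 1" "f x = g (p + z *\<^sub>R h) \<bullet> h"
      using assms(3) by (auto simp: h_def)
    have zh: "norm (z *\<^sub>R h) \<le> norm h" using z by (simp add: mult_left_le_one_le)
    have "norm (g (p + z *\<^sub>R h) - g p - H (p + z *\<^sub>R h - p)) \<le> (m / 2) * norm (p + z *\<^sub>R h - p)"
      by (rule r(2)) (use order.strict_trans1[OF zh h(2)] in simp)
    then have "norm (g (p + z *\<^sub>R h) - z *\<^sub>R H h) \<le> (m / 2) * (z * norm h)"
      using z assms(4) by (simp add: linear_scale[OF lin])
    then have "\<bar>(g (p + z *\<^sub>R h) - z *\<^sub>R H h) \<bullet> h\<bar> \<le> (m / 2) * (z * norm h) * norm h"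
      by (intro order_trans[OF Cauchy_Schwarz_ineq2] mult_right_mono) auto
    then have "f x \<ge> z * (h \<bullet> H h) - z * (m / 2 * (norm h)\<^sup>2)"
    proof -
      have "(g (p + z *\<^sub>R h) - z *\<^sub>R H h) \<bullet> h = f x - z * (h \<bullet> H h)"
        unfolding z(3) by (simp add: inner_diff_left inner_commute[of "H h" h])
      moreover have "(m / 2) * (z * norm h) * norm h = z * (m / 2 * (norm h)\<^sup>2)"
        by (simp add: power2_eq_square)
      ultimately show ?thesis
        using \<open>\<bar>(g (p + z *\<^sub>R h) - z *\<^sub>R H h) \<bullet> h\<bar> \<le> (m / 2) * (z * norm h) * norm h\<close> by linarith
    qed
    moreover have "z * (h \<bullet> H h) \<ge> z * (m * (norm h)\<^sup>2)" using m' z by (intro mult_left_mono) auto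
    moreover have "z * (m * (norm h)\<^sup>2) - z * (m / 2 * (norm h)\<^sup>2) > 0"
    proof -
      have "z * (m * (norm h)\<^sup>2) - z * (m / 2 * (norm h)\<^sup>2) = z * m * (norm h)\<^sup>2 / 2" by (simp add: algebra_simps)
      then show ?thesis using z m(1) h by simp
    qed
    ultimately show "f x > 0" by linarith
  qed
qed

lemma connected_meets_sphere:
  fixes S :: "'a::euclidean_space set"
  assumes "connected S" "p \<in> S" "y \<in> S" "0 < \<rho>" "\<rho> \<le> dist p y"
  obtains x where "x \<in> S" "dist p x = \<rho>"
proof -
  have "S \<inter> ball p \<rho> \<noteq> {}" "S - ball p \<rho> \<noteq> {}" using assms by auto
  from connected_Int_frontier[OF assms(1) this] obtain x where "x \<in> S" "x \<in> frontier (ball p \<rho>)" by blast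
  then show ?thesis using that assms(4) by (auto simp: frontier_ball)
qed

text \<open>Otherwise the Hessian is positive semidefinite and, being invertible, positive definite,
  so \<open>p\<close> is an isolated zero of \<open>U\<close>. But a connected set of zeros with
  more than one point meets all small spheres about \<open>p\<close>.\<close>

lemma negative_direction:
  fixes U :: "real^'n \<Rightarrow> real"
  assumes C2: "C2_function U" and hyp: "hyperbolic_critical_point U p" and "connected S" "p \<in> S" "diameter S > 0"
    and zero: "\<And>x. x \<in> S \<Longrightarrow> U x = 0"
  shows "\<exists>e. e \<bullet> (hessian U p *v e) < 0"
proof (rule ccontr)
  assume "\<not> ?thesis"
  then have psd: "0 \<le> e \<bullet> (hessian U p *v e)" for e by (simp add: not_less)
  note f = C2_has_gradient[OF C2] and g = C2_has_hessian[OF C2, of p]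
  have inv: "invertible (hessian U p)" and gp: "gradient U p = 0"
    using hyp by (auto simp: hyperbolic_critical_point_def critical_point_def)
  have pd: "0 < e \<bullet> (hessian U p *v e)" if "e \<noteq> 0" for e
  proof (rule ccontr)
    assume "\<not> ?thesis"
    then have "e \<bullet> (hessian U p *v e) = 0" using psd[of e] by simp
    then have "hessian U p *v e = 0"
      by (rule positive_semidefinite_null[OF has_derivative_linear[OF g] second_derivative_symmetric[OF f g] psd])
    then show False using inv that by (metis invertible_def matrix_vector_mul_assoc matrix_vector_mul_lid matrix_vector_mult_0_right)
  qed
  obtain r where r: "r > 0" "\<And>x. x \<in> ball p r \<Longrightarrow> x \<noteq> p \<Longrightarrow> U x > 0"
    using isolated_zero[OF f g zero[OF assms(4)] gp pd] by blast
  have "\<exists>y\<in>S. y \<noteq> p"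
  proof (rule ccontr)
    assume "\<not> ?thesis"
    then have "S = {p}" using assms(4) by blast
    then show False using assms(5) by simp
  qed
  then obtain y where y: "y \<in> S" "y \<noteq> p" by blast
  obtain x where "x \<in> S" "dist p x = min (r/2) (dist p y)"
    by (rule connected_meets_sphere[OF assms(3,4) y(1), of "min (r/2) (dist p y)"]) (use r y in auto)
  moreover from this r(1) y(2) have "x \<in> ball p r" "x \<noteq> p" by (auto simp: min_def split: if_splits)
  ultimately show False using r(2)[of x] zero[of x] by simp
qed

text \<open>The function \<open>k\<close> below is the claimed inequality along the segment. Its
  derivative vanishes at \<open>0\<close> and itself has nonpositive derivative, because the segment
  stays in the convex ball; two applications of the mean value theorem finish.\<close>

lemma concave_direction_forward:
  fixes f :: "'a::euclidean_space \<Rightarrow> real"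
  assumes f: "\<And>x. (f has_derivative (\<lambda>h. g x \<bullet> h)) (at x)" and g: "\<And>x. (g has_derivative H x) (at x)"
    and neg: "\<And>y. y \<in> ball p r \<Longrightarrow> e \<bullet> H y e \<le> - 2 * \<kappa>"
    and "x \<in> ball p r" "x + c *\<^sub>R e \<in> ball p r" "c \<ge> 0"
  shows "f (x + c *\<^sub>R e) \<le> f x + c * (g x \<bullet> e) - \<kappa> * c\<^sup>2"
proof (cases "c = 0")
  case False
  then have c: "0 < c" using assms by simp
  have in_ball: "x + s *\<^sub>R e \<in> ball p r" if "0 \<le> s" "s \<le> c" for s
  proof -
    have "x + s *\<^sub>R e = (1 - s / c) *\<^sub>R x + (s / c) *\<^sub>R (x + c *\<^sub>R e)"
      using c by (simp add: algebra_simps)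
    then show ?thesis
      using convexD[OF convex_ball assms(4,5), of "1 - s / c" "s / c"] that c by simp
  qed
  define k where "k s = f (x + s *\<^sub>R e) - s * (g x \<bullet> e) + \<kappa> * s\<^sup>2" for s
  define k' where "k' s = g (x + s *\<^sub>R e) \<bullet> e - g x \<bullet> e + 2 * \<kappa> * s" for s
  have k: "(k has_real_derivative k' s) (at s)" for s
    unfolding k_def k'_def by (auto intro!: derivative_eq_intros line_derivative[OF f])
  have k': "(k' has_real_derivative (H (x + s *\<^sub>R e) e \<bullet> e + 2 * \<kappa>)) (at s)" for s
  proof -
    have "((\<lambda>s. x + s *\<^sub>R e) has_derivative (\<lambda>h. h *\<^sub>R e)) (at s)"
      by (auto intro!: derivative_eq_intros)
    from has_derivative_compose[OF this g]
    have "((\<lambda>s. g (x + s *\<^sub>R e)) has_derivative (\<lambda>h. h *\<^sub>R H (x + s *\<^sub>R e) e)) (at s)"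
      by (simp add: linear_scale[OF has_derivative_linear[OF g]])
    from has_derivative_inner_left[OF this, of e]
    have "((\<lambda>s. g (x + s *\<^sub>R e) \<bullet> e) has_real_derivative H (x + s *\<^sub>R e) e \<bullet> e) (at s)"
      by (simp add: has_field_derivative_def mult_commute_abs)
    then show ?thesis unfolding k'_def by (auto intro!: derivative_eq_intros)
  qed
  obtain z where z: "0 < z" "z < c" "k c - k 0 = (c - 0) * k' z"
    using MVT2[OF c, of k k'] k by blast
  obtain z' where z': "0 < z'" "z' < z" "k' z - k' 0 = (z - 0) * (H (x + z' *\<^sub>R e) e \<bullet> e + 2 * \<kappa>)"
    using MVT2[OF z(1), of k' "\<lambda>s. H (x + s *\<^sub>R e) e \<bullet> e + 2 * \<kappa>"] k' by blast
  have "H (x + z' *\<^sub>R e) e \<bullet> e + 2 * \<kappa> \<le> 0"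
    using neg[OF in_ball, of z'] z z' by (simp add: inner_commute)
  then have "k' z - k' 0 \<le> 0" unfolding z'(3) using z(1) by (simp add: mult_le_0_iff)
  moreover have "k' 0 = 0" by (simp add: k'_def)
  ultimately have "k c - k 0 \<le> 0" unfolding z(3) using c by (simp add: mult_le_0_iff)
  then show ?thesis by (simp add: k_def)
qed simp

lemma concave_direction:
  fixes U :: "real^'n \<Rightarrow> real"
  assumes C2: "C2_function U" and neg: "e \<bullet> (hessian U p *v e) < 0"
  shows "concave_direction_at U (gradient U) p"
proof -
  \<comment> \<open>The form has the value \<open>- 4 * \<kappa>\<close> at \<open>p\<close>, so by
    continuity it stays below \<open>- 2 * \<kappa>\<close> nearby; the factor one half of the
    second-order term leaves \<open>\<kappa>\<close>.\<close>
  define \<kappa> where "\<kappa> = - (e \<bullet> (hessian U p *v e)) / 4"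
  have \<kappa>: "\<kappa> > 0" using neg by (simp add: \<kappa>_def)
  have hc: "continuous_on UNIV (hessian U)" using C2 by (simp add: C2_function_def)
  have "continuous_on UNIV (\<lambda>x. e \<bullet> (hessian U x *v e))"
    unfolding matrix_vector_mult_def inner_vec_def
    by (simp, intro continuous_intros hc)
  then have "isCont (\<lambda>x. e \<bullet> (hessian U x *v e)) p" by (simp add: continuous_on_eq_continuous_at)
  then obtain r where r: "r > 0" "\<And>x. dist x p < r \<Longrightarrow> dist (e \<bullet> (hessian U x *v e)) (e \<bullet> (hessian U p *v e)) < 2 * \<kappa>"
    unfolding continuous_at_eps_delta using \<kappa> by (elim allE[of _ "2 * \<kappa>"]) auto
  have neg': "e \<bullet> (hessian U y *v e) \<le> - 2 * \<kappa>" if "y \<in> ball p r" for y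
  proof -
    have "dist (e \<bullet> (hessian U y *v e)) (e \<bullet> (hessian U p *v e)) < 2 * \<kappa>"
      by (rule r(2)) (use that in \<open>simp add: dist_commute\<close>)
    then show ?thesis unfolding dist_real_def \<kappa>_def by linarith
  qed
  have "U (x + c *\<^sub>R e) \<le> U x + c * (gradient U x \<bullet> e) - \<kappa> * c\<^sup>2"
    if x: "x \<in> ball p r" "x + c *\<^sub>R e \<in> ball p r" for x c
  proof (cases "c \<ge> 0")
    case True
    then show ?thesis
      using concave_direction_forward[OF C2_has_gradient[OF C2] C2_has_hessian[OF C2] neg' x] by blast
  next
    case False
    \<comment> \<open>A negative step along \<open>e\<close> is a positive step along
      \<open>- e\<close>, for which the quadratic form has the same value.\<close>
    have "(- e) \<bullet> (hessian U y *v (- e)) \<le> - 2 * \<kappa>" if "y \<in> ball p r" for y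
      using neg'[OF that] by (simp add: linear_neg[OF matrix_vector_mul_linear])
    from concave_direction_forward[OF C2_has_gradient[OF C2] C2_has_hessian[OF C2] this x(1), of "- c"]
    show ?thesis using x(2) False by simp
  qed
  then show ?thesis using \<kappa> r(1) unfolding concave_direction_at_def by blast
qed

section \<open>The periodic orbit\<close>

lemma has_vector_derivative_left_right:
  fixes f :: "real \<Rightarrow> 'a::real_normed_vector"
  assumes "(f has_vector_derivative D) (at x within {l..x})" "(f has_vector_derivative D) (at x within {x..u})"
    and "l < x" "x < u"
  shows "(f has_vector_derivative D) (at x)"
proof -
  have "(f has_vector_derivative D) (at x within {l..x} \<union> {x..u})"
    using assms(1,2) unfolding has_vector_derivative_def has_derivative_within
    by (auto simp: at_within_union intro: filterlim_sup)
  moreover have "{l..x} \<union> {x..u} = {l..u}" using assms by auto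
  ultimately show ?thesis using assms(3,4) by (simp add: at_within_Icc_at)
qed

text \<open>The integral representation of \<open>f\<close>, valid from the interior alone, extends
  the derivative to the end points by continuity of \<open>f'\<close>. This carries Newton's
  equation up to the arrival times on the boundary.\<close>

lemma has_vector_derivative_closed_interval:
  fixes f :: "real \<Rightarrow> 'a::banach"
  assumes "continuous_on {a..b} f" "continuous_on {a..b} f'"
    and f': "\<And>t. t \<in> {a<..<b} \<Longrightarrow> (f has_vector_derivative f' t) (at t)" and t: "t \<in> {a..b}"
  shows "(f has_vector_derivative f' t) (at t within {a..b})"
proof -
  have eq: "f x = f a + integral {a..x} f'" if "x \<in> {a..b}" for x
  proof -
    have "(f' has_integral (f x - f a)) {a..x}"
      by (rule fundamental_theorem_of_calculus_interior)
         (use that f' continuous_on_subset[OF assms(1)] in auto)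
    then show ?thesis by (simp add: integral_unique)
  qed
  have "((\<lambda>x. f a + integral {a..x} f') has_vector_derivative f' t) (at t within {a..b})"
    using has_vector_derivative_add[OF has_vector_derivative_const integral_has_vector_derivative[OF assms(2) t]]
    by simp
  then show ?thesis
    by (rule has_vector_derivative_transform[OF t, rotated]) (rule eq)
qed

text \<open>The second-order equation contains no velocity and so survives time reversal. Since the
  velocity vanishes at both ends, forward and backward copies fit together with continuous velocity,
  and the accelerations match because they depend on the position only.\<close>

lemma reflect_periodically:
  fixes v w :: "real \<Rightarrow> 'a::real_normed_vector"
  assumes ab: "a < b"
    and v: "\<And>t. t \<in> {a..b} \<Longrightarrow> (v has_vector_derivative w t) (at t within {a..b})"
    and w: "\<And>t. t \<in> {a..b} \<Longrightarrow> (w has_vector_derivative f (v t)) (at t within {a..b})"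
    and ends: "w a = 0" "w b = 0"
  obtains X X' where "\<And>t. (X has_vector_derivative X' t) (at t)"
    "\<And>t. (X' has_vector_derivative f (X t)) (at t)"
    "\<And>t. X (t + 2 * (b - a)) = X t"
    "\<And>k::int. X (a + of_int k * (2 * (b - a))) = v a"
    "\<And>k::int. X (b + of_int k * (2 * (b - a))) = v b"
    "\<And>t. \<exists>s\<in>{a..b}. X t = v s \<and> norm (X' t) = norm (w s) \<and>
       (s = a \<longrightarrow> (\<exists>k::int. t = a + of_int k * (2 * (b - a)))) \<and>
       (s = b \<longrightarrow> (\<exists>k::int. t = b + of_int k * (2 * (b - a))))"
proof -
  define D where "D = b - a"
  have D: "D > 0" using ab by (simp add: D_def)
  define K where "K t = \<lfloor>(t - a) / D\<rfloor>" for t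
  \<comment> \<open>Folding of the line onto \<open>{a..b}\<close>: even pieces are translated, odd
    ones also reflected about the midpoint, so that they run backwards.\<close>
  define \<rho> where "\<rho> k t = (if even k then t - of_int k * D else a + b - (t - of_int k * D))" for k :: int and t
  define eps :: "int \<Rightarrow> real" where "eps k = (if even k then 1 else - 1)" for k
  define X where "X t = v (\<rho> (K t) t)" for t
  define X' where "X' t = eps (K t) *\<^sub>R w (\<rho> (K t) t)" for t
  define J where "J k = {a + of_int k * D..a + (of_int k + 1) * D}" for k :: int
  have K: "K t = k" if "a + of_int k * D \<le> t" "t < a + (of_int k + 1) * D" for t k
    unfolding K_def using that D by (intro floor_unique) (auto simp: field_simps)
  have K_bounds: "a + of_int (K t) * D \<le> t" "t < a + (of_int (K t) + 1) * D" for t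
  proof -
    have "of_int (K t) \<le> (t - a) / D" "(t - a) / D < of_int (K t) + 1" unfolding K_def by linarith+
    then show "a + of_int (K t) * D \<le> t" "t < a + (of_int (K t) + 1) * D" using D by (auto simp: field_simps)
  qed
  have \<rho>_in: "\<rho> k t \<in> {a..b}" if "t \<in> J k" for k t
    using that by (auto simp: \<rho>_def J_def D_def algebra_simps)
  \<comment> \<open>\<open>K\<close> assigns the right end of a closed piece to the next piece. Both
    formulas agree there: the folded point is the same, and the velocity is \<open>0\<close>, so the
    change of sign does no harm.\<close>
  have X_eq: "X t = v (\<rho> k t) \<and> X' t = eps k *\<^sub>R w (\<rho> k t)" if "t \<in> J k" for k t
  proof (cases "t = a + (of_int k + 1) * D")
    case True
    have Kt: "K t = k + 1" by (rule K) (use True D in \<open>auto simp: algebra_simps\<close>)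
    show ?thesis
    proof (cases "even k")
      case e: True
      have "\<rho> (k + 1) t = b" "\<rho> k t = b" using e True by (auto simp: \<rho>_def D_def algebra_simps)
      then show ?thesis using ends by (simp add: X_def X'_def Kt)
    next
      case o: False
      have "\<rho> (k + 1) t = a" "\<rho> k t = a" using o True by (auto simp: \<rho>_def D_def algebra_simps)
      then show ?thesis using ends by (simp add: X_def X'_def Kt)
    qed
  next
    case False
    then have "K t = k" using that by (intro K) (auto simp: J_def)
    then show ?thesis by (simp add: X_def X'_def)
  qed
  have \<rho>_deriv: "(\<rho> k has_vector_derivative eps k) (at t within S)" for k t S
  proof (cases "even k")
    case True
    have "\<rho> k = (\<lambda>t. t - of_int k * D)" "eps k = 1" using True by (auto simp: \<rho>_def eps_def)
    then show ?thesis by (auto intro!: derivative_eq_intros simp: has_vector_derivative_def)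
  next
    case False
    have "\<rho> k = (\<lambda>t. a + b - (t - of_int k * D))" "eps k = - 1" using False by (auto simp: \<rho>_def eps_def)
    then show ?thesis by (auto intro!: derivative_eq_intros simp: has_vector_derivative_def)
  qed
  have \<rho>_image: "\<rho> k ` J k \<subseteq> {a..b}" for k using \<rho>_in by blast
  have chain: "((\<lambda>t. u (\<rho> k t)) has_vector_derivative eps k *\<^sub>R u' (\<rho> k t)) (at t within J k)"
    if u: "\<And>t. t \<in> {a..b} \<Longrightarrow> (u has_vector_derivative u' t) (at t within {a..b})" and t: "t \<in> J k"
    for u u' :: "real \<Rightarrow> 'a" and k t
  proof -
    have "(u has_vector_derivative u' (\<rho> k t)) (at (\<rho> k t) within \<rho> k ` J k)"
      by (rule has_vector_derivative_within_subset[OF u[OF \<rho>_in[OF t]] \<rho>_image])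
    from vector_diff_chain_within[OF \<rho>_deriv this] show ?thesis by (simp add: o_def)
  qed
  have X_J: "(X has_vector_derivative X' t) (at t within J k)" if t: "t \<in> J k" for k t
  proof -
    have "((\<lambda>t. v (\<rho> k t)) has_vector_derivative eps k *\<^sub>R w (\<rho> k t)) (at t within J k)"
      by (rule chain[OF v t])
    then have "(X has_vector_derivative eps k *\<^sub>R w (\<rho> k t)) (at t within J k)"
      by (rule has_vector_derivative_transform[OF t, rotated]) (use X_eq in blast)
    then show ?thesis using X_eq[OF t] by simp
  qed
  have X'_J: "(X' has_vector_derivative f (X t)) (at t within J k)" if t: "t \<in> J k" for k t
  proof -
    \<comment> \<open>One sign comes from the chain rule and one from the definition of
      \<open>X'\<close>; their product is \<open>1\<close>.\<close>
    have sq: "eps k *\<^sub>R eps k *\<^sub>R f (v (\<rho> k t)) = f (v (\<rho> k t))" by (simp add: eps_def)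
    have "((\<lambda>t. w (\<rho> k t)) has_vector_derivative eps k *\<^sub>R f (v (\<rho> k t))) (at t within J k)"
      by (rule chain[OF w t])
    from bounded_linear.has_vector_derivative[OF bounded_linear_scaleR_right[of "eps k"] this]
    have "((\<lambda>t. eps k *\<^sub>R w (\<rho> k t)) has_vector_derivative f (v (\<rho> k t))) (at t within J k)"
      by (simp only: sq)
    then have "(X' has_vector_derivative f (v (\<rho> k t))) (at t within J k)"
      by (rule has_vector_derivative_transform[OF t, rotated]) (use X_eq in blast)
    then show ?thesis using X_eq[OF t] by simp
  qed
  have at: "(F has_vector_derivative F' t) (at t)"
    if F: "\<And>k t. t \<in> J k \<Longrightarrow> (F has_vector_derivative F' t) (at t within J k)" for F F' :: "real \<Rightarrow> 'a" and t
  proof -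
    define k where "k = K t"
    have k: "a + of_int k * D \<le> t" "t < a + (of_int k + 1) * D" using K_bounds by (auto simp: k_def)
    have r: "(F has_vector_derivative F' t) (at t within {t..a + (of_int k + 1) * D})"
      by (rule has_vector_derivative_within_subset[OF F[of t k]]) (use k in \<open>auto simp: J_def\<close>)
    show ?thesis
    proof (cases "t = a + of_int k * D")
      case True
      have "(F has_vector_derivative F' t) (at t within {a + of_int (k - 1) * D..t})"
        by (rule has_vector_derivative_within_subset[OF F[of t "k - 1"]])
           (use k True D in \<open>auto simp: J_def algebra_simps\<close>)
      then show ?thesis
        by (rule has_vector_derivative_left_right[OF _ r]) (use k True D in \<open>auto simp: algebra_simps\<close>)
    next
      case False
      have "(F has_vector_derivative F' t) (at t within {a + of_int k * D..t})"
        by (rule has_vector_derivative_within_subset[OF F[of t k]]) (use k in \<open>auto simp: J_def\<close>)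
      then show ?thesis
        by (rule has_vector_derivative_left_right[OF _ r]) (use k False in auto)
    qed
  qed
  show ?thesis
  proof (rule that[of X X'])
    show "(X has_vector_derivative X' t) (at t)" for t by (rule at[OF X_J])
    show "(X' has_vector_derivative f (X t)) (at t)" for t by (rule at[OF X'_J])
    show "X (t + 2 * (b - a)) = X t" for t
    proof -
      have "K (t + 2 * (b - a)) = K t + 2"
        by (rule K) (use K_bounds[of t] in \<open>auto simp: D_def algebra_simps\<close>)
      moreover have "\<rho> (K t + 2) (t + 2 * (b - a)) = \<rho> (K t) t"
        by (simp add: \<rho>_def D_def algebra_simps)
      ultimately show ?thesis by (simp add: X_def)
    qed
    show "X (a + of_int k * (2 * (b - a))) = v a" for k
    proof -
      have "K (a + of_int k * (2 * (b - a))) = 2 * k"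
        by (rule K) (use ab in \<open>auto simp: D_def algebra_simps\<close>)
      then show ?thesis by (simp add: X_def \<rho>_def D_def algebra_simps)
    qed
    show "X (b + of_int k * (2 * (b - a))) = v b" for k
    proof -
      \<comment> \<open>Since pieces are closed on the left, the times congruent to \<open>b\<close>
        belong to the odd pieces, as their left ends.\<close>
      have "K (b + of_int k * (2 * (b - a))) = 2 * k + 1"
        by (rule K) (use ab in \<open>auto simp: D_def algebra_simps\<close>)
      then show ?thesis by (simp add: X_def \<rho>_def D_def algebra_simps)
    qed
    show "\<exists>s\<in>{a..b}. X t = v s \<and> norm (X' t) = norm (w s) \<and>
       (s = a \<longrightarrow> (\<exists>k::int. t = a + of_int k * (2 * (b - a)))) \<and>
       (s = b \<longrightarrow> (\<exists>k::int. t = b + of_int k * (2 * (b - a))))" for t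
    proof (rule bexI[of _ "\<rho> (K t) t"], intro conjI impI)
      define k where "k = K t"
      have tJ: "t \<in> J k" using K_bounds[of t] by (auto simp: J_def k_def)
      show "\<rho> (K t) t \<in> {a..b}" using \<rho>_in[OF tJ] by (simp add: k_def)
      show "X t = v (\<rho> (K t) t)" by (simp add: X_def)
      show "norm (X' t) = norm (w (\<rho> (K t) t))" by (simp add: X'_def eps_def)
      show "\<exists>k::int. t = a + of_int k * (2 * (b - a))" if *: "\<rho> (K t) t = a"
      proof (cases "even k")
        case True
        then obtain m where m: "k = 2 * m" by (rule evenE)
        have "t = a + of_int m * (2 * (b - a))"
          using * True unfolding k_def[symmetric] by (simp add: \<rho>_def m D_def algebra_simps)
        then show ?thesis ..
      next
        case False
        then obtain m where m: "k = 2 * m + 1" by (rule oddE)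
        have "t = a + of_int (m + 1) * (2 * (b - a))"
          using * False unfolding k_def[symmetric] by (simp add: \<rho>_def m D_def algebra_simps)
        then show ?thesis ..
      qed
      show "\<exists>k::int. t = b + of_int k * (2 * (b - a))" if *: "\<rho> (K t) t = b"
      proof (cases "even k")
        case True
        then obtain m where m: "k = 2 * m" by (rule evenE)
        have "t = b + of_int m * (2 * (b - a))"
          using * True unfolding k_def[symmetric] by (simp add: \<rho>_def m D_def algebra_simps)
        then show ?thesis ..
      next
        case False
        then obtain m where m: "k = 2 * m + 1" by (rule oddE)
        have "t = b + of_int m * (2 * (b - a))"
          using * False unfolding k_def[symmetric] by (simp add: \<rho>_def m D_def algebra_simps)
        then show ?thesis ..
      qed
    qed
  qed
qed

context limit_curve
begin

text \<open>Makes \<open>forward_exit\<close> available at the \<open>A\<close> end.\<close>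

lemma limit_curve_reverse:
  "limit_curve U g \<Omega> B A (\<lambda>n t. V n (- t)) (\<lambda>n t. - W n (- t)) (\<lambda>n. - \<beta> n) (\<lambda>n. - \<alpha> n) (\<lambda>t. v (- t))"
proof -
  interpret rev: connection U g \<Omega> B A by (rule swap)
  show ?thesis
  proof
    show "rev.minimising (\<lambda>n t. V n (- t)) (\<lambda>n t. - W n (- t)) (\<lambda>n. - \<beta> n) (\<lambda>n. - \<alpha> n)"
      by (rule minimising_reverse[OF minimising])
    show "uniform_limit {s..t} (\<lambda>n t. V n (- t)) (\<lambda>t. v (- t)) sequentially" for s t
      by (rule uniform_limit_compose'[OF V_lim[of "- t" "- s"]]) auto
    have "range (\<lambda>t. v (- t)) \<subseteq> range v" by auto
    then show "bounded (range (\<lambda>t. v (- t)))" using bounded_subset[OF v_bounded] by blast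
    show "v (- 0) \<in> \<Omega>" using v0 by simp
  qed
qed

lemma connecting_orbit:
  assumes concave: "\<And>q. q \<in> frontier \<Omega> \<Longrightarrow> g q = 0 \<Longrightarrow> concave_direction_at U g q"
  obtains a b w where "a < b" "v a \<in> A" "v b \<in> B" "w a = 0" "w b = 0"
    "\<And>t. t \<in> {a<..<b} \<Longrightarrow> v t \<in> \<Omega>"
    "\<And>t. t \<in> {a..b} \<Longrightarrow> (norm (w t))\<^sup>2 / 2 = U (v t)"
    "\<And>t. t \<in> {a..b} \<Longrightarrow> (v has_vector_derivative w t) (at t within {a..b})"
    "\<And>t. t \<in> {a..b} \<Longrightarrow> (w has_vector_derivative g (v t)) (at t within {a..b})"
proof -
  obtain b where b: "b > 0" "v b \<in> B" "\<And>u. 0 \<le> u \<Longrightarrow> u < b \<Longrightarrow> v u \<in> \<Omega>"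
    "\<And>u. 0 \<le> u \<Longrightarrow> u < b \<Longrightarrow> (norm (vd u))\<^sup>2 / 2 = U (v u)"
    using forward_exit[OF concave] by blast
  have "\<exists>a'>0. v (- a') \<in> A \<and> (\<forall>u. 0 \<le> u \<longrightarrow> u < a' \<longrightarrow> v (- u) \<in> \<Omega>)"
    by (rule limit_curve.forward_exit[OF limit_curve_reverse]) (fact concave, blast)
  then obtain a' where a': "a' > 0" "v (- a') \<in> A" "\<And>u. 0 \<le> u \<Longrightarrow> u < a' \<Longrightarrow> v (- u) \<in> \<Omega>"
    by blast
  define a where "a = - a'"
  have a: "a < 0" "v a \<in> A" using a' by (auto simp: a_def)
  have in\<Omega>: "v t \<in> \<Omega>" if "t \<in> {a<..<b}" for t
    using b(3)[of t] a'(3)[of "- t"] that by (cases "0 \<le> t") (auto simp: a_def)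
  \<comment> \<open>The forward half has zero energy by \<open>forward_exit\<close>; conservation
    carries this across time \<open>0\<close> to the backward half.\<close>
  have energy: "(norm (vd t))\<^sup>2 / 2 = U (v t)" if t: "t \<in> {a<..<b}" for t
  proof -
    have "energy 0 = 0" using b(4)[of 0] b(1) by (simp add: energy_def)
    moreover have "energy t = energy 0"
    proof (cases "0 \<le> t")
      case True
      then show ?thesis by (intro energy_const in\<Omega>) (use t a in auto)
    next
      case False
      have "energy 0 = energy t" by (rule energy_const) (use False t b(1) in \<open>auto intro: in\<Omega>\<close>)
      then show ?thesis ..
    qed
    ultimately show ?thesis by (simp add: energy_def[of t])
  qed
  \<comment> \<open>\<open>vd\<close> is not known to be meaningful at the two boundary times, so
    the value \<open>0\<close> dictated by the energy is prescribed there.\<close>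
  define w where "w t = (if t \<in> {a<..<b} then vd t else 0)" for t
  have U_ends: "U (v a) = 0" "U (v b) = 0" using U_frontier AB a b by blast+
  have w_norm: "norm (w t) = sqrt (2 * U (v t))" if "t \<in> {a..b}" for t
  proof (cases "t \<in> {a<..<b}")
    case True
    have "norm (w t) = sqrt ((norm (w t))\<^sup>2)" by simp
    also have "(norm (w t))\<^sup>2 = 2 * U (v t)" using energy[OF True] True by (simp add: w_def)
    finally show ?thesis .
  next
    case False
    then have "t = a \<or> t = b" using that by auto
    then show ?thesis using U_ends False by (auto simp: w_def)
  qed
  have v_at: "(v has_vector_derivative w t) (at t)" and w_at: "(w has_vector_derivative g (v t)) (at t)"
    if t: "t \<in> {a<..<b}" for t
  proof -
    show "(v has_vector_derivative w t) (at t)" using v_deriv[OF in\<Omega>[OF t]] t by (simp add: w_def)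
    show "(w has_vector_derivative g (v t)) (at t)"
      by (rule has_vector_derivative_transform_within_open[OF vd_deriv[OF in\<Omega>[OF t]] open_greaterThanLessThan t])
         (simp add: w_def)
  qed
  have w_cont: "continuous_on {a..b} w"
    unfolding continuous_on_eq_continuous_within
  proof
    fix t assume t: "t \<in> {a..b}"
    show "continuous (at t within {a..b}) w"
    proof (cases "t \<in> {a<..<b}")
      case True
      then show ?thesis
        using has_vector_derivative_continuous[OF w_at] continuous_at_imp_continuous_at_within by blast
    next
      case False
      then have wt: "w t = 0" unfolding w_def by (rule if_not_P)
      \<comment> \<open>At the end points continuity of the velocity comes from the energy relation:
        its norm is \<open>sqrt (2 * U (v t))\<close>, which tends to \<open>0\<close>.\<close>
      have "continuous_on {a..b} (\<lambda>t. sqrt (2 * U (v t)))" by (intro continuous_intros Uv_cont)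
      then have "continuous_on {a..b} (\<lambda>t. norm (w t))"
        by (rule continuous_on_eq) (simp add: w_norm)
      then have "((\<lambda>t. norm (w t)) \<longlongrightarrow> norm (w t)) (at t within {a..b})"
        using t by (simp add: continuous_on_def)
      then show ?thesis
        unfolding continuous_within wt by (simp add: tendsto_norm_zero_iff)
    qed
  qed
  show ?thesis
  proof (rule that[of a b w])
    show "a < b" using a b by simp
    show "w a = 0" "w b = 0" by (auto simp: w_def)
    show "(norm (w t))\<^sup>2 / 2 = U (v t)" if "t \<in> {a..b}" for t
      unfolding w_norm[OF that] using U_nonneg[OF v_closure] by simp
    show "(v has_vector_derivative w t) (at t within {a..b})" if "t \<in> {a..b}" for t
      by (rule has_vector_derivative_closed_interval[OF v_cont w_cont v_at that])
    show "(w has_vector_derivative g (v t)) (at t within {a..b})" if "t \<in> {a..b}" for t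
      by (rule has_vector_derivative_closed_interval[OF w_cont gv_cont w_at that])
  qed (use a b in\<Omega> in auto)
qed

end

text \<open>A component is relatively closed in the set where \<open>U\<close> is positive, so a
  frontier point with positive \<open>U\<close> would belong to it; but a component of an open set
  is open and contains none of its frontier.\<close>

lemma frontier_component_zero:
  fixes U :: "'a::euclidean_space \<Rightarrow> real"
  assumes U: "continuous_on UNIV U" and C: "C \<in> components {x. U x > 0}" and x: "x \<in> frontier C"
  shows "U x = 0"
proof (rule antisym)
  have op: "open {x. U x > 0}" using U by (intro open_Collect_less) auto
  show "U x \<le> 0"
  proof (rule ccontr)
    assume "\<not> ?thesis"
    then have xS: "x \<in> {x. U x > 0}" by simp
    obtain T where T: "closed T" "C = {x. U x > 0} \<inter> T"
      using closedin_component[OF C] by (auto simp: closedin_closed)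
    have "closure C \<subseteq> T" using T by (simp add: closure_minimal)
    then have "x \<in> C" using x xS T(2) by (auto simp: frontier_def)
    then show False using x open_components[OF op C] by (auto simp: frontier_def interior_open)
  qed
  have "closed {x. 0 \<le> U x}" using U by (intro closed_Collect_le) auto
  moreover have "C \<subseteq> {x. 0 \<le> U x}" using in_components_subset[OF C] by (auto intro: less_imp_le)
  ultimately have "closure C \<subseteq> {x. 0 \<le> U x}" by (rule closure_minimal[rotated])
  then show "0 \<le> U x" using x by (auto simp: frontier_def)
qed

theorem corollary1p5:
  fixes U :: "real^'n \<Rightarrow> real"
    and \<Omega> :: "(real^'n) set"
    and N :: nat
    and \<Gamma> :: "nat \<Rightarrow> (real^'n) set"
  assumes U_C2: "C2_function U"
    and Omega: "\<Omega> \<in> components {x. U x > 0}"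
    and boundary_compact: "compact (frontier \<Omega>)"
    and boundary_components: "bij_betw \<Gamma> {1..N} (components (frontier \<Omega>))"
    and positive_diameter: "\<forall>i\<in>{1..N}. diameter (\<Gamma> i) > 0"
    and N_ge_2: "N \<ge> 2"
    and growth: "\<not> bounded \<Omega> \<longrightarrow>
          (\<exists>r0>0. \<exists>\<sigma> :: real \<Rightarrow> real.
             (\<forall>r\<ge>r0. \<sigma> r \<ge> 0) \<and>
             improper_integral_diverges \<sigma> r0 \<and>
             (\<forall>x\<in>\<Omega>. norm x \<ge> r0 \<longrightarrow> sqrt (U x) \<ge> \<sigma> (norm x)))"
    and finite_P: "finite {p \<in> frontier \<Omega>. critical_point U p}"
    and hyperbolic: "\<forall>p\<in>{p \<in> frontier \<Omega>. critical_point U p}. hyperbolic_critical_point U p"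
  shows "\<forall>\<Gamma>\<^sub>m \<in> \<Gamma> ` {1..N}. \<exists>\<Gamma>\<^sub>p \<in> \<Gamma> ` {1..N} - {\<Gamma>\<^sub>m}.
           \<exists>T\<^sub>m T\<^sub>p :: real. T\<^sub>m < T\<^sub>p \<and>
             (\<exists>(v :: real \<Rightarrow> real^'n) v' :: real \<Rightarrow> real^'n.
                let T = 2 * (T\<^sub>p - T\<^sub>m) in
                  (\<forall>t. v t \<in> closure \<Omega>) \<and>
                  (\<forall>t. v (t + T) = v t) \<and>
                  (\<forall>t. (v has_vector_derivative v' t) (at t)) \<and>
                  (\<forall>t. (v' has_vector_derivative gradient U (v t)) (at t)) \<and>
                  (\<forall>t. 1/2 * (norm (v' t))^2 - U (v t) = 0) \<and>
                  (\<forall>k::int. v (T\<^sub>m + of_int k * T) \<in> \<Gamma>\<^sub>m) \<and>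
                  (\<forall>k::int. v (T\<^sub>p + of_int k * T) \<in> \<Gamma>\<^sub>p) \<and>
                  (\<forall>t. (\<forall>k::int. t \<noteq> T\<^sub>m + of_int k * T \<and> t \<noteq> T\<^sub>p + of_int k * T)
                        \<longrightarrow> v t \<in> \<Omega>))"
proof
  fix \<Gamma>m assume \<Gamma>m: "\<Gamma>m \<in> \<Gamma> ` {1..N}"
  let ?g = "gradient U"
  have comps: "\<Gamma> ` {1..N} = components (frontier \<Omega>)"
    using boundary_components by (simp add: bij_betw_def)
  then have fin: "finite (components (frontier \<Omega>))" by (metis finite_atLeastAtMost finite_imageI)
  have A: "\<Gamma>m \<in> components (frontier \<Omega>)" using \<Gamma>m comps by simp
  have comp_compact: "compact C" if "C \<in> components (frontier \<Omega>)" for C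
    by (rule compact_components[OF boundary_compact that])
  \<comment> \<open>The target component is not prescribed: the minimisation runs towards all the
    others at once, and the arrival point of the orbit selects \<open>\<Gamma>p\<close> at the
    end.\<close>
  define B where "B = \<Union> (components (frontier \<Omega>) - {\<Gamma>m})"
  have U_cont: "continuous_on UNIV U"
    by (intro continuous_at_imp_continuous_on ballI has_derivative_continuous[OF C2_has_gradient[OF U_C2]])
  have zero: "U x = 0" if "x \<in> frontier \<Omega>" for x
    by (rule frontier_component_zero[OF U_cont Omega that])
  have op: "open {x. U x > 0}" using U_cont by (intro open_Collect_less) auto
  have "card (components (frontier \<Omega>)) = N"
    using bij_betw_same_card[OF boundary_components] by simp
  then have "components (frontier \<Omega>) - {\<Gamma>m} \<noteq> {}"
    using N_ge_2 A fin card_mono[of "{\<Gamma>m}" "components (frontier \<Omega>)"] by (auto simp: Diff_eq_empty_iff)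
  then obtain C0 where C0: "C0 \<in> components (frontier \<Omega>)" "C0 \<noteq> \<Gamma>m" by blast
  have conn: "connection U ?g \<Omega> \<Gamma>m B"
  proof
    show "(U has_derivative (\<lambda>h. ?g x \<bullet> h)) (at x)" for x by (rule C2_has_gradient[OF U_C2])
    show "continuous_on UNIV ?g" by (rule C2_gradient_continuous[OF U_C2])
    show "open \<Omega>" by (rule open_components[OF op Omega])
    show "connected \<Omega>" by (rule in_components_connected[OF Omega])
    show "0 < U x" if "x \<in> \<Omega>" for x using in_components_subset[OF Omega] that by blast
    show "compact \<Gamma>m" by (rule comp_compact[OF A])
    show "compact B" unfolding B_def using fin comp_compact by (intro compact_Union) auto
    show "\<Gamma>m \<union> B = frontier \<Omega>"
    proof -
      have "\<Gamma>m \<union> B = \<Union> (components (frontier \<Omega>))" unfolding B_def using A by blast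
      then show ?thesis using Union_components[of "frontier \<Omega>"] by simp
    qed
    show "\<Gamma>m \<inter> B = {}"
      unfolding B_def using A components_nonoverlap by blast
    show "\<Gamma>m \<noteq> {}" by (rule in_components_nonempty[OF A])
    show "B \<noteq> {}" unfolding B_def using C0 in_components_nonempty[OF C0(1)] by auto
  qed (rule zero)
  have concave: "concave_direction_at U ?g q" if q: "q \<in> frontier \<Omega>" "?g q = 0" for q
  proof -
    have hyp: "hyperbolic_critical_point U q" using hyperbolic q by (simp add: critical_point_def)
    obtain C where C: "C \<in> components (frontier \<Omega>)" "q \<in> C"
      using q(1) Union_components[of "frontier \<Omega>"] by blast
    then obtain i where "i \<in> {1..N}" "C = \<Gamma> i" using comps by (metis imageE)
    then have "diameter C > 0" using positive_diameter by simp
    moreover have "U x = 0" if "x \<in> C" for x using zero in_components_subset[OF C(1)] that by blast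
    ultimately show ?thesis
      using negative_direction[OF U_C2 hyp in_components_connected[OF C(1)] C(2)] concave_direction[OF U_C2]
      by blast
  qed
  obtain V W \<alpha> \<beta> v where lc: "limit_curve U ?g \<Omega> \<Gamma>m B V W \<alpha> \<beta> v"
    using connection.limit_curve_exists[OF conn growth[folded radial_growth_def]] by blast
  interpret limit_curve U ?g \<Omega> \<Gamma>m B V W \<alpha> \<beta> v by (rule lc)
  obtain a b w where ab: "a < b" "v a \<in> \<Gamma>m" "v b \<in> B" "w a = 0" "w b = 0"
    and v\<Omega>: "\<And>t. t \<in> {a<..<b} \<Longrightarrow> v t \<in> \<Omega>"
    and energy: "\<And>t. t \<in> {a..b} \<Longrightarrow> (norm (w t))\<^sup>2 / 2 = U (v t)"
    and vw: "\<And>t. t \<in> {a..b} \<Longrightarrow> (v has_vector_derivative w t) (at t within {a..b})"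
      "\<And>t. t \<in> {a..b} \<Longrightarrow> (w has_vector_derivative ?g (v t)) (at t within {a..b})"
    using connecting_orbit[OF concave] by blast
  obtain X X' where X: "\<And>t. (X has_vector_derivative X' t) (at t)"
    "\<And>t. (X' has_vector_derivative ?g (X t)) (at t)"
    "\<And>t. X (t + 2 * (b - a)) = X t"
    "\<And>k::int. X (a + of_int k * (2 * (b - a))) = v a"
    "\<And>k::int. X (b + of_int k * (2 * (b - a))) = v b"
    "\<And>t. \<exists>s\<in>{a..b}. X t = v s \<and> norm (X' t) = norm (w s) \<and>
       (s = a \<longrightarrow> (\<exists>k::int. t = a + of_int k * (2 * (b - a)))) \<and>
       (s = b \<longrightarrow> (\<exists>k::int. t = b + of_int k * (2 * (b - a))))"
    using reflect_periodically[OF ab(1) vw ab(4,5)] by blast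
  obtain \<Gamma>p where \<Gamma>p: "\<Gamma>p \<in> components (frontier \<Omega>) - {\<Gamma>m}" "v b \<in> \<Gamma>p"
    using ab(3) by (auto simp: B_def)
  have "X t \<in> closure \<Omega>" for t using X(6)[of t] v_closure by auto
  moreover have "1/2 * (norm (X' t))\<^sup>2 - U (X t) = 0" for t
    using X(6)[of t] energy by auto
  moreover have "X t \<in> \<Omega>"
    if t: "\<forall>k::int. t \<noteq> a + of_int k * (2 * (b - a)) \<and> t \<noteq> b + of_int k * (2 * (b - a))" for t
  proof -
    obtain s where "s \<in> {a..b}" "X t = v s" "s \<noteq> a" "s \<noteq> b" using X(6)[of t] t by blast
    then show ?thesis using v\<Omega>[of s] by auto
  qed
  ultimately show "\<exists>\<Gamma>\<^sub>p \<in> \<Gamma> ` {1..N} - {\<Gamma>m}.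
           \<exists>T\<^sub>m T\<^sub>p :: real. T\<^sub>m < T\<^sub>p \<and>
             (\<exists>(v :: real \<Rightarrow> real^'n) v' :: real \<Rightarrow> real^'n.
                let T = 2 * (T\<^sub>p - T\<^sub>m) in
                  (\<forall>t. v t \<in> closure \<Omega>) \<and>
                  (\<forall>t. v (t + T) = v t) \<and>
                  (\<forall>t. (v has_vector_derivative v' t) (at t)) \<and>
                  (\<forall>t. (v' has_vector_derivative gradient U (v t)) (at t)) \<and>
                  (\<forall>t. 1/2 * (norm (v' t))^2 - U (v t) = 0) \<and>
                  (\<forall>k::int. v (T\<^sub>m + of_int k * T) \<in> \<Gamma>m) \<and>
                  (\<forall>k::int. v (T\<^sub>p + of_int k * T) \<in> \<Gamma>\<^sub>p) \<and>
                  (\<forall>t. (\<forall>k::int. t \<noteq> T\<^sub>m + of_int k * T \<and> t \<noteq> T\<^sub>p + of_int k * T)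
                        \<longrightarrow> v t \<in> \<Omega>))"
    using X ab \<Gamma>p comps unfolding Let_def
    by (intro bexI[of _ \<Gamma>p] exI[of _ a] exI[of _ b] exI[of _ X] exI[of _ X'] conjI allI impI) auto
qed

end
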